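(* Let $N\ge1$, let $\Gamma_N=(\gamma_N^2(i,j))_{i,j=1,\dots,N}$ be a symmetric matrix with nonnegative entries, and put $\gamma_{\max}^2=\max_{i,j}\gamma_N^2(i,j)$. Let $X_N$ be a GUE matrix with variance profile $\Gamma_N$, let $Y_N$ be a deterministic $N\times N$ Hermitian matrix which is diagonal, and $H_N=X_N+Y_N$. Let $Z_N=U_{N,k}\Theta_kU_{N,k}^*$ be a deterministic Hermitian matrix of rank $k$, where $\Theta_k$ is a $k\times k$ real diagonal matrix with nonzero diagonal entries and $U_{N,k}$ is an $N\times k$ matrix with orthonormal columns. For $\lambda\in\mathbb C^+$ define $$\beta_k(\lambda)=\mathbb I_k-U_{N,k}^*(\lambda\mathbb I_N-X_N-Y_N)^{-1}U_{N,k}\Theta_k,\qquad \beta_k^\square(\lambda)=\mathbb I_k-U_{N,k}^*G_{H_N}^\square(\lambda\mathbb I_N)U_{N,k}\Theta_k .$$ Let $0<\delta<1$. Then for any $\lambda$ with $\operatorname{Im}\lambda\ge\gamma_{\max}N^{-1/4}(1-\delta)^{-1/6}$, $\beta_k^\square(\lambda)$ is a deterministic equivalent of $\beta_k(\lambda)$, in the sense that for any $d>0$, $$\mathbb P\big(\|\beta_k(\lambda)-\beta_k^\square(\lambda)\|\ge\|\Theta_k\|\,\varepsilon_N'(d)\big)\le4k^2N^{-d},$$ where $$\varepsilon_N'(d)=\sqrt2\,k\,\gamma_{\max}\frac{\sqrt{d\log N}}{|\operatorname{Im}\lambda|^2}N^{-1/2}+\Big(1+\frac{\gamma_{\max}^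2}{\delta|\operatorname{Im}\lambda|^2}\Big)\frac{\gamma_{\max}^4}{N^{3/2}(\operatorname{Im}\lambda)^5}.$$
   Context: $\mathbb C^+$ is the open upper half plane; $\|\cdot\|$ is the operator norm; $\mathbb I_n$ is the $n\times n$ identity. A GUE matrix of size $N$ with variance profile $\Gamma_N=(\gamma_N^2(i,j))$ (with $\gamma_N(i,j)\ge 0$) is the Hermitian random matrix $X_N=\big(\gamma_N(i,j)x_{i,j}/\sqrt N\big)_{i,j}$, where $x_{j,i}=\overline{x_{i,j}}$, the variables $(x_{i,j})_{i\ge j}$ are independent, $x_{i,i}$ is a centered real Gaussian of variance $1$, and for $i\ne j$ $x_{i,j}$ is a centered complex Gaussian of variance $1$ (real and imaginary parts independent, each of variance $1/2$). $\mathrm D_N(\mathbb C)^+$ (resp. $\mathrm D_N(\mathbb C)^-$) is the set of $N\times N$ complex diagonal matrices all of whose diagonal entries have positive (resp. negative) imaginary part; $\Delta(A)$ is the diagonal matrix with the same diagonal entries as $A$; for a diagonal matrix $\Lambda$, $\mathcal R_N(\Lambda)=\mathrm{diag}_{i}\big(\sum_{j=1}^N\frac{\gamma_N^2(i,j)}{N}\Lambda(j,j)\big)$. $G_{H_N}^\square:\mathrm D_N(\mathbb C)^+\to\mathrm D_N(\mathbb C)^-$ is the unique function, analytic in each variable, satisfying $G_{H_N}^\square(\Lambda)=\Delta\big[(\Lambda-\mathcal R_N(G_{H_N}^\square(\Lambda))-Y_N)^{-1}\big]$ for all $\Lambda\in \mathrm D_N(\mathbb C)^+$ (such a function exists and is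 unique).
   Formalization: The formal theorem assumes γ_max > 0 (and k ≥ 1); for Γ_N = 0 one has β_k = β_k^□ and ε'_N = 0, so the event has probability 1 and the stated bound fails for N ≥ 2 and large d. *)

theory Defs
  imports "HOL-Probability.Probability" "HOL-Complex_Analysis.Complex_Analysis"
begin

section \<open>Complex matrices\<close>

text \<open>An N x k complex matrix has type \<open>complex^'k^'n\<close>, with \<open>N = CARD('n)\<close> and \<open>k = CARD('k)\<close>.\<close>

definition conj_transpose :: "complex^'m^'n \<Rightarrow> complex^'n^'m" where
  "conj_transpose A = (\<chi> i j. cnj (A $ j $ i))"

definition hermitian_matrix :: "complex^'n^'n \<Rightarrow> bool" where
  "hermitian_matrix A \<longleftrightarrow> conj_transpose A = A"

definition diagonal_matrix :: "'a::zero^'n^'n \<Rightarrow> bool" where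
  "diagonal_matrix A \<longleftrightarrow> (\<forall>i j. i \<noteq> j \<longrightarrow> A $ i $ j = 0)"

text \<open>Operator norm for the Euclidean norms on the spaces \<open>complex^'m\<close> and \<open>complex^'n\<close>
  (the library's \<open>norm\<close> on matrices is the Frobenius norm).\<close>

definition op_norm :: "complex^'m^'n \<Rightarrow> real" where
  "op_norm A = onorm (\<lambda>v. A *v v)"

definition orthonormal_columns :: "complex^'k^'n \<Rightarrow> bool" where
  "orthonormal_columns U \<longleftrightarrow> conj_transpose U ** U = mat 1"

definition diag_part :: "'a::zero^'n^'n \<Rightarrow> 'a^'n^'n" where
  "diag_part A = (\<chi> i j. if i = j then A $ i $ i else 0)"

section \<open>GUE matrices with a variance profile\<close>

text \<open>A variance profile \<open>\<Gamma>\<close> has the entries \<open>\<gamma>(i,j)\<^sup>2\<close>, so that \<open>\<gamma>(i,j) = sqrt (\<Gamma> $ i $ j)\<close>.\<close>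

definition gamma_max_sq :: "real^'n^'n \<Rightarrow> real" where
  "gamma_max_sq \<Gamma> = Max {\<Gamma> $ i $ j | i j. True}"

definition gamma_max :: "real^'n^'n \<Rightarrow> real" where
  "gamma_max \<Gamma> = sqrt (gamma_max_sq \<Gamma>)"

text \<open>In \<open>normal_density \<mu> \<sigma>\<close> the parameter \<open>\<sigma>\<close> is the standard deviation. The diagonal
  variables are real because of the symmetry condition with \<open>i = j\<close>.\<close>

definition standard_gue_array :: "'w measure \<Rightarrow> ('n::linorder \<Rightarrow> 'n \<Rightarrow> 'w \<Rightarrow> complex) \<Rightarrow> bool" where
  "standard_gue_array M x \<longleftrightarrow>
     (\<forall>i j. \<forall>\<omega>\<in>space M. x j i \<omega> = cnj (x i j \<omega>)) \<and>
     prob_space.indep_vars M (\<lambda>_. borel) (\<lambda>(i, j). x i j) {(i, j). j \<le> i} \<and>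
     (\<forall>i. distributed M lborel (\<lambda>\<omega>. Re (x i i \<omega>)) (normal_density 0 1)) \<and>
     (\<forall>i j. i \<noteq> j \<longrightarrow>
        distributed M lborel (\<lambda>\<omega>. Re (x i j \<omega>)) (normal_density 0 (sqrt (1/2))) \<and>
        distributed M lborel (\<lambda>\<omega>. Im (x i j \<omega>)) (normal_density 0 (sqrt (1/2))) \<and>
        prob_space.indep_var M borel (\<lambda>\<omega>. Re (x i j \<omega>)) borel (\<lambda>\<omega>. Im (x i j \<omega>)))"

definition gue_with_profile ::
  "'w measure \<Rightarrow> real^'n::{finite,linorder}^'n::{finite,linorder} \<Rightarrow> ('w \<Rightarrow> complex^'n::{finite,linorder}^'n::{finite,linorder}) \<Rightarrow> bool" where
  "gue_with_profile M \<Gamma> X \<longleftrightarrow>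
     (\<exists>x. standard_gue_array M x \<and>
        (\<forall>\<omega>\<in>space M. \<forall>i j.
           X \<omega> $ i $ j = of_real (sqrt (\<Gamma> $ i $ j)) * x i j \<omega> / of_real (sqrt (real CARD('n)))))"

section \<open>The deterministic equivalent\<close>

definition D_plus :: "(complex^'n^'n) set" where
  "D_plus = {\<Lambda>. diagonal_matrix \<Lambda> \<and> (\<forall>i. 0 < Im (\<Lambda> $ i $ i))}"

definition D_minus :: "(complex^'n^'n) set" where
  "D_minus = {\<Lambda>. diagonal_matrix \<Lambda> \<and> (\<forall>i. Im (\<Lambda> $ i $ i) < 0)}"

definition R_map :: "real^'n^'n \<Rightarrow> complex^'n^'n \<Rightarrow> complex^'n^'n" where
  "R_map \<Gamma> \<Lambda> = (\<chi> i j. if i = j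
      then (\<Sum>l\<in>UNIV. of_real (\<Gamma> $ i $ l / real CARD('n)) * \<Lambda> $ l $ l) else 0)"

definition update_diag :: "complex^'n^'n \<Rightarrow> 'n \<Rightarrow> complex \<Rightarrow> complex^'n^'n" where
  "update_diag \<Lambda> i z = (\<chi> a b. if a = i \<and> b = i then z else \<Lambda> $ a $ b)"

text \<open>\<open>G_square \<Gamma> Y G\<close>: on \<open>D_plus\<close>, the function \<open>G\<close> is the deterministic equivalent
  associated with the profile \<open>\<Gamma>\<close> and the Hermitian matrix \<open>Y\<close>. These conditions determine \<open>G\<close> on
  \<open>D_plus\<close>; its values elsewhere are irrelevant. The inverted matrix is invertible, as \<open>Y\<close> is
  Hermitian and the diagonal entries of \<open>\<Lambda> - R_map \<Gamma> (G \<Lambda>)\<close> have positive imaginary part.\<close>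

definition G_square ::
  "real^'n^'n \<Rightarrow> complex^'n^'n \<Rightarrow> (complex^'n^'n \<Rightarrow> complex^'n^'n) \<Rightarrow> bool" where
  "G_square \<Gamma> Y G \<longleftrightarrow>
     G ` D_plus \<subseteq> D_minus \<and>
     (\<forall>\<Lambda>\<in>D_plus. \<forall>i l. (\<lambda>z. G (update_diag \<Lambda> i z) $ l $ l) analytic_on {z. 0 < Im z}) \<and>
     (\<forall>\<Lambda>\<in>D_plus. G \<Lambda> = diag_part (matrix_inv (\<Lambda> - R_map \<Gamma> (G \<Lambda>) - Y)))"

definition beta ::
  "complex^'k^'n \<Rightarrow> complex^'k^'k \<Rightarrow> complex^'n^'n \<Rightarrow> complex^'n^'n \<Rightarrow> complex \<Rightarrow> complex^'k^'k" where
  "beta U \<Theta> X Y z = mat 1 - conj_transpose U ** matrix_inv (mat z - X - Y) ** U ** \<Theta>"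

definition beta_square ::
  "complex^'k^'n \<Rightarrow> complex^'k^'k \<Rightarrow> (complex^'n^'n \<Rightarrow> complex^'n^'n) \<Rightarrow> complex \<Rightarrow> complex^'k^'k" where
  "beta_square U \<Theta> G z = mat 1 - conj_transpose U ** G (mat z) ** U ** \<Theta>"

text \<open>The arguments \<open>N\<close>, \<open>k\<close>, \<open>g\<close>, \<open>y\<close> are the two dimensions, \<open>\<gamma>\<^sub>m\<^sub>a\<^sub>x\<close> and \<open>Im z\<close>.\<close>

definition eps' :: "nat \<Rightarrow> nat \<Rightarrow> real \<Rightarrow> real \<Rightarrow> real \<Rightarrow> real \<Rightarrow> real" where
  "eps' N k g y \<delta> d =
     sqrt 2 * real k * g * (sqrt (d * ln (real N)) / \<bar>y\<bar>\<^sup>2) * real N powr (-1/2)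
     + (1 + g\<^sup>2 / (\<delta> * \<bar>y\<bar>\<^sup>2)) * (g ^ 4 / (real N powr (3/2) * y ^ 5))"

end

theory Submission
  imports Defs
begin

text \<open>The coordinates of \<open>X\<close> are a standard Gaussian vector \<open>x\<close>, and
  \<open>R = (z - X - Y)\<^sup>-\<^sup>1\<close> is a smooth function of it; a linear statistic \<open>trace (A R)\<close> has
  squared gradient at most \<open>\<gamma>\<^sup>2 \<parallel>A\<parallel>\<^sup>2 / (N (Im z)\<^sup>4)\<close>.

  Fluctuation: for \<open>y\<close> an independent copy of \<open>x\<close>, differentiating \<open>F x \<bullet> G (sin \<theta> x + cos \<theta> y)\<close>
  in expectation and integrating by parts bounds a covariance by inner products of gradients.
  With \<open>F = \<parallel>f\<parallel>\<^sup>2\<^sup>m f\<close> and \<open>G = f\<close> centered this bounds the even moments of \<open>\<parallel>f\<parallel>\<close> by those of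
  a real Gaussian, so that complex-valued statistics satisfy the one-dimensional tail bound
  \<open>2 exp (- t\<^sup>2 / (2 L))\<close> without loss from splitting into real and imaginary parts.

  Bias: the expected resolvent is diagonal, as the law of \<open>X\<close> is invariant under conjugation with
  diagonal sign matrices when \<open>Y\<close> is diagonal. Integration by parts shows that its entries solve the
  fixed point equation of the deterministic equivalent up to a covariance, controlled by the variance
  bounds; they are thus close to an exact solution for a perturbed parameter \<open>\<Lambda>'\<close>, and the
  assumption on \<open>Im z\<close> keeps \<open>Im \<Lambda>' \<ge> \<delta> Im z\<close>, where two solutions can be compared.\<close>

text \<open>The two terms of \<open>eps'\<close> have separate origins. With y = Im z, an entry of
  \<open>conj_transpose U ** R ** U\<close> is a statistic \<open>trace (A ** R)\<close> with A of
  rank one and Frobenius norm 1, so its squared gradient is at most L = \<gamma>^2 / (N y^4) and the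
  deviation t = sqrt (2 L d ln N) has probability at most 2 N^(-d). The operator norm is at most k
  times the largest entry, whence k t. The bias is a diagonal matrix, whose operator norm is its
  largest entry, so the second term has no factor k. The covariance in the bias pairs a weighted sum
  of diagonal resolvent entries with one of them; divided by y it leaves the error \<epsilon> =
  \<gamma>^4 / (N^(3/2) y^5). This moves the parameter by at most \<gamma>^2 \<epsilon>, and
  \<gamma>^2 \<epsilon> <= (1 - \<delta>) y is the sixth power of the assumption on Im z. Stability
  with lower bounds \<delta> y and y for the two imaginary parts adds \<gamma>^2 \<epsilon> /
  (\<delta> y^2) to \<epsilon>. The obstacle is that for small y the fixed point map need not
  contract; the comparison of solutions rests on the signs of imaginary parts instead.\<close>

no_notation fps_nth (infixl "$" 75)

section \<open>The standard Gaussian measure\<close>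

abbreviation std_normal :: "real measure" where
  "std_normal \<equiv> density lborel (\<lambda>x. ennreal (std_normal_density x))"

lemma prob_space_std_normal: "prob_space std_normal"
  by (rule prob_space_normal_density) simp

lemma std_normal_density_deriv:
  "(std_normal_density has_real_derivative - (x * std_normal_density x)) (at x)"
  unfolding std_normal_density_def
  by (auto intro!: derivative_eq_intros simp: field_simps)

lemma std_normal_density_at_top: "(std_normal_density \<longlongrightarrow> 0) at_top"
  unfolding std_normal_density_def by real_asymp

lemma std_normal_density_at_bot: "(std_normal_density \<longlongrightarrow> 0) at_bot"
  unfolding std_normal_density_def by real_asymp

text \<open>The density \<phi> satisfies \<phi>' = - t \<phi>, so \<phi> h has derivative \<phi> (h'
  - t h), and its integral over the line vanishes because \<phi> h tends to 0 at both ends. Vector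
  values cover complex functions directly.\<close>

lemma std_normal_integration_by_parts:
  fixes h h' :: "real \<Rightarrow> 'e::euclidean_space"
  assumes h: "\<And>t. (h has_vector_derivative h' t) (at t)"
    and h': "continuous_on UNIV h'"
    and B: "\<And>t. norm (h t) \<le> B" and B': "\<And>t. norm (h' t) \<le> B'"
  shows "(\<integral>t. t *\<^sub>R h t \<partial>std_normal) = (\<integral>t. h' t \<partial>std_normal)"
proof -
  define F where "F = (\<lambda>t. std_normal_density t *\<^sub>R h t)"
  define f where "f = (\<lambda>t. std_normal_density t *\<^sub>R h' t - (t * std_normal_density t) *\<^sub>R h t)"
  have ch: "continuous_on UNIV h"
    using h by (meson continuous_at_imp_continuous_on has_vector_derivative_continuous)
  have m [measurable]: "h \<in> borel_measurable borel" "h' \<in> borel_measurable borel"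
    using ch h' by (auto intro: borel_measurable_continuous_onI)
  have i1: "integrable lborel (\<lambda>t. std_normal_density t *\<^sub>R h' t)"
  proof (rule Bochner_Integration.integrable_bound)
    show "integrable lborel (\<lambda>t. B' * (std_normal_density t * \<bar>t\<bar>^0))"
      by (intro integrable_mult_right integrable_std_normal_moment_abs)
    show "AE t in lborel. norm (std_normal_density t *\<^sub>R h' t) \<le> norm (B' * (std_normal_density t * \<bar>t\<bar> ^ 0))"
      using B' order_trans[OF norm_ge_zero B'] by (auto intro!: AE_I2 mult_left_mono simp: abs_mult mult.commute[of B'])
  qed simp
  have i2: "integrable lborel (\<lambda>t. (t * std_normal_density t) *\<^sub>R h t)"
  proof (rule Bochner_Integration.integrable_bound)
    show "integrable lborel (\<lambda>t. B * (std_normal_density t * \<bar>t\<bar>^1))"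
      by (intro integrable_mult_right integrable_std_normal_moment_abs)
    show "AE t in lborel. norm ((t * std_normal_density t) *\<^sub>R h t) \<le> norm (B * (std_normal_density t * \<bar>t\<bar> ^ 1))"
      using mult_left_mono[OF B, of "std_normal_density _ * \<bar>_\<bar>"] order_trans[OF norm_ge_zero B]
      by (auto intro!: AE_I2 simp: abs_mult mult_ac)
  qed simp
  have d: "(F has_vector_derivative f t) (at t)" for t
    unfolding F_def f_def
    using has_vector_derivative_scaleR[OF std_normal_density_deriv h] by (simp add: algebra_simps)
  have cf: "continuous_on UNIV f"
    unfolding f_def std_normal_density_def using ch h' by (intro continuous_intros) auto
  have lim: "(F \<longlongrightarrow> 0) at_top" "(F \<longlongrightarrow> 0) at_bot"
    unfolding F_def
    by (rule lim_null_scaleR_bounded[OF std_normal_density_at_top, of _ B] lim_null_scaleR_bounded[OF std_normal_density_at_bot, of _ B],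
        use B in auto)+
  have fi: "integrable lborel f" unfolding f_def using i1 i2 by auto
  have "(LBINT x=-\<infinity>..\<infinity>. f x) = 0 - 0"
  proof (rule interval_integral_FTC_integrable)
    show "isCont f x" for x using cf by (simp add: continuous_on_eq_continuous_at)
    show "set_integrable lborel (einterval (- \<infinity>) \<infinity>) f"
      using fi by (simp add: set_integrable_def)
    show "((F \<circ> real_of_ereal) \<longlongrightarrow> 0) (at_right (- \<infinity>))"
      using lim(2) unfolding at_right_MInf by (simp add: tendsto_compose_filtermap[symmetric] filterlim_filtermap comp_def ereal_tendsto_simps)
    show "((F \<circ> real_of_ereal) \<longlongrightarrow> 0) (at_left \<infinity>)"
      using lim(1) unfolding at_left_PInf by (simp add: filterlim_filtermap comp_def)
  qed (use d in auto)
  then have "integral\<^sup>L lborel f = 0"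
    by (simp add: interval_lebesgue_integral_def set_lebesgue_integral_def)
  then have "(\<integral>t. std_normal_density t *\<^sub>R h' t \<partial>lborel) = (\<integral>t. (t * std_normal_density t) *\<^sub>R h t \<partial>lborel)"
    unfolding f_def using i1 i2 by simp
  then show ?thesis
    by (subst (1 2) integral_density) (auto simp: mult_ac)
qed

text \<open>The product measure lives on functions; it is transported to the vector type with its
  Borel sets, where continuity yields measurability and derivatives make sense.\<close>

definition gauss :: "(real^'i) measure" where
  "gauss = distr (Pi\<^sub>M UNIV (\<lambda>_. std_normal)) borel vec_lambda"

lemma measurable_vec_lambda [measurable]:
  "vec_lambda \<in> measurable (Pi\<^sub>M UNIV (\<lambda>_. std_normal)) (borel :: (real^'i) measure)"
proof (subst borel_measurable_euclidean_space, rule ballI)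
  fix b :: "real^'i" assume "b \<in> Basis"
  then obtain i where b: "b = axis i 1" by (auto simp: Basis_vec_def)
  have "(\<lambda>x. x i) \<in> measurable (Pi\<^sub>M UNIV (\<lambda>_. std_normal)) borel"
    by measurable
  then show "(\<lambda>x. vec_lambda x \<bullet> b) \<in> borel_measurable (Pi\<^sub>M UNIV (\<lambda>_. std_normal))"
    by (simp add: b inner_axis)
qed

lemma sets_gauss [simp, measurable_cong]: "sets gauss = sets borel"
  and space_gauss [simp]: "space gauss = UNIV"
  by (simp_all add: gauss_def)


interpretation std_normals: product_prob_space "\<lambda>_. std_normal" "UNIV :: 'i::finite set"
proof -
  interpret prob_space std_normal by (rule prob_space_std_normal)
  show "product_prob_space (\<lambda>_. std_normal)" by unfold_locales
qed

lemma prob_space_gauss: "prob_space (gauss :: (real^'i) measure)"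
  unfolding gauss_def by (intro std_normals.P.prob_space_distr measurable_vec_lambda)

interpretation gauss: prob_space "gauss :: (real^'i) measure"
  by (rule prob_space_gauss)

lemma borel_measurable_gauss:
  "continuous_on UNIV f \<Longrightarrow> f \<in> borel_measurable (gauss :: (real^'i) measure)"
  by (simp add: borel_measurable_continuous_onI cong: measurable_cong_sets)

lemma integrable_gauss_bounded:
  fixes f :: "real^'i \<Rightarrow> 'e::{banach, second_countable_topology}"
  assumes "continuous_on UNIV f" "\<And>x. norm (f x) \<le> B"
  shows "integrable gauss f"
  using assms by (intro gauss.integrable_const_bound[of _ B] borel_measurable_gauss) auto

lemma distr_gauss_component: "distr gauss borel (\<lambda>x::real^'i. x $ i) = std_normal"
proof -
  have "distr gauss borel (\<lambda>x::real^'i. x $ i) = distr (Pi\<^sub>M UNIV (\<lambda>_::'i. std_normal)) borel (\<lambda>f. f i)"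
    unfolding gauss_def by (subst distr_distr) (auto simp: comp_def)
  also have "\<dots> = distr (Pi\<^sub>M UNIV (\<lambda>_::'i. std_normal)) std_normal (\<lambda>f. f i)"
    by (intro distr_cong) auto
  also have "\<dots> = std_normal"
    by (intro distr_PiM_component prob_space_std_normal) auto
  finally show ?thesis .
qed

lemma integrable_std_normal_abs: "integrable std_normal (\<lambda>t. \<bar>t\<bar>)"
  using integrable_std_normal_moment_abs[of 1] by (subst integrable_density) auto

lemma integrable_gauss_component: "integrable gauss (\<lambda>x::real^'i. \<bar>x $ i\<bar>)"
  using integrable_std_normal_abs unfolding distr_gauss_component[of i, symmetric]
  by (subst (asm) integrable_distr_eq) auto

lemma integrable_gauss_component_scaleR:
  fixes f :: "real^'i \<Rightarrow> 'e::{banach, second_countable_topology}"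
  assumes "continuous_on UNIV f" "\<And>x. norm (f x) \<le> B"
  shows "integrable gauss (\<lambda>x. x $ i *\<^sub>R f x)"
proof (rule Bochner_Integration.integrable_bound)
  show "integrable gauss (\<lambda>x::real^'i. B * \<bar>x $ i\<bar>)"
    by (intro integrable_mult_right integrable_gauss_component)
  show "(\<lambda>x. x $ i *\<^sub>R f x) \<in> borel_measurable gauss"
    by (intro borel_measurable_gauss continuous_intros assms)
  show "AE x in gauss. norm (x $ i *\<^sub>R f x) \<le> norm (B * \<bar>x $ i\<bar>)"
    using assms(2) order_trans[OF norm_ge_zero assms(2)] by (auto intro!: mult_left_mono simp: abs_mult mult.commute[of B])
qed

text \<open>Fubini isolates coordinate \<open>i\<close>, in which the one-dimensional identity
  applies with the other coordinates frozen.\<close>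

lemma gauss_integration_by_parts:
  fixes H H' :: "real^'i \<Rightarrow> 'e::euclidean_space"
  assumes d: "\<And>x. ((\<lambda>t. H (x + t *\<^sub>R axis i 1)) has_vector_derivative H' x) (at 0)"
    and H: "continuous_on UNIV H" "\<And>x. norm (H x) \<le> B"
    and H': "continuous_on UNIV H'" "\<And>x. norm (H' x) \<le> B'"
  shows "(\<integral>x. x $ i *\<^sub>R H x \<partial>gauss) = (\<integral>x. H' x \<partial>gauss)"
proof -
  let ?P = "\<lambda>I. Pi\<^sub>M I (\<lambda>_::'i. std_normal)"
  have split: "(\<integral>x. K x \<partial>gauss) = (\<integral>f. (\<integral>t. K (vec_lambda (f(i := t))) \<partial>std_normal) \<partial>?P (UNIV - {i}))"
    if K: "integrable gauss K" for K :: "real^'i \<Rightarrow> 'e"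
  proof -
    have ins: "insert i (UNIV - {i}) = UNIV" by auto
    have m: "K \<in> borel_measurable borel"
      using borel_measurable_integrable[OF K] by (simp add: measurable_cong_sets[OF sets_gauss refl])
    have "integrable (?P UNIV) (\<lambda>f. K (vec_lambda f))"
      using K m unfolding gauss_def by (subst (asm) integrable_distr_eq) auto
    then have "(\<integral>f. K (vec_lambda f) \<partial>?P UNIV) = (\<integral>f. (\<integral>t. K (vec_lambda (f(i := t))) \<partial>std_normal) \<partial>?P (UNIV - {i}))"
      using std_normals.product_integral_insert[of "UNIV - {i}" i "\<lambda>f. K (vec_lambda f)"] unfolding ins by simp
    then show ?thesis
      using m unfolding gauss_def by (subst integral_distr) auto
  qed
  \<comment> \<open>Changing coordinate \<open>i\<close> is a translation along its axis, which
    carries the derivative hypothesis from 0 to every \<open>t\<close>.\<close>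
  have upd: "vec_lambda (f(i := t)) = vec_lambda (f(i := s)) + (t - s) *\<^sub>R axis i (1::real)" for f and t s :: real
    by (auto simp: vec_eq_iff axis_def)
  have inner: "(\<integral>t. t *\<^sub>R H (vec_lambda (f(i := t))) \<partial>std_normal) = (\<integral>t. H' (vec_lambda (f(i := t))) \<partial>std_normal)" for f
  proof (rule std_normal_integration_by_parts)
    fix t
    have "((\<lambda>u. H (vec_lambda (f(i := t)) + (u - t) *\<^sub>R axis i 1)) has_vector_derivative H' (vec_lambda (f(i := t)))) (at t)"
    proof -
      have "((\<lambda>u. u - t) has_vector_derivative 1) (at t)"
        by (auto intro!: derivative_eq_intros)
      from vector_diff_chain_at[OF this, of "\<lambda>u. H (vec_lambda (f(i := t)) + u *\<^sub>R axis i 1)"] d[of "vec_lambda (f(i := t))"]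
      show ?thesis by (simp add: o_def)
    qed
    then show "((\<lambda>u. H (vec_lambda (f(i := u)))) has_vector_derivative H' (vec_lambda (f(i := t)))) (at t)"
      by (subst upd[of f _ t]) simp
  next
    have c: "continuous_on UNIV (\<lambda>u. vec_lambda (f(i := u)) :: real^'i)"
      by (subst upd[of f _ 0]) (intro continuous_intros)
    show "continuous_on UNIV (\<lambda>u. H' (vec_lambda (f(i := u))))"
      by (rule continuous_on_compose2[OF H'(1) c]) auto
  qed (use H H' in auto)
  show ?thesis
    by (subst split, rule integrable_gauss_component_scaleR[OF H],
        subst split, rule integrable_gauss_bounded[OF H'], use inner in simp)
qed

section \<open>Recognising the Gaussian law, and its sign symmetries\<close>

lemma distr_eq_gaussI:
  fixes X :: "'i::finite \<Rightarrow> 'a \<Rightarrow> real"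
  assumes M: "prob_space M" and ind: "prob_space.indep_vars M (\<lambda>_. borel) X UNIV"
    and d: "\<And>i. distr M borel (X i) = std_normal"
  shows "distr M borel (\<lambda>\<omega>. \<chi> i. X i \<omega>) = gauss"
proof -
  interpret prob_space M by fact
  have rv [measurable]: "X i \<in> borel_measurable M" for i
    using ind by (auto simp: indep_vars_def)
  have eq: "distr M (Pi\<^sub>M UNIV (\<lambda>_. borel)) (\<lambda>\<omega>. \<lambda>i\<in>UNIV. X i \<omega>) = Pi\<^sub>M UNIV (\<lambda>_. std_normal)"
    using ind by (subst (asm) indep_vars_iff_distr_eq_PiM) (auto simp: d)
  have "gauss = distr (distr M (Pi\<^sub>M UNIV (\<lambda>_. borel)) (\<lambda>\<omega>. \<lambda>i\<in>UNIV. X i \<omega>)) borel vec_lambda"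
    unfolding gauss_def eq ..
  also have "\<dots> = distr M borel (vec_lambda \<circ> (\<lambda>\<omega>. \<lambda>i\<in>UNIV. X i \<omega>))"
  proof (rule distr_distr)
    show "vec_lambda \<in> borel_measurable (Pi\<^sub>M UNIV (\<lambda>_::'i. borel :: real measure))"
      using measurable_vec_lambda by (simp cong: measurable_cong_sets sets_PiM_cong)
  qed measurable
  finally show ?thesis by (simp add: comp_def restrict_UNIV)
qed

lemma indep_vars_gauss: "prob_space.indep_vars (gauss :: (real^'i) measure) (\<lambda>_. borel) (\<lambda>i x. x $ i) UNIV"
proof -
  have "distr gauss (Pi\<^sub>M UNIV (\<lambda>_::'i. borel)) (\<lambda>x. \<lambda>i\<in>UNIV. x $ i)
      = distr (Pi\<^sub>M UNIV (\<lambda>_. std_normal)) (Pi\<^sub>M UNIV (\<lambda>_. borel)) (\<lambda>x. x)"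
    unfolding gauss_def
    by (subst distr_distr) (auto simp: comp_def intro!: distr_cong measurable_PiM_single' cong: measurable_cong_sets)
  also have "\<dots> = Pi\<^sub>M UNIV (\<lambda>_. std_normal)"
    by (intro distr_id2 sets_PiM_cong) auto
  finally show ?thesis
    by (subst gauss.indep_vars_iff_distr_eq_PiM) (auto simp: distr_gauss_component)
qed

text \<open>Sign changes preserve the independence and, the density being even, the marginals. This
  is the symmetry that makes the expected resolvent diagonal.\<close>

lemma gauss_sign_flip:
  fixes s :: "'i::finite \<Rightarrow> real"
  assumes s: "\<And>i. s i = 1 \<or> s i = -1"
  shows "distr gauss borel (\<lambda>x. \<chi> i. s i * x $ i) = gauss"
proof (rule distr_eq_gaussI[OF prob_space_gauss])
  show "prob_space.indep_vars gauss (\<lambda>_. borel) (\<lambda>i x. s i * x $ i) UNIV"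
    by (rule gauss.indep_vars_compose2[OF indep_vars_gauss]) auto
  show "distr gauss borel (\<lambda>x. s i * x $ i) = std_normal" for i
  proof -
    have D: "distributed gauss lborel (\<lambda>x::real^'i. x $ i) std_normal_density"
      using distr_gauss_component[of i] by (simp add: distributed_def cong: distr_cong)
    have "distributed gauss lborel (\<lambda>x::real^'i. s i * x $ i) std_normal_density"
      using gauss.normal_density_affine[OF D, of "s i" 0] s[of i] by auto
    then show ?thesis
      unfolding distributed_def by (metis (no_types, lifting) distr_cong sets_lborel)
  qed
qed

section \<open>Covariance inequality and concentration\<close>

text \<open>The mean value inequality bounds every difference quotient by \<open>g\<close>, so
  dominated convergence applies along each sequence tending to 0.\<close>

lemma has_real_derivative_integral:
  fixes f f' :: "real \<Rightarrow> 'a \<Rightarrow> real"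
  assumes f: "\<And>t. integrable M (f t)"
    and d: "\<And>t x. ((\<lambda>t. f t x) has_real_derivative f' t x) (at t)"
    and f': "f' t \<in> borel_measurable M"
    and bnd: "\<And>t x. \<bar>f' t x\<bar> \<le> g x" and g: "integrable M g"
  shows "((\<lambda>t. \<integral>x. f t x \<partial>M) has_real_derivative (\<integral>x. f' t x \<partial>M)) (at t)"
  unfolding DERIV_def tendsto_at_iff_sequentially
proof (intro allI impI)
  fix S :: "nat \<Rightarrow> real" assume S: "\<forall>i. S i \<in> UNIV - {0}" "S \<longlonglongrightarrow> 0"
  then have S0: "S n \<noteq> 0" for n by auto
  have lip: "\<bar>f (t + h) x - f t x\<bar> \<le> g x * \<bar>h\<bar>" for h x
    using field_differentiable_bound[of UNIV "\<lambda>t. f t x" "\<lambda>t. f' t x" "g x" "t + h" t] d bnd by auto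
  have "(\<lambda>n. \<integral>x. (f (t + S n) x - f t x) / S n \<partial>M) \<longlonglongrightarrow> (\<integral>x. f' t x \<partial>M)"
  proof (rule integral_dominated_convergence[OF f' _ g])
    show "(\<lambda>x. (f (t + S n) x - f t x) / S n) \<in> borel_measurable M" for n
      using f by (intro borel_measurable_divide borel_measurable_diff) auto
    show "AE x in M. (\<lambda>n. (f (t + S n) x - f t x) / S n) \<longlonglongrightarrow> f' t x"
      using d S unfolding DERIV_def tendsto_at_iff_sequentially comp_def by auto
    show "AE x in M. norm ((f (t + S n) x - f t x) / S n) \<le> g x" for n
      using lip[of "S n"] S0[of n] by (auto simp: divide_le_eq)
  qed
  then show "((\<lambda>h. ((\<integral>x. f (t + h) x \<partial>M) - (\<integral>x. f t x \<partial>M)) / h) \<circ> S) \<longlonglongrightarrow> (\<integral>x. f' t x \<partial>M)"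
    using f by (simp add: comp_def)
qed

text \<open>Only pure second partials occur, because integration by parts in coordinate
  \<open>i\<close> meets \<open>f' i\<close> alone. Total differentiability of \<open>f\<close>
  serves the chain rule along a rotating vector. The common bound \<open>B\<close> secures
  integrability and is absent from the final inequalities.\<close>

locale gauss_test_function =
  fixes f :: "real^'i \<Rightarrow> 'e::euclidean_space" and f' f'' :: "'i \<Rightarrow> real^'i \<Rightarrow> 'e" and B :: real
  assumes deriv: "\<And>x. (f has_derivative (\<lambda>h. \<Sum>i\<in>UNIV. h $ i *\<^sub>R f' i x)) (at x)"
    and deriv2: "\<And>i x. ((\<lambda>t. f' i (x + t *\<^sub>R axis i 1)) has_vector_derivative f'' i x) (at 0)"
    and cont': "\<And>i. continuous_on UNIV (f' i)" and cont'': "\<And>i. continuous_on UNIV (f'' i)"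
    and bound: "\<And>x. norm (f x) \<le> B" and bound': "\<And>i x. norm (f' i x) \<le> B" and bound'': "\<And>i x. norm (f'' i x) \<le> B"
begin

lemma cont: "continuous_on UNIV f"
  using deriv by (meson continuous_at_imp_continuous_on has_derivative_continuous)

lemma partial: "((\<lambda>t. f (x + t *\<^sub>R axis i 1)) has_vector_derivative f' i x) (at 0)"
proof -
  have "((\<lambda>t. x + t *\<^sub>R axis i 1) has_derivative (\<lambda>t. t *\<^sub>R axis i 1)) (at (0::real))"
    by (auto intro!: derivative_eq_intros)
  from diff_chain_at[OF this, of f "\<lambda>h. \<Sum>i\<in>UNIV. h $ i *\<^sub>R f' i x"] deriv[of x]
  have "((\<lambda>t. f (x + t *\<^sub>R axis i 1)) has_derivative (\<lambda>t. \<Sum>j\<in>UNIV. (t *\<^sub>R axis i 1) $ j *\<^sub>R f' j x)) (at (0::real))"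
    by (simp add: comp_def)
  moreover have "(\<Sum>j\<in>UNIV. (t *\<^sub>R axis i 1) $ j *\<^sub>R f' j x) = t *\<^sub>R f' i x" for t
    by (subst sum.remove[of _ i]) (auto simp: axis_def intro!: sum.neutral)
  ultimately show ?thesis by (simp add: has_vector_derivative_def)
qed

lemma integrable: "integrable gauss f"
  by (rule integrable_gauss_bounded[OF cont bound])

lemma bound_nonneg: "0 \<le> B"
  using order_trans[OF norm_ge_zero bound] .

end

section \<open>Two independent Gaussian vectors and the covariance inequality\<close>

abbreviation gauss2 :: "((real^'i) \<times> (real^'i)) measure" where
  "gauss2 \<equiv> gauss \<Otimes>\<^sub>M gauss"

interpretation gauss2: pair_prob_space "gauss :: (real^'i) measure" "gauss :: (real^'i) measure" ..

lemma borel_measurable_gauss2: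
  fixes f :: "(real^'i) \<times> (real^'i) \<Rightarrow> 'e::topological_space"
  assumes "continuous_on UNIV f"
  shows "f \<in> borel_measurable gauss2"
proof -
  have "sets (gauss2 :: ((real^'i) \<times> (real^'i)) measure) = sets borel"
    unfolding borel_prod[symmetric] by (rule sets_pair_measure_cong) auto
  then show ?thesis
    using borel_measurable_continuous_onI[OF assms] by (simp cong: measurable_cong_sets)
qed

lemma integrable_gauss2_fst:
  "integrable gauss2 (\<lambda>p. f (fst p :: real^'i) :: real)" if "integrable gauss f"
proof -
  have "integrable (distr gauss2 gauss fst) f"
    using that by (subst gauss.distr_pair_fst)
  then show ?thesis
    by (subst (asm) integrable_distr_eq) (use that in auto)
qed

lemma integrable_gauss2_snd:
  "integrable gauss2 (\<lambda>p. f (snd p :: real^'i) :: real)" if "integrable gauss f"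
  using integrable_gauss2_fst[OF that]
  by (subst gauss2.integrable_product_swap_iff[symmetric]) (simp add: split_beta')

lemma integral_gauss2_fst:
  "(\<integral>p. f (fst p :: real^'i) \<partial>gauss2) = (\<integral>x. f x \<partial>gauss)" if "integrable gauss f" for f :: "real^'i \<Rightarrow> real"
  using gauss2.integral_fst'[OF integrable_gauss2_fst[OF that]] by (simp add: gauss.prob_space[unfolded space_gauss])

text \<open>As \<open>W \<theta>\<close> rotates from \<open>y\<close> to \<open>x\<close>, the
  expectation of F(x) paired with G(W) moves from the product of the means to the joint expectation.
  Its derivative in \<theta> is cos \<theta> times the expected pairing of the gradients at
  \<open>x\<close> and at \<open>W \<theta>\<close>. Since cos has integral 1 over [0, pi/2], no
  constant is lost. The bound \<open>c\<close> may depend on \<open>x\<close> but is uniform in the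
  second point, which varies with \<theta>.\<close>

lemma gauss_covariance_le:
  fixes F G :: "real^'i \<Rightarrow> 'e::euclidean_space"
  assumes F: "\<And>i x. ((\<lambda>t. F (x + t *\<^sub>R axis i 1)) has_vector_derivative F' i x) (at 0)"
      "continuous_on UNIV F" "\<And>i. continuous_on UNIV (F' i)"
      "\<And>x. norm (F x) \<le> A" "\<And>i x. norm (F' i x) \<le> A"
    and G: "gauss_test_function G G' G'' B"
    and c: "\<And>x y. (\<Sum>i\<in>UNIV. F' i x \<bullet> G' i y) \<le> c x" "integrable gauss c"
  shows "(\<integral>x. F x \<bullet> G x \<partial>gauss) - (\<integral>x. F x \<partial>gauss) \<bullet> (\<integral>x. G x \<partial>gauss) \<le> (\<integral>x. c x \<partial>gauss)"
proof -
  interpret G: gauss_test_function G G' G'' B by fact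
  have A0: "0 \<le> A" using order_trans[OF norm_ge_zero F(4)] .
  define W where "W \<theta> p = sin \<theta> *\<^sub>R fst p + cos \<theta> *\<^sub>R snd p" for \<theta> and p :: "(real^'i) \<times> (real^'i)"
  define W' where "W' \<theta> p = cos \<theta> *\<^sub>R fst p - sin \<theta> *\<^sub>R snd p" for \<theta> and p :: "(real^'i) \<times> (real^'i)"
  have cW: "continuous_on UNIV (W \<theta>)" for \<theta> unfolding W_def by (intro continuous_intros)
  have cc: "continuous_on UNIV (\<lambda>p. h (W \<theta> p))" if "continuous_on UNIV h" for h :: "real^'i \<Rightarrow> 'e" and \<theta>
    by (rule continuous_on_compose2[OF that cW]) auto
  have cF: "continuous_on UNIV (\<lambda>p. h (fst p))" if "continuous_on UNIV h" for h :: "real^'i \<Rightarrow> 'e"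
    by (rule continuous_on_compose2[OF that]) (auto intro: continuous_intros)
  have inn: "\<bar>a \<bullet> b\<bar> \<le> A * B" if "norm a \<le> A" "norm b \<le> B" for a b :: 'e
    using that A0 by (intro order_trans[OF Cauchy_Schwarz_ineq2] mult_mono) auto
  note conts = cc[OF G.cont] cc[OF G.cont'] cc[OF G.cont''] cF[OF F(2)] cF[OF F(3)]
  have int_bdd: "integrable gauss2 h" if "continuous_on UNIV h" "\<And>p. \<bar>h p\<bar> \<le> K"
    for h :: "(real^'i) \<times> (real^'i) \<Rightarrow> real" and K
    using that by (intro gauss2.P.integrable_const_bound[of _ K] borel_measurable_gauss2) auto
  have int_fst: "integrable gauss2 (\<lambda>p. fst p $ i * h p)" and int_snd: "integrable gauss2 (\<lambda>p. snd p $ i * h p)"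
    if h: "continuous_on UNIV h" "\<And>p. \<bar>h p\<bar> \<le> K"
    for h :: "(real^'i) \<times> (real^'i) \<Rightarrow> real" and K i
  proof -
    have K0: "0 \<le> K" using order_trans[OF abs_ge_zero h(2)] .
    show "integrable gauss2 (\<lambda>p. fst p $ i * h p)"
    proof (rule Bochner_Integration.integrable_bound)
      show "integrable gauss2 (\<lambda>p::(real^'i) \<times> (real^'i). K * \<bar>fst p $ i\<bar>)"
        by (intro integrable_mult_right integrable_gauss2_fst[of "\<lambda>x. \<bar>x $ i\<bar>"] integrable_gauss_component)
    qed (use h K0 in \<open>auto intro!: borel_measurable_gauss2 continuous_intros AE_I2 simp: abs_mult mult.commute[of K] mult_left_mono\<close>)
    show "integrable gauss2 (\<lambda>p. snd p $ i * h p)"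
    proof (rule Bochner_Integration.integrable_bound)
      show "integrable gauss2 (\<lambda>p::(real^'i) \<times> (real^'i). K * \<bar>snd p $ i\<bar>)"
        by (intro integrable_mult_right integrable_gauss2_snd[of "\<lambda>x. \<bar>x $ i\<bar>"] integrable_gauss_component)
    qed (use h K0 in \<open>auto intro!: borel_measurable_gauss2 continuous_intros AE_I2 simp: abs_mult mult.commute[of K] mult_left_mono\<close>)
  qed
  define \<Phi> where "\<Phi> \<theta> = (\<integral>p. F (fst p) \<bullet> G (W \<theta> p) \<partial>gauss2)" for \<theta>
  define \<Psi> where "\<Psi> \<theta> = (\<integral>p. (\<Sum>i\<in>UNIV. F' i (fst p) \<bullet> G' i (W \<theta> p)) \<partial>gauss2)" for \<theta>
  \<comment> \<open>Here the variable of integration enters both factors, so besides the gradient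
    pairing there is a \<open>G''\<close> term with weight sin \<theta>. In \<open>ibp2\<close> it
    enters through \<open>W\<close> alone, with weight cos \<theta>. Weighted by cos \<theta> and -
    sin \<theta> in \<open>d\<Phi>'\<close>, the two \<open>G''\<close> terms cancel.\<close>
  have ibp1: "(\<integral>p. fst p $ i * (F (fst p) \<bullet> G' i (W \<theta> p)) \<partial>gauss2)
     = (\<integral>p. F' i (fst p) \<bullet> G' i (W \<theta> p) + sin \<theta> * (F (fst p) \<bullet> G'' i (W \<theta> p)) \<partial>gauss2)" for i \<theta>
  proof -
    have i1: "integrable gauss2 (\<lambda>(x, y). x $ i * (F x \<bullet> G' i (W \<theta> (x, y))))"
      using int_fst[OF continuous_on_inner[OF conts(4) conts(2)] inn[OF F(4) G.bound'], of i i \<theta>]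
      by (simp add: split_beta')
    have i2: "integrable gauss2 (\<lambda>(x, y). F' i x \<bullet> G' i (W \<theta> (x, y)) + sin \<theta> * (F x \<bullet> G'' i (W \<theta> (x, y))))"
      using int_bdd[OF continuous_on_inner[OF conts(5) conts(2)] inn[OF F(5) G.bound'], of i i \<theta>]
        int_bdd[OF continuous_on_inner[OF conts(4) conts(3)] inn[OF F(4) G.bound''], of i \<theta>]
      by (simp add: split_beta')
    have "(\<integral>x. x $ i *\<^sub>R (F x \<bullet> G' i (W \<theta> (x, y))) \<partial>gauss)
        = (\<integral>x. F' i x \<bullet> G' i (W \<theta> (x, y)) + sin \<theta> * (F x \<bullet> G'' i (W \<theta> (x, y))) \<partial>gauss)" for y
    proof (rule gauss_integration_by_parts)
      fix x
      have "((\<lambda>t. sin \<theta> * t) has_vector_derivative sin \<theta>) (at 0)"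
        by (auto intro!: derivative_eq_intros)
      from vector_diff_chain_at[OF this, of "\<lambda>t. G' i (W \<theta> (x, y) + t *\<^sub>R axis i 1)"] G.deriv2[of i "W \<theta> (x, y)"]
      have "((\<lambda>t. G' i (W \<theta> (x + t *\<^sub>R axis i 1, y))) has_vector_derivative sin \<theta> *\<^sub>R G'' i (W \<theta> (x, y))) (at 0)"
        by (simp add: comp_def W_def algebra_simps)
      from bounded_bilinear.has_vector_derivative[OF bounded_bilinear_inner F(1) this]
      show "((\<lambda>t. F (x + t *\<^sub>R axis i 1) \<bullet> G' i (W \<theta> (x + t *\<^sub>R axis i 1, y))) has_vector_derivative
        F' i x \<bullet> G' i (W \<theta> (x, y)) + sin \<theta> * (F x \<bullet> G'' i (W \<theta> (x, y)))) (at 0)"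
        by (simp add: add.commute)
    next
      have cw: "continuous_on UNIV (\<lambda>x. h (W \<theta> (x, y)))" if "continuous_on UNIV h" for h :: "real^'i \<Rightarrow> 'e"
        by (rule continuous_on_compose2[OF that]) (auto simp: W_def intro!: continuous_intros)
      show "continuous_on UNIV (\<lambda>x. F x \<bullet> G' i (W \<theta> (x, y)))"
        "continuous_on UNIV (\<lambda>x. F' i x \<bullet> G' i (W \<theta> (x, y)) + sin \<theta> * (F x \<bullet> G'' i (W \<theta> (x, y))))"
        by (intro continuous_intros F cw G.cont' G.cont'')+
      fix x
      show "norm (F x \<bullet> G' i (W \<theta> (x, y))) \<le> A * B"
        using inn[OF F(4) G.bound'] by simp
      have "\<bar>sin \<theta> * (F x \<bullet> G'' i (W \<theta> (x, y)))\<bar> \<le> 1 * (A * B)"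
        unfolding abs_mult by (intro mult_mono inn[OF F(4) G.bound'']) auto
      then show "norm (F' i x \<bullet> G' i (W \<theta> (x, y)) + sin \<theta> * (F x \<bullet> G'' i (W \<theta> (x, y)))) \<le> A * B + 1 * (A * B)"
        unfolding real_norm_def by (intro order_trans[OF abs_triangle_ineq] add_mono inn[OF F(5) G.bound'])
    qed
    then show ?thesis
      using gauss2.integral_snd[OF i1] gauss2.integral_snd[OF i2] by (simp add: split_beta')
  qed
  have ibp2: "(\<integral>p. snd p $ i * (F (fst p) \<bullet> G' i (W \<theta> p)) \<partial>gauss2)
     = (\<integral>p. cos \<theta> * (F (fst p) \<bullet> G'' i (W \<theta> p)) \<partial>gauss2)" for i \<theta>
  proof -
    have i1: "integrable gauss2 (\<lambda>(x, y). y $ i * (F x \<bullet> G' i (W \<theta> (x, y))))"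
      using int_snd[OF continuous_on_inner[OF conts(4) conts(2)] inn[OF F(4) G.bound'], of i i \<theta>]
      by (simp add: split_beta')
    have i2: "integrable gauss2 (\<lambda>(x, y). cos \<theta> * (F x \<bullet> G'' i (W \<theta> (x, y))))"
      using int_bdd[OF continuous_on_inner[OF conts(4) conts(3)] inn[OF F(4) G.bound''], of i \<theta>]
      by (simp add: split_beta')
    have "(\<integral>y. y $ i *\<^sub>R (F x \<bullet> G' i (W \<theta> (x, y))) \<partial>gauss)
        = (\<integral>y. cos \<theta> * (F x \<bullet> G'' i (W \<theta> (x, y))) \<partial>gauss)" for x
    proof (rule gauss_integration_by_parts)
      fix y
      have "((\<lambda>t. cos \<theta> * t) has_vector_derivative cos \<theta>) (at 0)"
        by (auto intro!: derivative_eq_intros)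
      from vector_diff_chain_at[OF this, of "\<lambda>t. G' i (W \<theta> (x, y) + t *\<^sub>R axis i 1)"] G.deriv2[of i "W \<theta> (x, y)"]
      have "((\<lambda>t. G' i (W \<theta> (x, y + t *\<^sub>R axis i 1))) has_vector_derivative cos \<theta> *\<^sub>R G'' i (W \<theta> (x, y))) (at 0)"
        by (simp add: comp_def W_def algebra_simps)
      from bounded_linear.has_vector_derivative[OF bounded_linear_inner_right this]
      show "((\<lambda>t. F x \<bullet> G' i (W \<theta> (x, y + t *\<^sub>R axis i 1))) has_vector_derivative
        cos \<theta> * (F x \<bullet> G'' i (W \<theta> (x, y)))) (at 0)"
        by simp
    next
      have cw: "continuous_on UNIV (\<lambda>y. h (W \<theta> (x, y)))" if "continuous_on UNIV h" for h :: "real^'i \<Rightarrow> 'e"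
        by (rule continuous_on_compose2[OF that]) (auto simp: W_def intro!: continuous_intros)
      show "continuous_on UNIV (\<lambda>y. F x \<bullet> G' i (W \<theta> (x, y)))"
        "continuous_on UNIV (\<lambda>y. cos \<theta> * (F x \<bullet> G'' i (W \<theta> (x, y))))"
        by (intro continuous_intros F cw G.cont' G.cont'')+
      fix y
      show "norm (F x \<bullet> G' i (W \<theta> (x, y))) \<le> A * B"
        using inn[OF F(4) G.bound'] by simp
      have "\<bar>cos \<theta> * (F x \<bullet> G'' i (W \<theta> (x, y)))\<bar> \<le> 1 * (A * B)"
        unfolding abs_mult by (intro mult_mono inn[OF F(4) G.bound'']) auto
      then show "norm (cos \<theta> * (F x \<bullet> G'' i (W \<theta> (x, y)))) \<le> 1 * (A * B)"
        by simp
    qed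
    then show ?thesis
      using gauss2.integral_fst'[OF i1] gauss2.integral_fst'[OF i2] by (simp add: split_beta')
  qed
  have dW: "((\<lambda>\<theta>. F (fst p) \<bullet> G (W \<theta> p)) has_real_derivative
      (\<Sum>i\<in>UNIV. W' \<theta> p $ i * (F (fst p) \<bullet> G' i (W \<theta> p)))) (at \<theta>)" for \<theta> p
  proof -
    have "((\<lambda>\<theta>. W \<theta> p) has_vector_derivative W' \<theta> p) (at \<theta>)"
      unfolding W_def W'_def by (auto intro!: derivative_eq_intros simp: has_vector_derivative_def algebra_simps)
    from vector_derivative_diff_chain_within[OF this, of G, OF has_derivative_at_withinI[OF G.deriv]]
    have "((\<lambda>\<theta>. G (W \<theta> p)) has_vector_derivative (\<Sum>i\<in>UNIV. W' \<theta> p $ i *\<^sub>R G' i (W \<theta> p))) (at \<theta>)"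
      by (simp add: comp_def)
    from bounded_linear.has_vector_derivative[OF bounded_linear_inner_right this]
    show ?thesis
      by (simp add: has_real_derivative_iff_has_vector_derivative inner_sum_right)
  qed
  have d\<Phi>: "(\<Phi> has_real_derivative (\<integral>p. (\<Sum>i\<in>UNIV. W' \<theta> p $ i * (F (fst p) \<bullet> G' i (W \<theta> p))) \<partial>gauss2)) (at \<theta>)" for \<theta>
    unfolding \<Phi>_def
  proof (rule has_real_derivative_integral[where g = "\<lambda>p. \<Sum>i\<in>UNIV. (A * B) * (\<bar>fst p $ i\<bar> + \<bar>snd p $ i\<bar>)"])
    show "integrable gauss2 (\<lambda>p. F (fst p) \<bullet> G (W t p))" for t
      by (rule int_bdd[OF continuous_on_inner[OF conts(4) conts(1)] inn[OF F(4) G.bound]])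
    show "(\<lambda>p. \<Sum>i\<in>UNIV. W' \<theta> p $ i * (F (fst p) \<bullet> G' i (W \<theta> p))) \<in> borel_measurable gauss2"
      unfolding W'_def by (intro borel_measurable_gauss2 continuous_intros conts)
    show "integrable gauss2 (\<lambda>p::(real^'i)\<times>(real^'i). \<Sum>i\<in>UNIV. (A * B) * (\<bar>fst p $ i\<bar> + \<bar>snd p $ i\<bar>))"
      by (intro Bochner_Integration.integrable_sum integrable_mult_right Bochner_Integration.integrable_add
            integrable_gauss2_fst[of "\<lambda>x. \<bar>x $ i\<bar>" for i] integrable_gauss2_snd[of "\<lambda>x. \<bar>x $ i\<bar>" for i] integrable_gauss_component)
    fix t p
    show "\<bar>\<Sum>i\<in>UNIV. W' t p $ i * (F (fst p) \<bullet> G' i (W t p))\<bar> \<le> (\<Sum>i\<in>UNIV. (A * B) * (\<bar>fst p $ i\<bar> + \<bar>snd p $ i\<bar>))"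
    proof (intro order_trans[OF sum_abs] sum_mono)
      fix i
      have "\<bar>W' t p $ i\<bar> \<le> \<bar>cos t\<bar> * \<bar>fst p $ i\<bar> + \<bar>sin t\<bar> * \<bar>snd p $ i\<bar>"
        unfolding W'_def by (simp add: abs_mult[symmetric])
      also have "\<dots> \<le> 1 * \<bar>fst p $ i\<bar> + 1 * \<bar>snd p $ i\<bar>"
        by (intro add_mono mult_right_mono) auto
      finally have "\<bar>W' t p $ i\<bar> \<le> \<bar>fst p $ i\<bar> + \<bar>snd p $ i\<bar>" by simp
      then show "\<bar>W' t p $ i * (F (fst p) \<bullet> G' i (W t p))\<bar> \<le> (A * B) * (\<bar>fst p $ i\<bar> + \<bar>snd p $ i\<bar>)"
        unfolding abs_mult by (subst mult.commute) (intro mult_mono inn[OF F(4) G.bound'], auto intro: mult_nonneg_nonneg A0 G.bound_nonneg)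
    qed
  qed (rule dW)
  have d\<Phi>': "(\<integral>p. (\<Sum>i\<in>UNIV. W' \<theta> p $ i * (F (fst p) \<bullet> G' i (W \<theta> p))) \<partial>gauss2) = cos \<theta> * \<Psi> \<theta>" for \<theta>
  proof -
    note I1 = int_fst[OF continuous_on_inner[OF conts(4) conts(2)] inn[OF F(4) G.bound']]
    note I2 = int_snd[OF continuous_on_inner[OF conts(4) conts(2)] inn[OF F(4) G.bound']]
    note I3 = int_bdd[OF continuous_on_inner[OF conts(5) conts(2)] inn[OF F(5) G.bound']]
    note I4 = int_bdd[OF continuous_on_inner[OF conts(4) conts(3)] inn[OF F(4) G.bound'']]
    have "(\<integral>p. W' \<theta> p $ i * (F (fst p) \<bullet> G' i (W \<theta> p)) \<partial>gauss2) = cos \<theta> * (\<integral>p. F' i (fst p) \<bullet> G' i (W \<theta> p) \<partial>gauss2)" for i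
    proof -
      have "(\<integral>p. W' \<theta> p $ i * (F (fst p) \<bullet> G' i (W \<theta> p)) \<partial>gauss2) =
        (\<integral>p. cos \<theta> * (fst p $ i * (F (fst p) \<bullet> G' i (W \<theta> p))) - sin \<theta> * (snd p $ i * (F (fst p) \<bullet> G' i (W \<theta> p))) \<partial>gauss2)"
        unfolding W'_def by (simp add: algebra_simps)
      also have "\<dots> = cos \<theta> * (\<integral>p. F' i (fst p) \<bullet> G' i (W \<theta> p) + sin \<theta> * (F (fst p) \<bullet> G'' i (W \<theta> p)) \<partial>gauss2)
          - sin \<theta> * (\<integral>p. cos \<theta> * (F (fst p) \<bullet> G'' i (W \<theta> p)) \<partial>gauss2)"
        unfolding ibp1[symmetric] ibp2[symmetric]
        by (simp add: I1 I2)
      also have "\<dots> = cos \<theta> * (\<integral>p. F' i (fst p) \<bullet> G' i (W \<theta> p) \<partial>gauss2)"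
        by (simp add: I3 I4 algebra_simps)
      finally show ?thesis .
    qed
    moreover have "integrable gauss2 (\<lambda>p. W' \<theta> p $ i * (F (fst p) \<bullet> G' i (W \<theta> p)))" for i
    proof -
      have "integrable gauss2 (\<lambda>p. cos \<theta> * (fst p $ i * (F (fst p) \<bullet> G' i (W \<theta> p))) - sin \<theta> * (snd p $ i * (F (fst p) \<bullet> G' i (W \<theta> p))))"
        by (intro Bochner_Integration.integrable_diff integrable_mult_right I1 I2)
      then show ?thesis unfolding W'_def by (simp add: algebra_simps)
    qed
    ultimately show ?thesis
      unfolding \<Psi>_def by (simp add: I3 sum_distrib_left)
  qed
  have \<Psi>_le: "\<Psi> \<theta> \<le> (\<integral>x. c x \<partial>gauss)" for \<theta>
    unfolding \<Psi>_def integral_gauss2_fst[OF c(2), symmetric]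
    by (intro integral_mono integrable_gauss2_fst c Bochner_Integration.integrable_sum
        int_bdd[OF continuous_on_inner[OF conts(5) conts(2)] inn[OF F(5) G.bound']])
  let ?C = "\<integral>x. c x \<partial>gauss"
  \<comment> \<open>Monotonicity of \<Phi> - C sin replaces integration of the derivative; it uses
    that cos is nonnegative on [0, pi/2].\<close>
  have "\<Phi> (pi/2) - ?C * sin (pi/2) \<le> \<Phi> 0 - ?C * sin 0"
  proof (rule DERIV_nonpos_imp_nonincreasing[where f = "\<lambda>\<theta>. \<Phi> \<theta> - ?C * sin \<theta>"])
    fix \<theta> assume \<theta>: "0 \<le> \<theta>" "\<theta> \<le> pi / 2"
    have "((\<lambda>\<theta>. \<Phi> \<theta> - ?C * sin \<theta>) has_real_derivative cos \<theta> * \<Psi> \<theta> - ?C * cos \<theta>) (at \<theta>)"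
      using d\<Phi>[of \<theta>] unfolding d\<Phi>' by (auto intro!: derivative_eq_intros)
    moreover have "cos \<theta> * \<Psi> \<theta> - ?C * cos \<theta> \<le> 0"
      using mult_left_mono[OF \<Psi>_le, of "cos \<theta>" \<theta>] cos_ge_zero[of \<theta>] \<theta> by (simp add: mult.commute)
    ultimately show "\<exists>y. ((\<lambda>\<theta>. \<Phi> \<theta> - ?C * sin \<theta>) has_real_derivative y) (at \<theta>) \<and> y \<le> 0"
      by blast
  qed simp
  moreover have "\<Phi> (pi/2) = (\<integral>x. F x \<bullet> G x \<partial>gauss)"
    unfolding \<Phi>_def W_def
    using integral_gauss2_fst[of "\<lambda>x. F x \<bullet> G x"]
      integrable_gauss_bounded[OF continuous_on_inner[OF F(2) G.cont], of "A * B"] inn[OF F(4) G.bound] by simp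
  moreover have "\<Phi> 0 = (\<integral>x. F x \<partial>gauss) \<bullet> (\<integral>x. G x \<partial>gauss)"
  proof -
    have "\<Phi> 0 = (\<integral>x. (\<integral>y. F x \<bullet> G y \<partial>gauss) \<partial>gauss)"
      unfolding \<Phi>_def
      by (subst gauss2.integral_fst'[OF int_bdd[OF continuous_on_inner[OF conts(4) conts(1)] inn[OF F(4) G.bound]], symmetric])
        (simp add: W_def)
    also have "\<dots> = (\<integral>x. F x \<bullet> (\<integral>y. G y \<partial>gauss) \<partial>gauss)"
      using G.integrable by simp
    also have "\<dots> = (\<integral>x. F x \<partial>gauss) \<bullet> (\<integral>x. G x \<partial>gauss)"
      using integrable_gauss_bounded[OF F(2) F(4)] by simp
    finally show ?thesis .
  qed
  ultimately show ?thesis by simp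
qed

section \<open>Moments, tail bound and variance of a test function\<close>

context gauss_test_function
begin

lemma integrable_norm_power: "integrable gauss (\<lambda>x. norm (f x) ^ k)"
  by (rule integrable_gauss_bounded[of _ "B ^ k"])
    (auto intro!: continuous_intros cont power_mono bound)

text \<open>In the covariance inequality for \<open>norm f ^ (2 * m)\<close> times \<open>f\<close>
  and \<open>f\<close>, the joint expectation is the next even moment and the product of means is 0.
  Each partial of the first function is at most \<open>(2 * m + 1) * norm f ^ (2 * m)\<close> times
  that of \<open>f\<close>, which reproduces the recursion of the Gaussian moments.\<close>

lemma gauss_moment_step:
  assumes mean: "(\<integral>x. f x \<partial>gauss) = 0"
    and grad: "\<And>x. (\<Sum>i\<in>UNIV. (norm (f' i x))\<^sup>2) \<le> L"
  shows "(\<integral>x. norm (f x) ^ (2 * Suc m) \<partial>gauss) \<le> (2 * real m + 1) * L * (\<integral>x. norm (f x) ^ (2 * m) \<partial>gauss)"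
proof -
  \<comment> \<open>The even power is written through \<open>f x \<bullet> f x\<close>, since the
    norm itself is not differentiable at 0.\<close>
  define F where "F x = (f x \<bullet> f x) ^ m *\<^sub>R f x" for x
  define F' where "F' i x = (f x \<bullet> f x) ^ m *\<^sub>R f' i x
      + (real m * (2 * (f x \<bullet> f' i x)) * (f x \<bullet> f x) ^ (m - 1)) *\<^sub>R f x" for i x
  have ff: "f x \<bullet> f x \<le> B\<^sup>2" for x
    using power_mono[OF bound[of x], of 2] by (simp add: power2_norm_eq_inner)
  have ff': "\<bar>f x \<bullet> f' i x\<bar> \<le> B\<^sup>2" for i x
    unfolding power2_eq_square using bound bound' bound_nonneg
    by (intro order_trans[OF Cauchy_Schwarz_ineq2] mult_mono) auto
  have nF: "norm (F x) \<le> (B\<^sup>2) ^ m * B" for x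
    unfolding F_def norm_scaleR using ff bound_nonneg
    by (intro mult_mono bound) (auto simp: power_mono)
  have nF': "norm (F' i x) \<le> (B\<^sup>2) ^ m * B + (real m * (2 * B\<^sup>2) * (B\<^sup>2) ^ (m - 1)) * B" for i x
    unfolding F'_def
  proof (intro order_trans[OF norm_triangle_ineq] add_mono)
    show "norm ((f x \<bullet> f x) ^ m *\<^sub>R f' i x) \<le> (B\<^sup>2) ^ m * B"
      unfolding norm_scaleR using ff bound_nonneg
      by (intro mult_mono bound') (auto simp: power_mono)
    show "norm ((real m * (2 * (f x \<bullet> f' i x)) * (f x \<bullet> f x) ^ (m - 1)) *\<^sub>R f x) \<le> (real m * (2 * B\<^sup>2) * (B\<^sup>2) ^ (m - 1)) * B"
      unfolding norm_scaleR abs_mult using ff ff' bound_nonneg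
      by (intro mult_mono bound) (auto simp: power_mono)
  qed
  have dF: "((\<lambda>t. F (x + t *\<^sub>R axis i 1)) has_vector_derivative F' i x) (at 0)" for i x
  proof -
    let ?g = "\<lambda>t. f (x + t *\<^sub>R axis i 1)"
    have "((\<lambda>t. ?g t \<bullet> ?g t) has_real_derivative (2 * (f x \<bullet> f' i x))) (at 0)"
      using bounded_bilinear.has_vector_derivative[OF bounded_bilinear_inner partial[of x i] partial[of x i]]
      by (simp add: has_real_derivative_iff_has_vector_derivative inner_commute)
    from DERIV_power[OF this, of m]
    have "((\<lambda>t. (?g t \<bullet> ?g t) ^ m) has_real_derivative (real m * (2 * (f x \<bullet> f' i x)) * (f x \<bullet> f x) ^ (m - 1))) (at 0)"
      by (simp add: mult_ac)
    from has_vector_derivative_scaleR[OF this partial]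
    show ?thesis
      unfolding F_def F'_def by simp
  qed
  have cF: "continuous_on UNIV F" "continuous_on UNIV (F' i)" for i
    unfolding F_def F'_def by (intro continuous_intros cont cont')+
  let ?K = "(B\<^sup>2) ^ m * B + (real m * (2 * B\<^sup>2) * (B\<^sup>2) ^ (m - 1)) * B"
  have "(\<integral>x. F x \<bullet> f x \<partial>gauss) - (\<integral>x. F x \<partial>gauss) \<bullet> (\<integral>x. f x \<partial>gauss)
    \<le> (\<integral>x. (2 * real m + 1) * L * norm (f x) ^ (2 * m) \<partial>gauss)"
  proof (rule gauss_covariance_le[where A = ?K])
    show "norm (F x) \<le> ?K" for x
      using nF[of x] bound_nonneg by (auto intro: order_trans)
    show "gauss_test_function f f' f'' B" by unfold_locales
    show "integrable gauss (\<lambda>x. (2 * real m + 1) * L * norm (f x) ^ (2 * m))"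
      by (intro integrable_mult_right integrable_norm_power)
    fix x y
    have L0: "0 \<le> L" using order_trans[OF sum_nonneg grad[of x]] by simp
    have one: "F' i x \<bullet> f' i y \<le> (2 * real m + 1) * norm (f x) ^ (2 * m) * (norm (f' i x) * norm (f' i y))" for i
    proof -
      have pow: "(f x \<bullet> f x) ^ j = norm (f x) ^ (2 * j)" for j
        by (simp add: power2_norm_eq_inner[symmetric] power_mult)
      have "F' i x \<bullet> f' i y \<le> norm (F' i x) * norm (f' i y)" by (rule norm_cauchy_schwarz)
      also have "norm (F' i x) \<le> norm (f x) ^ (2 * m) * norm (f' i x)
          + (real m * (2 * (norm (f x) * norm (f' i x))) * norm (f x) ^ (2 * (m - 1))) * norm (f x)"
        unfolding F'_def pow
        by (intro order_trans[OF norm_triangle_ineq] add_mono)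
          (use mult_left_mono[OF Cauchy_Schwarz_ineq2[of "f x" "f' i x"], of "real m * 2 * norm (f x) ^ (2 * (m - 1)) * norm (f x)"]
            in \<open>auto simp: abs_mult mult_ac\<close>)
      also have "\<dots> = (2 * real m + 1) * norm (f x) ^ (2 * m) * norm (f' i x)"
        by (cases m) (auto simp: algebra_simps)
      finally show ?thesis by (simp add: mult_right_mono mult_ac)
    qed
    have "(\<Sum>i\<in>UNIV. F' i x \<bullet> f' i y) \<le> (2 * real m + 1) * norm (f x) ^ (2 * m) * (\<Sum>i\<in>UNIV. norm (f' i x) * norm (f' i y))"
      unfolding sum_distrib_left by (intro sum_mono one)
    \<comment> \<open>The gradients are taken at different points; the inequality between arithmetic
      and geometric means separates them, after which \<open>grad\<close> applies at each.\<close>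
    also have "(\<Sum>i\<in>UNIV. norm (f' i x) * norm (f' i y)) \<le> (\<Sum>i\<in>UNIV. ((norm (f' i x))\<^sup>2 + (norm (f' i y))\<^sup>2) / 2)"
      using sum_squares_bound[of "norm (f' _ x)" "norm (f' _ y)"] by (intro sum_mono) (simp add: mult_ac)
    also have "\<dots> \<le> L"
      using grad[of x] grad[of y] by (simp add: sum.distrib sum_divide_distrib[symmetric])
    finally have "(\<Sum>i\<in>UNIV. F' i x \<bullet> f' i y) \<le> (2 * real m + 1) * norm (f x) ^ (2 * m) * L"
      by (simp add: mult_left_mono)
    then show "(\<Sum>i\<in>UNIV. F' i x \<bullet> f' i y) \<le> (2 * real m + 1) * L * norm (f x) ^ (2 * m)"
      by (simp add: mult_ac)
  qed (use cF dF nF' in auto)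
  moreover have "F x \<bullet> f x = norm (f x) ^ (2 * Suc m)" for x
    by (simp add: F_def power2_norm_eq_inner[symmetric] power_mult power_add power2_eq_square)
  ultimately show ?thesis
    using mean by simp
qed

text \<open>The coefficient (2m)! / (2^m m!) is the product of the odd numbers below 2m, the moment
  of order 2m of a standard normal variable.\<close>

lemma gauss_moment_le:
  assumes mean: "(\<integral>x. f x \<partial>gauss) = 0"
    and grad: "\<And>x. (\<Sum>i\<in>UNIV. (norm (f' i x))\<^sup>2) \<le> L"
  shows "(\<integral>x. norm (f x) ^ (2 * m) \<partial>gauss) \<le> fact (2 * m) / (2 ^ m * fact m) * L ^ m"
proof (induction m)
  case 0
  then show ?case using gauss.prob_space by simp
next
  case (Suc m)
  have L0: "0 \<le> L" using order_trans[OF sum_nonneg grad[of 0]] by simp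
  have "(\<integral>x. norm (f x) ^ (2 * Suc m) \<partial>gauss) \<le> (2 * real m + 1) * L * (fact (2 * m) / (2 ^ m * fact m) * L ^ m)"
    by (rule order_trans[OF gauss_moment_step[OF mean grad]]) (rule mult_left_mono[OF Suc.IH], use L0 in simp)
  also have "\<dots> = ((2 * real m + 2) * ((2 * real m + 1) * fact (2 * m))) / ((2 * real m + 2) * (2 ^ m * fact m)) * L ^ Suc m"
    by (subst mult_divide_mult_cancel_left) (auto simp: field_simps)
  also have "\<dots> = fact (2 * Suc m) / (2 ^ Suc m * fact (Suc m)) * L ^ Suc m"
    by (simp add: algebra_simps)
  finally show ?case .
qed

text \<open>The series of cosh contains exactly the even moments. Its denominators (2m)! cancel
  against the moment bound, and what remains is the series of exp (s^2 L / 2).\<close>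

lemma gauss_cosh_le:
  assumes mean: "(\<integral>x. f x \<partial>gauss) = 0"
    and grad: "\<And>x. (\<Sum>i\<in>UNIV. (norm (f' i x))\<^sup>2) \<le> L"
  shows "(\<integral>x. cosh (s * norm (f x)) \<partial>gauss) \<le> exp (s\<^sup>2 * L / 2)"
proof -
  have L0: "0 \<le> L" using order_trans[OF sum_nonneg grad[of 0]] by simp
  define S where "S n u = (\<Sum>m<n. u ^ (2 * m) / fact (2 * m))" for n and u :: real
  have sums: "(\<lambda>m. u ^ (2 * m) / fact (2 * m)) sums cosh u" for u :: real
  proof -
    have "strict_mono (\<lambda>m::nat. 2 * m)" by (auto simp: strict_mono_def)
    moreover have "(if even n then u ^ n /\<^sub>R fact n else 0) = 0" if "n \<notin> range (\<lambda>m::nat. 2 * m)" for n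
      using that by (auto elim!: evenE)
    ultimately have "(\<lambda>m. if even (2 * m) then u ^ (2 * m) /\<^sub>R fact (2 * m) else 0) sums cosh u"
      using sums_mono_reindex[of "\<lambda>m. 2 * m" "\<lambda>n. if even n then u ^ n /\<^sub>R fact n else 0" "cosh u"] cosh_converges[of u]
      by blast
    then show ?thesis by (simp add: field_simps)
  qed
  have S: "(\<lambda>n. S n u) \<longlonglongrightarrow> cosh u" for u
    using sums[of u] by (simp add: sums_def S_def)
  have S_nonneg: "0 \<le> S n u" for n u
    unfolding S_def by (intro sum_nonneg) (auto simp: power_mult)
  have S_le: "S n u \<le> cosh u" for n u
    unfolding S_def sums_unique[OF sums] by (intro sum_le_suminf sums_summable[OF sums]) (auto simp: power_mult)
  have le: "(\<integral>x. S n (s * norm (f x)) \<partial>gauss) \<le> exp (s\<^sup>2 * L / 2)" for n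
  proof -
    have "(\<integral>x. S n (s * norm (f x)) \<partial>gauss)
        = (\<Sum>m<n. s ^ (2 * m) / fact (2 * m) * (\<integral>x. norm (f x) ^ (2 * m) \<partial>gauss))"
      unfolding S_def power_mult_distrib times_divide_eq_left[symmetric] mult.commute[of "s ^ _"]
      using integrable_norm_power by (simp add: mult_ac)
    also have "\<dots> \<le> (\<Sum>m<n. s ^ (2 * m) / fact (2 * m) * (fact (2 * m) / (2 ^ m * fact m) * L ^ m))"
      by (intro sum_mono mult_left_mono gauss_moment_le mean grad) (auto simp: power_mult)
    also have "\<dots> = (\<Sum>m<n. (s\<^sup>2 * L / 2) ^ m /\<^sub>R fact m)"
    proof (intro sum.cong refl)
      fix m
      have "a ^ m / p * (p / (2 ^ m * q) * L ^ m) = (a * L / 2) ^ m /\<^sub>R q" if "p \<noteq> 0" for a p q :: real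
        using that by (simp add: power_mult_distrib power_divide field_simps)
      from this[of "fact (2 * m)" "s\<^sup>2" "fact m"]
      show "s ^ (2 * m) / fact (2 * m) * (fact (2 * m) / (2 ^ m * fact m) * L ^ m) = (s\<^sup>2 * L / 2) ^ m /\<^sub>R fact m"
        unfolding power_mult by simp
    qed
    also have "\<dots> \<le> exp (s\<^sup>2 * L / 2)"
      unfolding sums_unique[OF exp_converges] using L0
      by (intro sum_le_suminf sums_summable[OF exp_converges]) auto
    finally show ?thesis .
  qed
  have cS: "continuous_on UNIV (\<lambda>x. S n (s * norm (f x)))" for n
    unfolding S_def by (intro continuous_intros cont) auto
  have cc: "continuous_on UNIV (\<lambda>x. cosh (s * norm (f x)))"
    by (intro continuous_intros cont)
  \<comment> \<open>Boundedness of \<open>f\<close> supplies a constant dominating function, so the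
    bound on the partial sums passes to the limit.\<close>
  have "(\<lambda>n. \<integral>x. S n (s * norm (f x)) \<partial>gauss) \<longlonglongrightarrow> (\<integral>x. cosh (s * norm (f x)) \<partial>gauss)"
  proof (rule integral_dominated_convergence[where w = "\<lambda>_. cosh (s * B)"])
    have "cosh (s * norm (f x)) \<le> cosh (s * B)" for x
    proof -
      have "cosh \<bar>s * norm (f x)\<bar> \<le> cosh \<bar>s * B\<bar>"
        using bound[of x] bound_nonneg by (subst cosh_real_nonneg_le_iff) (auto simp: abs_mult mult_left_mono)
      then show ?thesis by (simp add: cosh_real_abs)
    qed
    then show "AE x in gauss. norm (S n (s * norm (f x))) \<le> cosh (s * B)" for n
      using S_nonneg order_trans[OF S_le] by (intro AE_I2) simp
  qed (use S cS cc in \<open>auto intro!: borel_measurable_gauss\<close>)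
  then show ?thesis using le by (intro LIMSEQ_le_const2) auto
qed

lemma gauss_concentration_centered:
  assumes mean: "(\<integral>x. f x \<partial>gauss) = 0"
    and grad: "\<And>x. (\<Sum>i\<in>UNIV. (norm (f' i x))\<^sup>2) \<le> L" and L: "0 < L" and t: "0 \<le> t"
  shows "measure gauss {x. t \<le> norm (f x)} \<le> 2 * exp (- (t\<^sup>2 / (2 * L)))"
proof -
  \<comment> \<open>This choice minimises s^2 L / 2 - s t. The factor 2 of the conclusion comes from
    cosh u >= exp u / 2.\<close>
  define s where "s = t / L"
  have s0: "0 \<le> s" using t L by (simp add: s_def)
  have c: "0 < cosh (s * t)" by (rule cosh_real_pos)
  have "integrable gauss (\<lambda>x. cosh (s * norm (f x)))"
  proof (rule integrable_gauss_bounded[where B = "cosh (s * B)"])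
    show "norm (cosh (s * norm (f x))) \<le> cosh (s * B)" for x
      using bound[of x] bound_nonneg s0 cosh_real_nonneg_le_iff[of "s * norm (f x)" "s * B"]
      by (auto simp: mult_left_mono)
  qed (intro continuous_intros cont)
  then have "measure gauss {x \<in> space gauss. cosh (s * t) \<le> cosh (s * norm (f x))}
      \<le> (\<integral>x. cosh (s * norm (f x)) \<partial>gauss) / cosh (s * t)"
    by (intro integral_Markov_inequality_measure[where A = "{}"]) (use c in auto)
  also have "\<dots> \<le> exp (s\<^sup>2 * L / 2) / cosh (s * t)"
    using c by (intro divide_right_mono gauss_cosh_le mean grad) auto
  also have "\<dots> \<le> exp (s\<^sup>2 * L / 2) / (exp (s * t) / 2)"
    by (intro divide_left_mono mult_pos_pos c) (auto simp: cosh_def)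
  also have "\<dots> = 2 * exp (s\<^sup>2 * L / 2 - s * t)"
    by (simp add: exp_diff)
  also have "s\<^sup>2 * L / 2 - s * t = - (t\<^sup>2 / (2 * L))"
    using L by (simp add: s_def field_simps power2_eq_square)
  finally have *: "measure gauss {x \<in> space gauss. cosh (s * t) \<le> cosh (s * norm (f x))} \<le> 2 * exp (- (t\<^sup>2 / (2 * L)))" .
  have "{x. cosh (s * t) \<le> cosh (s * norm (f x))} \<in> sets borel"
    by (intro borel_closed closed_Collect_le continuous_intros cont)
  then have "measure gauss {x. t \<le> norm (f x)} \<le> measure gauss {x. cosh (s * t) \<le> cosh (s * norm (f x))}"
    using s0 t by (intro gauss.finite_measure_mono) (auto simp: cosh_real_nonneg_le_iff mult_left_mono)
  then show ?thesis using * by simp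
qed

lemma test_function_centered: "gauss_test_function (\<lambda>x. f x - (\<integral>x. f x \<partial>gauss)) f' f'' (2 * B)"
proof
  show "((\<lambda>x. f x - (\<integral>x. f x \<partial>gauss)) has_derivative (\<lambda>h. \<Sum>i\<in>UNIV. h $ i *\<^sub>R f' i x)) (at x)" for x
    using has_derivative_diff[OF deriv has_derivative_const] by simp
  have "norm (\<integral>x. f x \<partial>gauss) \<le> (\<integral>x. B \<partial>(gauss :: (real^'i) measure))"
    by (rule Bochner_Integration.integral_norm_bound_integral) (use integrable bound in auto)
  also have "\<dots> = B" by (simp add: gauss.prob_space[unfolded space_gauss])
  finally show "norm (f x - (\<integral>x. f x \<partial>gauss)) \<le> 2 * B" for x
    using norm_triangle_ineq4[of "f x" "\<integral>x. f x \<partial>gauss"] bound[of x] by linarith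
qed (use deriv2 cont' cont'' order_trans[OF bound'] order_trans[OF bound''] bound_nonneg in auto)

lemma mean_centered: "(\<integral>x. f x - (\<integral>x. f x \<partial>gauss) \<partial>gauss) = 0"
  using integrable by (simp add: gauss.prob_space[unfolded space_gauss])

theorem gauss_concentration:
  assumes "\<And>x. (\<Sum>i\<in>UNIV. (norm (f' i x))\<^sup>2) \<le> L" "0 < L" "0 \<le> t"
  shows "measure gauss {x. t \<le> norm (f x - (\<integral>x. f x \<partial>gauss))} \<le> 2 * exp (- (t\<^sup>2 / (2 * L)))"
  using gauss_test_function.gauss_concentration_centered[OF test_function_centered mean_centered assms] .

text \<open>The second moment, for which the coefficient in \<open>gauss_moment_le\<close> is
  1.\<close>

theorem gauss_poincare:
  assumes "\<And>x. (\<Sum>i\<in>UNIV. (norm (f' i x))\<^sup>2) \<le> L"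
  shows "(\<integral>x. (norm (f x - (\<integral>x. f x \<partial>gauss)))\<^sup>2 \<partial>gauss) \<le> L"
  using gauss_test_function.gauss_moment_le[OF test_function_centered mean_centered assms, of 1] by (simp add: fact_2)

end

section \<open>Resolvents of Hermitian matrices\<close>

lemma norm_vec_sq: "(norm (x :: 'a::real_normed_vector^'n))\<^sup>2 = (\<Sum>i\<in>UNIV. (norm (x $ i))\<^sup>2)"
  by (simp add: norm_vec_def L2_set_def sum_nonneg)

lemma norm_matrix_sq: "(norm (A :: 'a::real_normed_vector^'m^'n))\<^sup>2 = (\<Sum>i\<in>UNIV. \<Sum>j\<in>UNIV. (norm (A $ i $ j))\<^sup>2)"
  by (simp add: norm_vec_sq)

lemma norm_sum_mult_le: "norm (\<Sum>i\<in>UNIV. a $ i * b $ i) \<le> norm a * norm b" for a b :: "complex^'n"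
proof -
  have "norm (\<Sum>i\<in>UNIV. a $ i * b $ i) \<le> (\<Sum>i\<in>UNIV. \<bar>norm (a $ i)\<bar> * \<bar>norm (b $ i)\<bar>)"
    by (rule order_trans[OF norm_sum]) (simp add: norm_mult)
  also have "\<dots> \<le> norm a * norm b"
    unfolding norm_vec_def by (rule L2_set_mult_ineq)
  finally show ?thesis .
qed

lemma conj_transpose_nth [simp]: "conj_transpose A $ i $ j = cnj (A $ j $ i)"
  by (simp add: conj_transpose_def)

lemma conj_transpose_mult: "conj_transpose (A ** B) = conj_transpose B ** conj_transpose A"
  by (simp add: vec_eq_iff matrix_matrix_mult_def mult.commute)

lemma norm_conj_transpose [simp]: "norm (conj_transpose A) = norm A"
proof -
  have "(norm (conj_transpose A))\<^sup>2 = (norm A)\<^sup>2"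
    unfolding norm_matrix_sq by (subst sum.swap) simp
  then show ?thesis by simp
qed

lemma norm_matrix_vector_le: "norm (A *v v) \<le> norm A * norm v" for A :: "complex^'m^'n"
proof (rule power2_le_imp_le)
  have "(norm (A *v v))\<^sup>2 \<le> (\<Sum>i\<in>UNIV. (norm (A $ i) * norm v)\<^sup>2)"
    unfolding norm_vec_sq[of "A *v v"]
    by (intro sum_mono power_mono) (auto simp: matrix_vector_mult_def norm_sum_mult_le)
  then show "(norm (A *v v))\<^sup>2 \<le> (norm A * norm v)\<^sup>2"
    by (simp add: power_mult_distrib norm_vec_sq[of A] sum_distrib_right)
qed simp

text \<open>The Frobenius norm is computed column by column, so multiplication by \<open>A\<close>
  costs only its operator bound. For a resolvent that bound is the inverse of |Im z|, which keeps
  the dimension out of the estimates.\<close>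

lemma norm_matrix_mult_left_le:
  fixes A :: "complex^'m^'n" and B :: "complex^'k^'m"
  assumes A: "\<And>v. norm (A *v v) \<le> c * norm v"
  shows "norm (A ** B) \<le> c * norm B"
proof (rule power2_le_imp_le)
  have c: "0 \<le> c" using order_trans[OF norm_ge_zero A[of "axis undefined 1"]] by (simp add: norm_eq_sqrt_inner inner_axis_axis)
  have "(norm (A ** B))\<^sup>2 = (\<Sum>j\<in>UNIV. (norm (A *v column j B))\<^sup>2)"
    unfolding norm_matrix_sq norm_vec_sq[of "A *v _"]
    by (subst sum.swap) (simp add: matrix_matrix_mult_def matrix_vector_mult_def column_def)
  also have "\<dots> \<le> (\<Sum>j\<in>UNIV. (c * norm (column j B))\<^sup>2)"
    by (intro sum_mono power_mono A) auto
  also have "\<dots> = (c * norm B)\<^sup>2"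
    unfolding power_mult_distrib norm_matrix_sq sum_distrib_left[symmetric]
    by (subst sum.swap[of "\<lambda>i j. (norm (B $ i $ j))\<^sup>2"]) (simp only: norm_vec_sq, simp add: column_def)
  finally show "(norm (A ** B))\<^sup>2 \<le> (c * norm B)\<^sup>2" .
  show "0 \<le> c * norm B" using c by simp
qed

lemma norm_matrix_mult_right_le:
  fixes A :: "complex^'m^'n" and B :: "complex^'k^'m"
  assumes "\<And>v. norm (conj_transpose B *v v) \<le> c * norm v"
  shows "norm (A ** B) \<le> c * norm A"
  using norm_matrix_mult_left_le[OF assms, of "conj_transpose A"]
  by (simp add: conj_transpose_mult[symmetric])

lemma norm_matrix_mult_le: "norm (A ** B) \<le> norm A * norm B" for A :: "complex^'m^'n" and B :: "complex^'k^'m"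
  by (rule norm_matrix_mult_left_le) (rule norm_matrix_vector_le)

lemma norm_trace_mult_le: "norm (trace (A ** B)) \<le> norm A * norm B" for A B :: "complex^'n^'n"
proof -
  have "trace (A ** B) = (\<Sum>i\<in>UNIV. \<Sum>j\<in>UNIV. A $ i $ j * B $ j $ i)"
    by (simp add: trace_def matrix_matrix_mult_def)
  also have "norm \<dots> \<le> (\<Sum>i\<in>UNIV. norm (A $ i) * norm (conj_transpose B $ i))"
  proof (rule order_trans[OF norm_sum], rule sum_mono)
    fix i
    have "norm (\<chi> j. B $ j $ i) = norm (conj_transpose B $ i)"
      by (simp add: norm_vec_def)
    then show "norm (\<Sum>j\<in>UNIV. A $ i $ j * B $ j $ i) \<le> norm (A $ i) * norm (conj_transpose B $ i)"
      using norm_sum_mult_le[of "A $ i" "\<chi> j. B $ j $ i"] by simp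
  qed
  also have "\<dots> \<le> norm A * norm (conj_transpose B)"
    using L2_set_mult_ineq[of "\<lambda>i. norm (A $ i)" "\<lambda>i. norm (conj_transpose B $ i)" UNIV]
    by (simp add: norm_vec_def)
  finally show ?thesis by simp
qed

lemma bounded_bilinear_matrix_mult: "bounded_bilinear ((**) :: complex^'m^'n \<Rightarrow> complex^'k^'m \<Rightarrow> _)"
proof
  fix A :: "complex^'m^'n" and B :: "complex^'k^'m" and r :: real
  show "(r *\<^sub>R A) ** B = r *\<^sub>R (A ** B)" "A ** (r *\<^sub>R B) = r *\<^sub>R (A ** B)"
    by (simp_all add: vec_eq_iff matrix_matrix_mult_def scaleR_sum_right)
  show "\<exists>K. \<forall>a b. norm ((a :: complex^'m^'n) ** (b :: complex^'k^'m)) \<le> norm a * norm b * K"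
    by (rule exI[of _ 1]) (simp add: norm_matrix_mult_le)
qed (simp_all add: vec_eq_iff matrix_matrix_mult_def sum.distrib algebra_simps)

interpretation matrix_mult: bounded_bilinear "(**) :: complex^'m^'n \<Rightarrow> complex^'k^'m \<Rightarrow> _"
  by (rule bounded_bilinear_matrix_mult)

lemma bounded_linear_trace: "bounded_linear (trace :: complex^'n^'n \<Rightarrow> complex)"
  unfolding trace_def
  by (intro bounded_linear_sum bounded_linear_compose[OF bounded_linear_vec_nth] bounded_linear_vec_nth)

section \<open>Inverses, and the resolvent of a Hermitian matrix\<close>

lemma matrix_inv_invertible:
  assumes "invertible A"
  shows "A ** matrix_inv A = mat 1" "matrix_inv A ** A = mat 1"
  using someI_ex[OF assms[unfolded invertible_def]] by (simp_all add: matrix_inv_def)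

lemma matrix_inv_unique: "matrix_inv A = B" if "A ** B = mat 1" for A B :: "'a::field^'n^'n"
proof -
  have BA: "B ** A = mat 1" using that by (simp add: matrix_left_right_inverse)
  then have "invertible A" using that by (auto simp: invertible_def)
  then show ?thesis
    by (metis BA matrix_inv_invertible(1) matrix_mul_assoc matrix_mul_lid matrix_mul_rid)
qed

lemma hermitian_matrix_nth: "hermitian_matrix A \<Longrightarrow> cnj (A $ i $ j) = A $ j $ i"
  unfolding hermitian_matrix_def by (metis conj_transpose_nth)

text \<open>The quadratic form of a Hermitian matrix is real, so only \<open>z\<close> contributes
  to the imaginary part. From this follow both the invertibility of the shifted matrix and the sign
  of the imaginary part of the diagonal resolvent entries.\<close>

lemma Im_hermitian_shift_form:
  fixes A :: "complex^'n^'n"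
  assumes A: "hermitian_matrix A"
  shows "Im (\<Sum>i\<in>UNIV. cnj (v $ i) * ((mat z - A) *v v) $ i) = Im z * (norm v)\<^sup>2"
proof -
  define q where "q = (\<Sum>i\<in>UNIV. \<Sum>j\<in>UNIV. cnj (v $ i) * A $ i $ j * v $ j)"
  have "cnj q = (\<Sum>i\<in>UNIV. \<Sum>j\<in>UNIV. cnj (v $ j) * A $ j $ i * v $ i)"
    unfolding q_def by (simp add: hermitian_matrix_nth[OF A] mult_ac)
  also have "\<dots> = q" unfolding q_def by (rule sum.swap)
  finally have Imq: "Im q = 0" by (simp add: complex_eq_iff)
  have "(mat z *v v) $ i = z * v $ i" for i
    by (simp add: matrix_vector_mult_def mat_def if_distrib[of "\<lambda>c. c * _"] cong: if_cong)
  then have "(\<Sum>i\<in>UNIV. cnj (v $ i) * ((mat z - A) *v v) $ i) = (\<Sum>i\<in>UNIV. z * (v $ i * cnj (v $ i))) - q"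
    by (simp add: matrix_vector_mult_diff_rdistrib right_diff_distrib sum_subtractf mult_ac)
      (simp add: q_def matrix_vector_mult_def sum_distrib_left mult_ac)
  then have "(\<Sum>i\<in>UNIV. cnj (v $ i) * ((mat z - A) *v v) $ i) = z * of_real ((norm v)\<^sup>2) - q"
    by (simp add: norm_vec_sq complex_norm_square[symmetric] sum_distrib_left)
  then show ?thesis
    using Imq by simp
qed

lemma hermitian_shift_lower_bound:
  fixes A :: "complex^'n^'n"
  assumes A: "hermitian_matrix A"
  shows "\<bar>Im z\<bar> * norm v \<le> norm ((mat z - A) *v v)"
proof -
  have "\<bar>Im z\<bar> * (norm v)\<^sup>2 \<le> norm (\<Sum>i\<in>UNIV. cnj (v $ i) * ((mat z - A) *v v) $ i)"
    by (metis Im_hermitian_shift_form[OF A] abs_Im_le_cmod abs_mult abs_power2)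
  also have "\<dots> \<le> norm (\<chi> i. cnj (v $ i)) * norm ((mat z - A) *v v)"
    using norm_sum_mult_le[of "\<chi> i. cnj (v $ i)"] by simp
  also have "norm (\<chi> i. cnj (v $ i)) = norm v" by (simp add: norm_vec_def)
  finally show ?thesis
    by (cases "v = 0") (auto simp: power2_eq_square mult_ac)
qed

lemma hermitian_shift_invertible:
  fixes A :: "complex^'n^'n"
  assumes A: "hermitian_matrix A" and z: "Im z \<noteq> 0"
  shows "invertible (mat z - A)"
proof -
  have "x = 0" if "(mat z - A) *v x = 0" for x
    using hermitian_shift_lower_bound[OF A, of z x] that z by (simp add: mult_le_0_iff)
  then have "\<exists>B. B ** (mat z - A) = mat 1"
    by (subst matrix_left_invertible_ker) auto
  then show ?thesis by (simp add: invertible_left_inverse)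
qed

lemma norm_resolvent_le:
  fixes A :: "complex^'n^'n"
  assumes A: "hermitian_matrix A" and z: "Im z \<noteq> 0"
  shows "norm (matrix_inv (mat z - A) *v v) \<le> norm v / \<bar>Im z\<bar>"
proof -
  have "(mat z - A) *v (matrix_inv (mat z - A) *v v) = v"
    by (simp add: matrix_vector_mul_assoc matrix_inv_invertible hermitian_shift_invertible A z)
  then have "\<bar>Im z\<bar> * norm (matrix_inv (mat z - A) *v v) \<le> norm v"
    by (metis hermitian_shift_lower_bound[OF A])
  then show ?thesis using z by (simp add: field_simps)
qed

lemma conj_transpose_resolvent:
  fixes A :: "complex^'n^'n"
  assumes A: "hermitian_matrix A" and z: "Im z \<noteq> 0"
  shows "conj_transpose (matrix_inv (mat z - A)) = matrix_inv (mat (cnj z) - A)"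
proof (rule sym, rule matrix_inv_unique)
  have "mat (cnj z) - A = conj_transpose (mat z - A)"
    by (simp add: vec_eq_iff mat_def hermitian_matrix_nth[OF A])
  then have "(mat (cnj z) - A) ** conj_transpose (matrix_inv (mat z - A))
    = conj_transpose (matrix_inv (mat z - A) ** (mat z - A))"
    by (simp add: conj_transpose_mult)
  also have "\<dots> = mat 1"
    by (simp add: matrix_inv_invertible hermitian_shift_invertible A z) (simp add: vec_eq_iff mat_def)
  finally show "(mat (cnj z) - A) ** conj_transpose (matrix_inv (mat z - A)) = mat 1" .
qed

lemma norm_resolvent_mult_le:
  fixes A B :: "complex^'n^'n"
  assumes A: "hermitian_matrix A" and z: "Im z \<noteq> 0"
  shows "norm (matrix_inv (mat z - A) ** B) \<le> norm B / \<bar>Im z\<bar>"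
    and "norm (B ** matrix_inv (mat z - A)) \<le> norm B / \<bar>Im z\<bar>"
  using norm_matrix_mult_left_le[of "matrix_inv (mat z - A)" "1 / \<bar>Im z\<bar>" B] norm_resolvent_le[OF A z]
    norm_matrix_mult_right_le[of "matrix_inv (mat z - A)" "1 / \<bar>Im z\<bar>" B] norm_resolvent_le[OF A, of "cnj z"] z
  by (simp_all add: conj_transpose_resolvent A)

lemma resolvent_diff:
  fixes A B :: "complex^'n^'n"
  assumes "hermitian_matrix A" "hermitian_matrix B" "Im z \<noteq> 0"
  shows "matrix_inv (mat z - B) - matrix_inv (mat z - A)
    = matrix_inv (mat z - B) ** (B - A) ** matrix_inv (mat z - A)"
proof -
  let ?R = "matrix_inv (mat z - A)" and ?S = "matrix_inv (mat z - B)"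
  have "?S ** (B - A) ** ?R = ?S ** ((mat z - A) - (mat z - B)) ** ?R" by simp
  also have "\<dots> = ?S ** ((mat z - A) ** ?R) - (?S ** (mat z - B)) ** ?R"
    by (simp only: matrix_mult.diff_left matrix_mult.diff_right matrix_mul_assoc)
  also have "\<dots> = ?S - ?R"
    by (simp add: matrix_inv_invertible hermitian_shift_invertible assms)
  finally show ?thesis by simp
qed

text \<open>The resolvent identity gives the increment of \<open>R\<close>; inserted once more, it
  writes the remainder as that increment times \<open>L h ** R x\<close>, which is quadratic in
  \<open>h\<close>. The map \<open>L\<close> is general because it will be the Gaussian matrix and
  later the projection to Hermitian matrices.\<close>

lemma has_derivative_resolvent:
  fixes L :: "'a::real_normed_vector \<Rightarrow> complex^'n^'n"
  assumes L: "bounded_linear L" and H: "\<And>x. hermitian_matrix (L x + Y)" and z: "Im z \<noteq> 0"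
  defines "R \<equiv> \<lambda>x. matrix_inv (mat z - (L x + Y))"
  shows "(R has_derivative (\<lambda>h. R x ** L h ** R x)) (at x)"
proof -
  interpret L: bounded_linear L by fact
  have diff: "R (x + h) - R x = R (x + h) ** L h ** R x" for h x
    unfolding R_def using resolvent_diff[OF H H z, of "x + h" x] by (simp add: L.add)
  have le: "norm (R a ** B ** R b) \<le> norm B / (Im z)\<^sup>2" for a b B
  proof -
    have "norm (R a ** B ** R b) \<le> norm (R a ** B) / \<bar>Im z\<bar>"
      unfolding R_def by (rule norm_resolvent_mult_le[OF H z])
    also have "\<dots> \<le> (norm B / \<bar>Im z\<bar>) / \<bar>Im z\<bar>"
      unfolding R_def by (intro divide_right_mono norm_resolvent_mult_le[OF H z]) auto
    finally show ?thesis by (simp add: power2_eq_square)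
  qed
  obtain K where K: "0 < K" "\<And>h. norm (L h) \<le> norm h * K" using L.pos_bounded by blast
  have bl: "bounded_linear (\<lambda>h. R x ** L h ** R x)"
    by (intro bounded_linear_compose[OF matrix_mult.bounded_linear_left]
        bounded_linear_compose[OF matrix_mult.bounded_linear_right] L)
  let ?c = "K / (Im z)\<^sup>2 * K / \<bar>Im z\<bar>"
  have est: "norm (R (x + h) - R x - R x ** L h ** R x) / norm h \<le> ?c * norm h" for h
  proof -
    have "R (x + h) - R x - R x ** L h ** R x = (R (x + h) - R x) ** (L h ** R x)"
      unfolding matrix_mult.diff_left by (simp add: diff matrix_mul_assoc)
    also have "norm \<dots> \<le> norm (R (x + h) - R x) * norm (L h ** R x)"
      by (rule norm_matrix_mult_le)
    also have "\<dots> \<le> (norm (L h) / (Im z)\<^sup>2) * (norm (L h) / \<bar>Im z\<bar>)"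
      unfolding diff using le[of "x + h" "L h" x] norm_resolvent_mult_le(2)[OF H[of x] z, of "L h"]
      by (intro mult_mono) (auto simp: R_def)
    also have "\<dots> \<le> (norm h * K / (Im z)\<^sup>2) * (norm h * K / \<bar>Im z\<bar>)"
      by (intro mult_mono divide_right_mono K) (use K in auto)
    finally have "norm (R (x + h) - R x - R x ** L h ** R x) \<le> (K / (Im z)\<^sup>2 * K / \<bar>Im z\<bar>) * norm h * norm h"
      by (simp add: mult_ac)
    then show ?thesis using z by (cases "h = 0") (auto simp: divide_le_eq)
  qed
  show ?thesis
    unfolding has_derivative_at using bl
  proof
    show "(\<lambda>h. norm (R (x + h) - R x - R x ** L h ** R x) / norm h) \<midarrow>0\<rightarrow> 0"
    proof (rule Lim_null_comparison)
      show "\<forall>\<^sub>F h in at 0. norm (norm (R (x + h) - R x - R x ** L h ** R x) / norm h) \<le> ?c * norm h"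
        using est by (intro always_eventually) simp
      show "(\<lambda>h::'a. ?c * norm h) \<midarrow>0\<rightarrow> 0"
        by (intro tendsto_mult_right_zero tendsto_norm_zero tendsto_ident_at)
    qed
  qed
qed

section \<open>Linear statistics of the resolvent\<close>

text \<open>The coordinate \<open>x $ (i, i)\<close> is the diagonal Gaussian; for \<open>j < i\<close> the coordinates \<open>(i, j)\<close> and
  \<open>(j, i)\<close> are the rescaled real and imaginary parts of the entry \<open>(i, j)\<close>.\<close>

definition gue_entry :: "'n \<Rightarrow> 'n \<Rightarrow> real^('n::{finite,linorder} \<times> 'n) \<Rightarrow> complex" where
  "gue_entry i j x = (if i = j then of_real (x $ (i, i))
     else if j < i then Complex (x $ (i, j) / sqrt 2) (x $ (j, i) / sqrt 2)
     else Complex (x $ (j, i) / sqrt 2) (- (x $ (i, j) / sqrt 2)))"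

text \<open>\<open>\<sigma>\<close> holds the variances of the matrix entries, with the factor 1 / N
  included; the coordinates of \<open>x\<close> have variance 1.\<close>

definition gue_matrix :: "('n::{finite,linorder} \<Rightarrow> 'n \<Rightarrow> real) \<Rightarrow> real^('n::{finite,linorder} \<times> 'n) \<Rightarrow> complex^'n::{finite,linorder}^'n::{finite,linorder}" where
  "gue_matrix \<sigma> x = (\<chi> i j. of_real (sqrt (\<sigma> i j)) * gue_entry i j x)"

text \<open>The matrix being linear in \<open>x\<close>, this is its partial derivative along
  coordinate \<alpha> at every point.\<close>

definition gue_direction :: "('n::{finite,linorder} \<Rightarrow> 'n \<Rightarrow> real) \<Rightarrow> 'n \<times> 'n \<Rightarrow> complex^'n::{finite,linorder}^'n::{finite,linorder}" where
  "gue_direction \<sigma> \<alpha> = gue_matrix \<sigma> (axis \<alpha> 1)"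

lemma gue_entry_add: "gue_entry i j (x + y) = gue_entry i j x + gue_entry i j y"
  by (auto simp: gue_entry_def complex_eq_iff add_divide_distrib)

lemma gue_entry_scaleR: "gue_entry i j (r *\<^sub>R x) = r *\<^sub>R gue_entry i j x"
  by (auto simp: gue_entry_def complex_eq_iff)

lemma cnj_gue_entry: "cnj (gue_entry i j x) = gue_entry j i x"
  by (auto simp: gue_entry_def complex_eq_iff)

lemma linear_gue_matrix: "linear (gue_matrix \<sigma>)"
  by (rule linearI) (simp_all add: vec_eq_iff gue_matrix_def gue_entry_add gue_entry_scaleR algebra_simps)

lemma bounded_linear_gue_matrix: "bounded_linear (gue_matrix \<sigma>)"
  by (rule linear_conv_bounded_linear[THEN iffD1, OF linear_gue_matrix])

lemma gue_matrix_expand: "gue_matrix \<sigma> x = (\<Sum>\<alpha>\<in>UNIV. x $ \<alpha> *\<^sub>R gue_direction \<sigma> \<alpha>)"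
proof -
  have "x = (\<Sum>\<alpha>\<in>UNIV. x $ \<alpha> *\<^sub>R axis \<alpha> 1)"
    using basis_expansion[of x] by (simp add: scalar_mult_eq_scaleR)
  then have "gue_matrix \<sigma> x = gue_matrix \<sigma> (\<Sum>\<alpha>\<in>UNIV. x $ \<alpha> *\<^sub>R axis \<alpha> 1)" by simp
  then show ?thesis
    by (simp add: linear_sum[OF linear_gue_matrix] linear_scale[OF linear_gue_matrix] gue_direction_def)
qed

lemma gue_entry_axis_nonzero:
  assumes "gue_entry i j (axis \<alpha> 1) \<noteq> 0"
  shows "\<alpha> = (i, j) \<or> \<alpha> = (j, i)"
  using assms by (auto simp: gue_entry_def axis_def complex_eq_iff split: if_splits)

text \<open>The coordinates are independent of variance 1, so the sum is the second moment of two
  entries, taken without conjugation. For the square of an off-diagonal entry the real and imaginary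
  parts contribute 1/2 and -1/2; for an entry and its transpose they add up to 1.\<close>

lemma gue_entry_covariance:
  "(\<Sum>\<alpha>\<in>UNIV. gue_entry i j (axis \<alpha> 1) * gue_entry k l (axis \<alpha> 1)) = (if i = l \<and> j = k then 1 else 0)"
proof -
  have "(\<Sum>\<alpha>\<in>UNIV. gue_entry i j (axis \<alpha> 1) * gue_entry k l (axis \<alpha> 1))
    = (\<Sum>\<alpha>\<in>{(i, j), (j, i)}. gue_entry i j (axis \<alpha> 1) * gue_entry k l (axis \<alpha> 1))"
    by (rule sum.mono_neutral_right) (use gue_entry_axis_nonzero in auto)
  also have "\<dots> = (if i = l \<and> j = k then 1 else 0)"
  proof (cases "i = j")
    case True
    then show ?thesis by (auto simp: gue_entry_def axis_def complex_eq_iff)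
  next
    case False
    then show ?thesis
      by (cases "k = l"; cases "i < j"; cases "k < l") (auto simp: gue_entry_def axis_def complex_eq_iff)
  qed
  finally show ?thesis .
qed

text \<open>\<open>s\<close> dominates the variances of all entries; in the application it is
  \<gamma>^2 / N.\<close>

locale gue_model =
  fixes \<sigma> :: "'n::{finite,linorder} \<Rightarrow> 'n \<Rightarrow> real" and s :: real and Y :: "complex^'n::{finite,linorder}^'n::{finite,linorder}" and z :: complex
  assumes \<sigma>_sym: "\<sigma> i j = \<sigma> j i" and \<sigma>_nonneg: "0 \<le> \<sigma> i j" and \<sigma>_le: "\<sigma> i j \<le> s" and s_pos: "0 < s"
    and Y_herm: "hermitian_matrix Y" and Y_diag: "diagonal_matrix Y" and z_pos: "0 < Im z"
begin

abbreviation D where "D \<equiv> gue_direction \<sigma>"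

definition R where "R x = matrix_inv (mat z - (gue_matrix \<sigma> x + Y))"

lemma hermitian_gue: "hermitian_matrix (gue_matrix \<sigma> x)"
  using \<sigma>_sym by (simp add: hermitian_matrix_def vec_eq_iff gue_matrix_def cnj_gue_entry)

lemma hermitian_model: "hermitian_matrix (gue_matrix \<sigma> x + Y)"
  using hermitian_matrix_nth[OF hermitian_gue[of x]] hermitian_matrix_nth[OF Y_herm]
  by (simp add: hermitian_matrix_def vec_eq_iff)

lemma direction_covariance:
  "(\<Sum>\<alpha>\<in>UNIV. D \<alpha> $ i $ j * D \<alpha> $ k $ l) = (if i = l \<and> j = k then of_real (\<sigma> i j) else 0)"
proof -
  have "(\<Sum>\<alpha>\<in>UNIV. D \<alpha> $ i $ j * D \<alpha> $ k $ l)
    = of_real (sqrt (\<sigma> i j)) * of_real (sqrt (\<sigma> k l)) * (\<Sum>\<alpha>\<in>UNIV. gue_entry i j (axis \<alpha> 1) * gue_entry k l (axis \<alpha> 1))"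
    by (simp add: gue_direction_def gue_matrix_def sum_distrib_left mult_ac)
  then show ?thesis
    unfolding gue_entry_covariance
    using \<sigma>_sym[of i j] \<sigma>_nonneg[of i j] by (auto simp flip: of_real_mult)
qed

text \<open>The sum is the expectation of X A X for the Gaussian matrix X. It is diagonal, and it is
  the source of \<open>R_map\<close> in the fixed point equation.\<close>

lemma sum_direction_sandwich:
  "(\<Sum>\<alpha>\<in>UNIV. (D \<alpha> ** A ** D \<alpha>) $ i $ l) = (if i = l then \<Sum>j\<in>UNIV. of_real (\<sigma> i j) * A $ j $ j else 0)"
proof -
  have "(\<Sum>\<alpha>\<in>UNIV. (D \<alpha> ** A ** D \<alpha>) $ i $ l)
    = (\<Sum>\<alpha>\<in>UNIV. \<Sum>k\<in>UNIV. \<Sum>j\<in>UNIV. D \<alpha> $ i $ j * A $ j $ k * D \<alpha> $ k $ l)"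
    by (simp add: matrix_matrix_mult_def sum_distrib_right)
  also have "\<dots> = (\<Sum>k\<in>UNIV. \<Sum>j\<in>UNIV. \<Sum>\<alpha>\<in>UNIV. D \<alpha> $ i $ j * A $ j $ k * D \<alpha> $ k $ l)"
    by (subst sum.swap, intro sum.cong refl, subst sum.swap, rule refl)
  also have "\<dots> = (\<Sum>k\<in>UNIV. \<Sum>j\<in>UNIV. A $ j $ k * (if i = l \<and> j = k then of_real (\<sigma> i j) else 0))"
    unfolding direction_covariance[symmetric] sum_distrib_left by (simp add: mult_ac)
  also have "\<dots> = (if i = l then \<Sum>j\<in>UNIV. of_real (\<sigma> i j) * A $ j $ j else 0)"
    by (auto simp: if_distrib mult.commute cong: if_cong)
  finally show ?thesis .
qed

text \<open>The left side is the squared gradient of the trace of X B. As each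
  \<open>D \<alpha>\<close> is Hermitian, conjugating the second factor only swaps its indices, and
  \<open>direction_covariance\<close> applies.\<close>

lemma sum_trace_direction_sq:
  "(\<Sum>\<alpha>\<in>UNIV. (norm (trace (D \<alpha> ** B)))\<^sup>2) = (\<Sum>i\<in>UNIV. \<Sum>j\<in>UNIV. \<sigma> i j * (norm (B $ j $ i))\<^sup>2)"
proof -
  have herm: "cnj (D \<alpha> $ i $ j) = D \<alpha> $ j $ i" for \<alpha> i j
    unfolding gue_direction_def by (rule hermitian_matrix_nth[OF hermitian_gue])
  have "complex_of_real (\<Sum>\<alpha>\<in>UNIV. (norm (trace (D \<alpha> ** B)))\<^sup>2)
     = (\<Sum>\<alpha>\<in>UNIV. trace (D \<alpha> ** B) * cnj (trace (D \<alpha> ** B)))"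
    unfolding of_real_sum complex_norm_square ..
  also have "\<dots> = (\<Sum>\<alpha>\<in>UNIV. \<Sum>i\<in>UNIV. \<Sum>j\<in>UNIV. \<Sum>k\<in>UNIV. \<Sum>l\<in>UNIV.
      (D \<alpha> $ i $ j * D \<alpha> $ l $ k) * (B $ j $ i * cnj (B $ l $ k)))"
    unfolding trace_def matrix_matrix_mult_def vec_lambda_beta cnj_sum complex_cnj_mult herm
    by (simp only: sum_distrib_right) (simp only: sum_distrib_left mult_ac)
  also have "\<dots> = (\<Sum>i\<in>UNIV. \<Sum>j\<in>UNIV. \<Sum>k\<in>UNIV. \<Sum>l\<in>UNIV. \<Sum>\<alpha>\<in>UNIV.
      (D \<alpha> $ i $ j * D \<alpha> $ l $ k) * (B $ j $ i * cnj (B $ l $ k)))"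
    by (subst sum.swap, intro sum.cong refl, subst sum.swap, intro sum.cong refl,
        subst sum.swap, intro sum.cong refl, subst sum.swap, rule refl)
  also have "\<dots> = (\<Sum>i\<in>UNIV. \<Sum>j\<in>UNIV. \<Sum>k\<in>UNIV. \<Sum>l\<in>UNIV.
      (if i = k \<and> j = l then of_real (\<sigma> i j) else 0) * (B $ j $ i * cnj (B $ l $ k)))"
    unfolding sum_distrib_right[symmetric] direction_covariance ..
  also have "\<dots> = (\<Sum>i\<in>UNIV. \<Sum>j\<in>UNIV. \<Sum>k\<in>UNIV.
      (if i = k then of_real (\<sigma> i j) * (B $ j $ i * cnj (B $ j $ k)) else 0))"
    by (intro sum.cong refl) (auto simp: if_distrib[of "\<lambda>c. c * _"] cong: if_cong)
  also have "\<dots> = complex_of_real (\<Sum>i\<in>UNIV. \<Sum>j\<in>UNIV. \<sigma> i j * (norm (B $ j $ i))\<^sup>2)"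
    by (simp only: of_real_sum of_real_mult complex_norm_square) simp
  finally show ?thesis by (simp only: of_real_eq_iff)
qed

lemma norm_R_mult: "norm (R x ** A) \<le> norm A / Im z" "norm (A ** R x) \<le> norm A / Im z"
  unfolding R_def using norm_resolvent_mult_le[OF hermitian_model[of x], of z A] z_pos by auto

lemma R_deriv: "(R has_derivative (\<lambda>h. R x ** gue_matrix \<sigma> h ** R x)) (at x)"
  unfolding R_def[abs_def]
  by (rule has_derivative_resolvent[OF bounded_linear_gue_matrix hermitian_model]) (use z_pos in simp)

lemma R_cont: "continuous_on UNIV R"
  using R_deriv by (meson continuous_at_imp_continuous_on has_derivative_continuous)

lemma R_mult: "(mat z - (gue_matrix \<sigma> x + Y)) ** R x = mat 1"
  unfolding R_def using z_pos by (simp add: matrix_inv_invertible hermitian_shift_invertible hermitian_model)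

lemma R_partial: "((\<lambda>t. R (x + t *\<^sub>R axis \<alpha> 1)) has_vector_derivative R x ** D \<alpha> ** R x) (at 0)"
proof -
  have "((\<lambda>t. x + t *\<^sub>R axis \<alpha> 1) has_vector_derivative axis \<alpha> 1) (at 0)"
    by (auto intro!: derivative_eq_intros simp: has_vector_derivative_def)
  from vector_derivative_diff_chain_within[OF this, of R, OF has_derivative_at_withinI[OF R_deriv]]
  show ?thesis by (simp add: comp_def gue_direction_def)
qed

definition F where "F A x = trace (A ** R x)"
definition F' where "F' A \<alpha> x = trace (A ** (R x ** D \<alpha> ** R x))"
text \<open>The two terms come from differentiating the right and the left resolvent in
  \<open>F'\<close>.\<close>

definition F'' where "F'' A \<alpha> x = trace (A ** (R x ** D \<alpha> ** (R x ** D \<alpha> ** R x) + (R x ** D \<alpha> ** R x) ** D \<alpha> ** R x))"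

lemma bounded_linear_trace_mult: "bounded_linear (\<lambda>B. trace (A ** B :: ((complex, 'n) vec, 'n) vec))"
  by (rule bounded_linear_compose[OF bounded_linear_trace matrix_mult.bounded_linear_right])

lemma F_deriv: "(F A has_derivative (\<lambda>h. \<Sum>\<alpha>\<in>UNIV. h $ \<alpha> *\<^sub>R F' A \<alpha> x)) (at x)"
proof -
  have "(F A has_derivative (\<lambda>h. trace (A ** (R x ** gue_matrix \<sigma> h ** R x)))) (at x)"
    unfolding F_def[abs_def] by (rule bounded_linear.has_derivative[OF bounded_linear_trace_mult R_deriv])
  moreover have "trace (A ** (R x ** gue_matrix \<sigma> h ** R x)) = (\<Sum>\<alpha>\<in>UNIV. h $ \<alpha> *\<^sub>R F' A \<alpha> x)" for h
    unfolding gue_matrix_expand F'_def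
    by (simp add: matrix_mult.sum_left matrix_mult.sum_right matrix_mult.scaleR_left matrix_mult.scaleR_right
       linear_sum[OF bounded_linear.linear[OF bounded_linear_trace]] linear_scale[OF bounded_linear.linear[OF bounded_linear_trace]])
  ultimately show ?thesis by simp
qed

lemma F'_partial: "((\<lambda>t. F' A \<alpha> (x + t *\<^sub>R axis \<alpha> 1)) has_vector_derivative F'' A \<alpha> x) (at 0)"
proof -
  have "((\<lambda>t. R (x + t *\<^sub>R axis \<alpha> 1) ** D \<alpha>) has_vector_derivative (R x ** D \<alpha> ** R x) ** D \<alpha>) (at 0)"
    by (rule bounded_linear.has_vector_derivative[OF matrix_mult.bounded_linear_left R_partial])
  from matrix_mult.has_vector_derivative[OF this R_partial]
  show ?thesis
    unfolding F'_def F''_def by (intro bounded_linear.has_vector_derivative[OF bounded_linear_trace_mult]) simp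
qed

lemma norm_RDR: "norm (R x ** B ** R x) \<le> norm B / (Im z)\<^sup>2"
  using order_trans[OF norm_R_mult(2)[of "R x ** B" x] divide_right_mono[OF norm_R_mult(1)[of x B], of "Im z"]] z_pos
  by (simp add: power2_eq_square)

text \<open>There are finitely many directions, hence a largest norm among them. Any finite bound
  will do, as it only qualifies \<open>F A\<close> as a test function.\<close>

lemma F_bounds:
  obtains B where "\<And>x. norm (F A x) \<le> B" "\<And>\<alpha> x. norm (F' A \<alpha> x) \<le> B" "\<And>\<alpha> x. norm (F'' A \<alpha> x) \<le> B"
proof
  define d where "d = Max (range (\<lambda>\<alpha>. norm (D \<alpha>)))"
  have d: "norm (D \<alpha>) \<le> d" for \<alpha> unfolding d_def by (rule Max_ge) auto
  have d0: "0 \<le> d" using order_trans[OF norm_ge_zero d] .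
  let ?y = "Im z"
  define B1 where "B1 = norm A * (norm (mat 1 :: ((complex, 'n) vec, 'n) vec) / ?y)"
  define B2 where "B2 = norm A * (d / ?y\<^sup>2)"
  define B3 where "B3 = norm A * (2 * (d / ?y\<^sup>2 * d / ?y))"
  have nn: "0 \<le> B1" "0 \<le> B2" "0 \<le> B3" using d0 z_pos by (auto simp: B1_def B2_def B3_def)
  have RDR: "norm (R x ** D \<alpha> ** R x) \<le> d / ?y\<^sup>2" for x \<alpha>
    by (rule order_trans[OF norm_RDR]) (use d z_pos in \<open>simp add: divide_right_mono\<close>)
  have "norm (F A x) \<le> B1" for x
    unfolding F_def B1_def using norm_R_mult(1)[of x "mat 1"]
    by (intro order_trans[OF norm_trace_mult_le] mult_left_mono) auto
  then show "norm (F A x) \<le> B1 + B2 + B3" for x using nn by (smt (verit))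
  have "norm (F' A \<alpha> x) \<le> B2" for \<alpha> x
    unfolding F'_def B2_def by (intro order_trans[OF norm_trace_mult_le] mult_left_mono RDR) auto
  then show "norm (F' A \<alpha> x) \<le> B1 + B2 + B3" for \<alpha> x using nn by (smt (verit))
  have "norm (F'' A \<alpha> x) \<le> B3" for \<alpha> x
  proof -
    have "norm (R x ** D \<alpha> ** (R x ** D \<alpha> ** R x)) \<le> norm (R x ** D \<alpha> ** R x) * norm (D \<alpha> ** R x)"
      using norm_matrix_mult_le[of "R x ** D \<alpha> ** R x" "D \<alpha> ** R x"] by (simp add: matrix_mul_assoc)
    also have "\<dots> \<le> d / ?y\<^sup>2 * (d / ?y)"
      using order_trans[OF norm_R_mult(2)[of "D \<alpha>" x] divide_right_mono[OF d, of ?y \<alpha>]] z_pos d0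
      by (intro mult_mono RDR) auto
    finally have 1: "norm (R x ** D \<alpha> ** (R x ** D \<alpha> ** R x)) \<le> d / ?y\<^sup>2 * d / ?y" by simp
    then have "norm ((R x ** D \<alpha> ** R x) ** D \<alpha> ** R x) \<le> d / ?y\<^sup>2 * d / ?y" by (simp add: matrix_mul_assoc)
    with 1 have "norm (R x ** D \<alpha> ** (R x ** D \<alpha> ** R x) + (R x ** D \<alpha> ** R x) ** D \<alpha> ** R x) \<le> 2 * (d / ?y\<^sup>2 * d / ?y)"
      by (intro order_trans[OF norm_triangle_ineq]) linarith
    then show ?thesis
      unfolding F''_def B3_def by (intro order_trans[OF norm_trace_mult_le] mult_left_mono) auto
  qed
  then show "norm (F'' A \<alpha> x) \<le> B1 + B2 + B3" for \<alpha> x using nn by (smt (verit))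
qed

lemma F_test_function: obtains B where "gauss_test_function (F A) (F' A) (F'' A) B"
proof -
  obtain B where B: "\<And>x. norm (F A x) \<le> B" "\<And>\<alpha> x. norm (F' A \<alpha> x) \<le> B" "\<And>\<alpha> x. norm (F'' A \<alpha> x) \<le> B"
    using F_bounds[of A] by blast
  have tr: "continuous_on UNIV (\<lambda>x. trace (A ** h x))" if "continuous_on UNIV h" for h :: "_ \<Rightarrow> ((complex, 'n) vec, 'n) vec"
    by (rule bounded_linear.continuous_on[OF bounded_linear_trace_mult that])
  have "gauss_test_function (F A) (F' A) (F'' A) B"
  proof (unfold_locales, rule F_deriv, rule F'_partial)
    show "continuous_on UNIV (F' A \<alpha>)" "continuous_on UNIV (F'' A \<alpha>)" for \<alpha>
      unfolding F'_def[abs_def] F''_def[abs_def]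
      by (intro tr continuous_intros R_cont matrix_mult.continuous_on)+
  qed (rule B)+
  then show thesis by (rule that)
qed

text \<open>Cyclicity of the trace pairs the direction with \<open>R x ** A ** R x\<close>. Each
  resolvent costs a factor 1 / Im z in Frobenius norm, hence the fourth power after
  squaring.\<close>

lemma F_gradient: "(\<Sum>\<alpha>\<in>UNIV. (norm (F' A \<alpha> x))\<^sup>2) \<le> s * ((norm A)\<^sup>2 / (Im z) ^ 4)"
proof -
  have "F' A \<alpha> x = trace (D \<alpha> ** (R x ** A ** R x))" for \<alpha>
  proof -
    have "F' A \<alpha> x = trace ((A ** R x) ** (D \<alpha> ** R x))" by (simp add: F'_def matrix_mul_assoc)
    also have "\<dots> = trace ((D \<alpha> ** R x) ** (A ** R x))" by (rule trace_mul_sym)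
    finally show ?thesis by (simp add: matrix_mul_assoc)
  qed
  then have "(\<Sum>\<alpha>\<in>UNIV. (norm (F' A \<alpha> x))\<^sup>2) = (\<Sum>i\<in>UNIV. \<Sum>j\<in>UNIV. \<sigma> i j * (norm ((R x ** A ** R x) $ j $ i))\<^sup>2)"
    by (simp add: sum_trace_direction_sq)
  also have "\<dots> \<le> (\<Sum>i\<in>UNIV. \<Sum>j\<in>UNIV. s * (norm ((R x ** A ** R x) $ j $ i))\<^sup>2)"
    by (intro sum_mono mult_right_mono \<sigma>_le) auto
  also have "\<dots> = s * (norm (R x ** A ** R x))\<^sup>2"
    unfolding norm_matrix_sq sum_distrib_left[symmetric] by (subst sum.swap) (rule refl)
  also have "\<dots> \<le> s * (norm A / (Im z)\<^sup>2)\<^sup>2"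
    using s_pos by (intro mult_left_mono power_mono norm_RDR) auto
  finally show ?thesis by (simp add: power_divide flip: power_mult)
qed

lemma F_concentration:
  assumes "A \<noteq> 0" "0 \<le> t"
  shows "measure gauss {x. t \<le> norm (F A x - (\<integral>x. F A x \<partial>gauss))}
    \<le> 2 * exp (- (t\<^sup>2 / (2 * (s * ((norm A)\<^sup>2 / (Im z) ^ 4)))))"
proof -
  obtain B where B: "gauss_test_function (F A) (F' A) (F'' A) B" by (rule F_test_function)
  show ?thesis
    by (rule gauss_test_function.gauss_concentration[OF B F_gradient]) (use assms s_pos z_pos in auto)
qed

lemma F_variance: "(\<integral>x. (norm (F A x - (\<integral>x. F A x \<partial>gauss)))\<^sup>2 \<partial>gauss) \<le> s * ((norm A)\<^sup>2 / (Im z) ^ 4)"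
proof -
  obtain B where B: "gauss_test_function (F A) (F' A) (F'' A) B" by (rule F_test_function)
  show ?thesis by (rule gauss_test_function.gauss_poincare[OF B F_gradient])
qed

end

section \<open>The expected resolvent\<close>

lemma sqrt_mult_add_le:
  assumes "0 \<le> x" "0 \<le> y" "0 \<le> a" "0 \<le> b"
  shows "sqrt (x * y) + sqrt (a * b) \<le> sqrt ((x + a) * (y + b))"
proof (rule real_le_rsqrt)
  have "2 * (sqrt (x * b) * sqrt (y * a)) \<le> x * b + y * a"
    using sum_squares_bound[of "sqrt (x * b)" "sqrt (y * a)"] assms by (simp add: mult_ac)
  moreover have "sqrt (x * y) * sqrt (a * b) = sqrt (x * b) * sqrt (y * a)"
    by (simp add: real_sqrt_mult mult_ac)
  ultimately show "(sqrt (x * y) + sqrt (a * b))\<^sup>2 \<le> (x + a) * (y + b)"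
    using assms by (simp add: power2_sum algebra_simps)
qed

text \<open>Taking imaginary parts in 1 / u = A - sum \<sigma> u expresses - Im u as |u|^2 times the
  sum of Im A and a nonnegative term. With |Im u| <= |u| this also bounds - Im u.\<close>

lemma neg_Im_fixed_point:
  fixes u :: "'n::finite \<Rightarrow> complex"
  assumes \<sigma>: "\<And>i j. 0 \<le> \<sigma> i j"
    and u: "\<And>i. u i * (A i - (\<Sum>j\<in>UNIV. of_real (\<sigma> i j) * u j)) = 1" "\<And>i. Im (u i) < 0"
    and A: "\<And>i. a \<le> Im (A i)" "0 < a"
  shows "(norm (u i))\<^sup>2 * ((\<Sum>j\<in>UNIV. \<sigma> i j * - Im (u j)) + a) \<le> - Im (u i)" and "- Im (u i) \<le> 1 / a"
proof -
  let ?S = "\<Sum>j\<in>UNIV. of_real (\<sigma> i j) * u j"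
  have u0: "u i \<noteq> 0" using u(2)[of i] by auto
  have "A i - ?S = inverse (u i)"
    using u(1)[of i] u0 by (simp add: field_simps)
  then have "Im (A i) + (\<Sum>j\<in>UNIV. \<sigma> i j * - Im (u j)) = - Im (u i) / (norm (u i))\<^sup>2"
    by (simp add: complex_eq_iff Im_sum sum_negf cmod_power2)
  then have eq: "(norm (u i))\<^sup>2 * (Im (A i) + (\<Sum>j\<in>UNIV. \<sigma> i j * - Im (u j))) = - Im (u i)"
    using u0 by simp
  show 1: "(norm (u i))\<^sup>2 * ((\<Sum>j\<in>UNIV. \<sigma> i j * - Im (u j)) + a) \<le> - Im (u i)"
    unfolding eq[symmetric] using A(1)[of i] by (intro mult_left_mono) auto
  have "0 \<le> (\<Sum>j\<in>UNIV. \<sigma> i j * - Im (u j))"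
    using \<sigma> u(2) by (intro sum_nonneg mult_nonneg_nonneg) (auto intro: less_imp_le)
  then have "(norm (u i))\<^sup>2 * a \<le> (norm (u i))\<^sup>2 * ((\<Sum>j\<in>UNIV. \<sigma> i j * - Im (u j)) + a)"
    by (intro mult_left_mono) auto
  then have "(norm (u i))\<^sup>2 * a \<le> - Im (u i)"
    using 1 by linarith
  moreover have "(- Im (u i))\<^sup>2 * a \<le> (norm (u i))\<^sup>2 * a"
    using A(2) abs_Im_le_cmod[of "u i"] by (intro mult_right_mono) (auto simp: abs_le_square_iff[symmetric])
  ultimately have "(- Im (u i)) * (- Im (u i) * a) \<le> (- Im (u i)) * 1"
    by (simp add: power2_eq_square mult_ac)
  then have "- Im (u i) * a \<le> 1"
    using u(2)[of i] by (subst (asm) mult_le_cancel_left_pos) auto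
  then show "- Im (u i) \<le> 1 / a"
    using A(2) by (simp add: field_simps)
qed

text \<open>With \<open>p = - Im u\<close>, \<open>q = - Im v\<close>, the vector \<open>r i = sqrt (p i * q i)\<close> satisfies
  \<open>norm (u i * v i) * (\<Sum>j. \<sigma> i j * r j) \<le> r i - norm (u i * v i) * sqrt (a * b)\<close> by Cauchy-Schwarz,
  so a multiple of it dominates \<open>norm (u i - v i)\<close> at the index where the ratio is largest.\<close>

lemma fixed_point_stability:
  fixes u v :: "'n::finite \<Rightarrow> complex"
  assumes \<sigma>: "\<And>i j. 0 \<le> \<sigma> i j"
    and u: "\<And>i. u i * (A i - (\<Sum>j\<in>UNIV. of_real (\<sigma> i j) * u j)) = 1" "\<And>i. Im (u i) < 0"
    and v: "\<And>i. v i * (B i - (\<Sum>j\<in>UNIV. of_real (\<sigma> i j) * v j)) = 1" "\<And>i. Im (v i) < 0"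
    and A: "\<And>i. a \<le> Im (A i)" "0 < a" and B: "\<And>i. b \<le> Im (B i)" "0 < b"
    and AB: "\<And>i. norm (A i - B i) \<le> \<eta>"
  shows "norm (u i - v i) \<le> \<eta> / (a * b)"
proof -
  define p where "p i = - Im (u i)" for i
  define q where "q i = - Im (v i)" for i
  define r where "r i = sqrt (p i * q i)" for i
  define m where "m i = norm (u i) * norm (v i)" for i
  define d where "d i = norm (u i - v i)" for i
  have p: "0 < p i" and q: "0 < q i" for i using u(2) v(2) by (auto simp: p_def q_def)
  have r: "0 < r i" for i using p q by (simp add: r_def)
  have u0: "u i \<noteq> 0" and v0: "v i \<noteq> 0" for i using u(2)[of i] v(2)[of i] by auto
  have m: "0 < m i" for i using u0 v0 by (simp add: m_def)
  have \<eta>: "0 \<le> \<eta>" using order_trans[OF norm_ge_zero AB] .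
  have super: "m i * ((\<Sum>j\<in>UNIV. \<sigma> i j * r j) + sqrt (a * b)) \<le> r i" for i
  proof -
    let ?P = "\<Sum>j\<in>UNIV. \<sigma> i j * p j" and ?Q = "\<Sum>j\<in>UNIV. \<sigma> i j * q j"
    have P: "0 \<le> ?P" and Q: "0 \<le> ?Q"
      using \<sigma> p q by (auto intro!: sum_nonneg mult_nonneg_nonneg intro: less_imp_le)
    have "(\<Sum>j\<in>UNIV. \<sigma> i j * r j) = (\<Sum>j\<in>UNIV. \<bar>sqrt (\<sigma> i j * p j)\<bar> * \<bar>sqrt (\<sigma> i j * q j)\<bar>)"
      using \<sigma> p q by (intro sum.cong refl) (simp add: r_def real_sqrt_mult less_imp_le)
    also have "\<dots> \<le> L2_set (\<lambda>j. sqrt (\<sigma> i j * p j)) UNIV * L2_set (\<lambda>j. sqrt (\<sigma> i j * q j)) UNIV"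
      by (rule L2_set_mult_ineq)
    also have "\<dots> = sqrt ?P * sqrt ?Q"
      using \<sigma> p q by (simp add: L2_set_def less_imp_le)
    also have "\<dots> = sqrt (?P * ?Q)" by (simp add: real_sqrt_mult)
    finally have "(\<Sum>j\<in>UNIV. \<sigma> i j * r j) + sqrt (a * b) \<le> sqrt ((?P + a) * (?Q + b))"
      using sqrt_mult_add_le[OF P Q, of a b] A B by linarith
    then have "m i * ((\<Sum>j\<in>UNIV. \<sigma> i j * r j) + sqrt (a * b)) \<le> m i * sqrt ((?P + a) * (?Q + b))"
      using m[of i] by (intro mult_left_mono) auto
    also have "\<dots> = sqrt (((norm (u i))\<^sup>2 * (?P + a)) * ((norm (v i))\<^sup>2 * (?Q + b)))"
      by (simp add: m_def real_sqrt_mult)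
    also have "\<dots> \<le> sqrt (p i * q i)"
      unfolding real_sqrt_le_iff p_def q_def
      using neg_Im_fixed_point(1)[OF \<sigma> u A, of i] neg_Im_fixed_point(1)[OF \<sigma> v B, of i] P Q p[of i] A B
      by (intro mult_mono) (auto simp: p_def q_def)
    finally show ?thesis by (simp add: r_def)
  qed
  have diff: "d i \<le> m i * (\<eta> + (\<Sum>j\<in>UNIV. \<sigma> i j * d j))" for i
  proof -
    \<comment> \<open>Both bracketed products equal 1, so this is u - v = u v (1 / v - 1 / u) with
      the inverses replaced by the equations.\<close>
    have "u i - v i = u i * (v i * (B i - (\<Sum>j\<in>UNIV. of_real (\<sigma> i j) * v j)))
        - v i * (u i * (A i - (\<Sum>j\<in>UNIV. of_real (\<sigma> i j) * u j)))"
      unfolding u v by simp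
    also have "\<dots> = u i * v i * (B i - A i + (\<Sum>j\<in>UNIV. of_real (\<sigma> i j) * (u j - v j)))"
      by (simp add: algebra_simps sum_subtractf)
    finally have "d i = m i * norm (B i - A i + (\<Sum>j\<in>UNIV. of_real (\<sigma> i j) * (u j - v j)))"
      unfolding d_def m_def norm_mult[symmetric] by simp
    also have "\<dots> \<le> m i * (\<eta> + (\<Sum>j\<in>UNIV. \<sigma> i j * d j))"
    proof (intro mult_left_mono order_trans[OF norm_triangle_ineq] add_mono)
      show "norm (B i - A i) \<le> \<eta>" using AB[of i] by (simp add: norm_minus_commute)
      show "norm (\<Sum>j\<in>UNIV. of_real (\<sigma> i j) * (u j - v j)) \<le> (\<Sum>j\<in>UNIV. \<sigma> i j * d j)"
        by (rule order_trans[OF norm_sum]) (simp add: norm_mult d_def \<sigma>)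
    qed (use m[of i] in simp)
    finally show ?thesis .
  qed
  define K where "K = Max (range (\<lambda>i. d i / r i))"
  have "K \<in> range (\<lambda>i. d i / r i)" unfolding K_def by (rule Max_in) auto
  then obtain k where k: "K = d k / r k" by auto
  have K: "d j \<le> K * r j" for j
  proof -
    have "d j / r j \<le> K" unfolding K_def by (rule Max_ge) auto
    then show ?thesis using r[of j] by (simp add: field_simps)
  qed
  have K0: "0 \<le> K" unfolding k using r[of k] by (simp add: d_def)
  \<comment> \<open>At this index \<open>diff\<close> and \<open>super\<close> give K r <= m \<eta>
    + K (r - m sqrt (a b)). The terms K r cancel, so the argument needs no contraction.\<close>
  have "m k * (\<Sum>j\<in>UNIV. \<sigma> k j * d j) \<le> m k * (K * (\<Sum>j\<in>UNIV. \<sigma> k j * r j))"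
    unfolding sum_distrib_left using K \<sigma> m[of k]
    by (intro sum_mono mult_left_mono) (auto simp: mult.left_commute[of K] intro!: mult_left_mono)
  moreover have "K * (m k * ((\<Sum>j\<in>UNIV. \<sigma> k j * r j) + sqrt (a * b))) \<le> K * r k"
    by (intro mult_left_mono super K0)
  moreover have "d k = K * r k" using r[of k] k by simp
  ultimately have "m k * (K * sqrt (a * b)) \<le> m k * \<eta>"
    using diff[of k] by (simp add: algebra_simps)
  then have "K * sqrt (a * b) \<le> \<eta>" using m[of k] by simp
  then have K_le: "K \<le> \<eta> / sqrt (a * b)" using A B by (simp add: pos_le_divide_eq)
  \<comment> \<open>The bounds 1 / a and 1 / b on the negative imaginary parts lead back from the
    weighted ratio to the distance itself and supply the second factor 1 / sqrt (a b).\<close>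
  have "p i * q i \<le> 1 / a * (1 / b)"
    unfolding p_def q_def
    using neg_Im_fixed_point(2)[OF \<sigma> u A] neg_Im_fixed_point(2)[OF \<sigma> v B] v(2)[of i] A
    by (intro mult_mono) auto
  then have "r i \<le> 1 / sqrt (a * b)"
    unfolding r_def by (metis real_sqrt_divide real_sqrt_le_iff real_sqrt_one times_divide_times_eq mult_1)
  then have "K * r i \<le> \<eta> / sqrt (a * b) * (1 / sqrt (a * b))"
    using K_le \<eta> r[of i] A B by (intro mult_mono) auto
  also have "\<dots> = \<eta> / (a * b)" using A B by simp
  finally show ?thesis using K[of i] by (simp add: d_def)
qed

section \<open>Resolvent entries as linear statistics, and their approximate fixed point
  equation\<close>

definition unit_matrix :: "'n \<Rightarrow> 'n \<Rightarrow> complex^'n::finite^'n::finite" where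
  "unit_matrix i j = (\<chi> a b. if a = i \<and> b = j then 1 else 0)"

lemma unit_matrix_mult: "(unit_matrix i j ** A) $ a $ b = (if a = i then A $ j $ b else 0)"
proof -
  have "(\<Sum>k\<in>UNIV. (if a = i \<and> k = j then 1 else 0) * A $ k $ b) = (\<Sum>k\<in>UNIV. if k = j then (if a = i then A $ k $ b else 0) else 0)"
    by (intro sum.cong) auto
  then show ?thesis
    by (simp add: matrix_matrix_mult_def unit_matrix_def)
qed

lemma trace_unit_matrix_mult: "trace (unit_matrix i j ** A) = A $ j $ i"
  by (simp add: trace_def unit_matrix_mult)

lemma norm_unit_matrix: "norm (unit_matrix i j) = 1"
proof -
  have "(norm (unit_matrix i j))\<^sup>2 = (\<Sum>a\<in>UNIV. \<Sum>b\<in>UNIV. if b = j then (if a = i then 1 else 0) else 0)"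
    unfolding norm_matrix_sq unit_matrix_def by (intro sum.cong) auto
  then have "(norm (unit_matrix i j))\<^sup>2 = 1\<^sup>2" by simp
  then show ?thesis by (subst (asm) power2_eq_iff_nonneg) auto
qed

context gue_model
begin

lemma F_unit: "F (unit_matrix j i) x = R x $ i $ j"
  by (simp add: F_def trace_unit_matrix_mult)

lemma integrable_F: "integrable gauss (F A)"
proof -
  obtain B where "gauss_test_function (F A) (F' A) (F'' A) B" by (rule F_test_function)
  then show ?thesis by (rule gauss_test_function.integrable)
qed

lemma integrable_R_entry: "integrable gauss (\<lambda>x. R x $ i $ j)"
  using integrable_F[of "unit_matrix j i"] by (simp add: F_unit[abs_def])

definition g where "g i = (\<integral>x. R x $ i $ i \<partial>gauss)"
definition \<rho> where "\<rho> i x = (\<Sum>j\<in>UNIV. of_real (\<sigma> i j) * R x $ j $ j)"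
text \<open>The weight that turns \<open>\<rho> i\<close> into a linear statistic, so that the
  variance bound covers it.\<close>

definition row_matrix :: "'n \<Rightarrow> ((complex, 'n) vec, 'n) vec" where
  "row_matrix i = (\<chi> a b. if a = b then of_real (\<sigma> i a) else 0)"

lemma F_row: "F (row_matrix i) x = \<rho> i x"
  by (simp add: F_def \<rho>_def row_matrix_def trace_def matrix_matrix_mult_def if_distrib[of "\<lambda>c. c * _"] cong: if_cong)

lemma norm_row_matrix: "(norm (row_matrix i))\<^sup>2 \<le> real CARD('n) * s\<^sup>2"
proof -
  have "(norm (row_matrix i))\<^sup>2 = (\<Sum>a\<in>UNIV. \<Sum>b\<in>UNIV. if a = b then (\<sigma> i a)\<^sup>2 else 0)"
    unfolding norm_matrix_sq row_matrix_def by (intro sum.cong) auto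
  also have "\<dots> = (\<Sum>a\<in>UNIV. (\<sigma> i a)\<^sup>2)" by simp
  also have "\<dots> \<le> (\<Sum>a\<in>(UNIV::'n set). s\<^sup>2)"
    by (intro sum_mono power_mono \<sigma>_le \<sigma>_nonneg)
  finally show ?thesis by simp
qed

lemma integral_\<rho>: "(\<integral>x. \<rho> i x \<partial>gauss) = (\<Sum>j\<in>UNIV. of_real (\<sigma> i j) * g j)"
  unfolding \<rho>_def g_def using integrable_R_entry by simp

text \<open>This is the expected diagonal of (z - X - Y) R = 1. Integration by parts replaces each
  coordinate in X R by a derivative of R, and \<open>sum_direction_sandwich\<close> collapses the
  resulting sum of D R D R to \<rho> times R. Because \<open>Y\<close> is diagonal, it contributes
  only \<open>Y $ i $ i\<close>.\<close>

lemma dyson_equation: "(z - Y $ i $ i) * g i - (\<integral>x. \<rho> i x * R x $ i $ i \<partial>gauss) = 1"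
proof -
  \<comment> \<open>With this weight the statistic \<open>F\<close> is the coefficient of
    \<open>x $ \<alpha>\<close> in the diagonal entry of X R.\<close>
  let ?A = "\<lambda>\<alpha>. unit_matrix i i ** D \<alpha>"
  have FA: "F (?A \<alpha>) x = (D \<alpha> ** R x) $ i $ i" for \<alpha> x
    by (simp add: F_def matrix_mul_assoc[symmetric] trace_unit_matrix_mult)
  have F'A: "F' (?A \<alpha>) \<alpha> x = (D \<alpha> ** (R x ** D \<alpha> ** R x)) $ i $ i" for \<alpha> x
    by (simp add: F'_def matrix_mul_assoc[symmetric] trace_unit_matrix_mult)
  have HR: "(gue_matrix \<sigma> x ** R x) $ i $ i = (\<Sum>\<alpha>\<in>UNIV. x $ \<alpha> *\<^sub>R F (?A \<alpha>) x)" for x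
    by (simp add: gue_matrix_expand[of \<sigma> x] matrix_mult.sum_left matrix_mult.scaleR_left FA)
  have ibp: "(\<integral>x. x $ \<alpha> *\<^sub>R F (?A \<alpha>) x \<partial>gauss) = (\<integral>x. F' (?A \<alpha>) \<alpha> x \<partial>gauss)"
    and int: "integrable gauss (\<lambda>x. x $ \<alpha> *\<^sub>R F (?A \<alpha>) x)"
    and int': "integrable gauss (F' (?A \<alpha>) \<alpha>)" for \<alpha>
  proof -
    obtain B where "gauss_test_function (F (?A \<alpha>)) (F' (?A \<alpha>)) (F'' (?A \<alpha>)) B" by (rule F_test_function)
    then interpret T: gauss_test_function "F (?A \<alpha>)" "F' (?A \<alpha>)" "F'' (?A \<alpha>)" B .
    show "(\<integral>x. x $ \<alpha> *\<^sub>R F (?A \<alpha>) x \<partial>gauss) = (\<integral>x. F' (?A \<alpha>) \<alpha> x \<partial>gauss)"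
      by (rule gauss_integration_by_parts[OF T.partial T.cont T.bound T.cont' T.bound'])
    show "integrable gauss (\<lambda>x. x $ \<alpha> *\<^sub>R F (?A \<alpha>) x)"
      by (rule integrable_gauss_component_scaleR[OF T.cont T.bound])
    show "integrable gauss (F' (?A \<alpha>) \<alpha>)"
      by (rule integrable_gauss_bounded[OF T.cont' T.bound'])
  qed
  have sumF': "(\<Sum>\<alpha>\<in>UNIV. F' (?A \<alpha>) \<alpha> x) = \<rho> i x * R x $ i $ i" for x
  proof -
    have "(\<Sum>\<alpha>\<in>UNIV. F' (?A \<alpha>) \<alpha> x) = (\<Sum>\<alpha>\<in>UNIV. \<Sum>k\<in>UNIV. (D \<alpha> ** R x ** D \<alpha>) $ i $ k * R x $ k $ i)"
      unfolding F'A matrix_mul_assoc by (subst matrix_matrix_mult_def) simp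
    also have "\<dots> = (\<Sum>k\<in>UNIV. (\<Sum>\<alpha>\<in>UNIV. (D \<alpha> ** R x ** D \<alpha>) $ i $ k) * R x $ k $ i)"
      by (subst sum.swap) (simp add: sum_distrib_right)
    also have "\<dots> = (\<Sum>k\<in>UNIV. if i = k then \<rho> i x * R x $ k $ i else 0)"
      unfolding sum_direction_sandwich by (intro sum.cong) (auto simp: \<rho>_def)
    finally show ?thesis by simp
  qed
  have eq: "(z - Y $ i $ i) * R x $ i $ i - (gue_matrix \<sigma> x ** R x) $ i $ i = 1" for x
  proof -
    have "((mat z - (gue_matrix \<sigma> x + Y)) ** R x) $ i $ i = 1"
      unfolding R_mult by (simp add: mat_def)
    moreover have "(mat z ** R x) $ i $ i = z * R x $ i $ i"
      by (simp add: mat_def matrix_matrix_mult_def if_distrib[of "\<lambda>c. c * _"] cong: if_cong)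
    moreover have "(Y ** R x) $ i $ i = Y $ i $ i * R x $ i $ i"
    proof -
      have "(\<Sum>k\<in>UNIV. Y $ i $ k * R x $ k $ i) = (\<Sum>k\<in>UNIV. if i = k then Y $ i $ k * R x $ k $ i else 0)"
        using Y_diag by (intro sum.cong) (auto simp: diagonal_matrix_def)
      then show ?thesis by (simp add: matrix_matrix_mult_def)
    qed
    ultimately show ?thesis
      by (simp add: matrix_mult.diff_left matrix_mult.add_left algebra_simps)
  qed
  have "(\<integral>x. (gue_matrix \<sigma> x ** R x) $ i $ i \<partial>gauss) = (\<Sum>\<alpha>\<in>UNIV. \<integral>x. F' (?A \<alpha>) \<alpha> x \<partial>gauss)"
    unfolding HR using int by (simp add: ibp)
  also have "\<dots> = (\<integral>x. \<rho> i x * R x $ i $ i \<partial>gauss)"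
    using int' by (simp flip: sumF')
  finally have E: "(\<integral>x. (gue_matrix \<sigma> x ** R x) $ i $ i \<partial>gauss) = (\<integral>x. \<rho> i x * R x $ i $ i \<partial>gauss)" .
  have "integrable gauss (\<lambda>x. (gue_matrix \<sigma> x ** R x) $ i $ i)"
    unfolding HR using int by simp
  then have "(\<integral>x. (z - Y $ i $ i) * R x $ i $ i - (gue_matrix \<sigma> x ** R x) $ i $ i \<partial>gauss)
     = (z - Y $ i $ i) * g i - (\<integral>x. \<rho> i x * R x $ i $ i \<partial>gauss)"
    unfolding E[symmetric] g_def using integrable_R_entry by simp
  then show ?thesis
    unfolding eq by (simp add: gauss.prob_space[unfolded space_gauss])
qed

text \<open>With y = Im z, the variances are at most N s^3 / y^4 for \<open>\<rho> i\<close> and s /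
  y^4 for a single entry; the bound is the square root of their product.\<close>

lemma covariance_bound:
  "norm ((\<integral>x. \<rho> i x * R x $ i $ i \<partial>gauss) - (\<integral>x. \<rho> i x \<partial>gauss) * g i)
    \<le> s\<^sup>2 * sqrt (real CARD('n)) / (Im z) ^ 4"
proof -
  let ?N = "real CARD('n)"
  define a where "a x = \<rho> i x - (\<integral>x. \<rho> i x \<partial>gauss)" for x
  define b where "b x = R x $ i $ i - g i" for x
  have N: "0 < ?N" by simp
  have Va: "(\<integral>x. (norm (a x))\<^sup>2 \<partial>gauss) \<le> s * ((?N * s\<^sup>2) / (Im z) ^ 4)"
    using order_trans[OF F_variance[of "row_matrix i"] mult_left_mono[OF divide_right_mono[OF norm_row_matrix]]] s_pos z_pos
    unfolding F_row a_def by simp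
  have Vb: "(\<integral>x. (norm (b x))\<^sup>2 \<partial>gauss) \<le> s * (1 / (Im z) ^ 4)"
    using F_variance[of "unit_matrix i i"] unfolding F_unit b_def g_def norm_unit_matrix by simp
  obtain Ba where Ba: "gauss_test_function (F (row_matrix i)) (F' (row_matrix i)) (F'' (row_matrix i)) Ba" by (rule F_test_function)
  obtain Bb where Bb: "gauss_test_function (F (unit_matrix i i)) (F' (unit_matrix i i)) (F'' (unit_matrix i i)) Bb" by (rule F_test_function)
  interpret a: gauss_test_function a "F' (row_matrix i)" "F'' (row_matrix i)" "2 * Ba"
    using gauss_test_function.test_function_centered[OF Ba] unfolding F_row[abs_def] a_def[abs_def] .
  interpret b: gauss_test_function b "F' (unit_matrix i i)" "F'' (unit_matrix i i)" "2 * Bb"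
    using gauss_test_function.test_function_centered[OF Bb] unfolding F_unit[abs_def] b_def[abs_def] g_def .
  have iab: "integrable gauss (\<lambda>x. a x * b x)"
  proof (rule integrable_gauss_bounded)
    show "norm (a x * b x) \<le> 2 * Ba * (2 * Bb)" for x
      unfolding norm_mult by (intro mult_mono a.bound b.bound a.bound_nonneg norm_ge_zero)
  qed (intro continuous_intros a.cont b.cont)
  have ia2: "integrable gauss (\<lambda>x. (norm (a x))\<^sup>2)" and ib2: "integrable gauss (\<lambda>x. (norm (b x))\<^sup>2)"
    by (rule a.integrable_norm_power b.integrable_norm_power)+
  have mean: "(\<integral>x. b x \<partial>gauss) = 0"
    unfolding b_def g_def using integrable_R_entry by (simp add: gauss.prob_space[unfolded space_gauss])
  have i\<rho>: "integrable gauss (\<rho> i)" using integrable_F[of "row_matrix i"] by (simp add: F_row[abs_def])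
  have "\<rho> i x * R x $ i $ i = a x * b x + (\<integral>x. \<rho> i x \<partial>gauss) * b x + \<rho> i x * g i" for x
    by (simp add: a_def b_def algebra_simps)
  then have "(\<integral>x. \<rho> i x * R x $ i $ i \<partial>gauss)
      = (\<integral>x. a x * b x \<partial>gauss) + (\<integral>x. \<rho> i x \<partial>gauss) * (\<integral>x. b x \<partial>gauss) + (\<integral>x. \<rho> i x \<partial>gauss) * g i"
    using iab b.integrable i\<rho> by simp
  then have "norm ((\<integral>x. \<rho> i x * R x $ i $ i \<partial>gauss) - (\<integral>x. \<rho> i x \<partial>gauss) * g i) = norm (\<integral>x. a x * b x \<partial>gauss)"
    by (simp add: mean)
  \<comment> \<open>The weight s sqrt N is the ratio of the two standard deviation bounds; with it
    this pointwise inequality is as sharp as Cauchy-Schwarz.\<close>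
  also have "\<dots> \<le> (\<integral>x. (norm (a x))\<^sup>2 / (2 * (s * sqrt ?N)) + s * sqrt ?N * (norm (b x))\<^sup>2 / 2 \<partial>gauss)"
  proof (rule Bochner_Integration.integral_norm_bound_integral[OF iab])
    show "integrable gauss (\<lambda>x. (norm (a x))\<^sup>2 / (2 * (s * sqrt ?N)) + s * sqrt ?N * (norm (b x))\<^sup>2 / 2)"
      using ia2 ib2 by simp
    fix x
    let ?t = "s * sqrt ?N"
    have t: "0 < ?t" using s_pos by simp
    have "(norm (a x))\<^sup>2 / (2 * r) + r * (norm (b x))\<^sup>2 / 2 - norm (a x) * norm (b x)
        = (norm (a x) - r * norm (b x))\<^sup>2 / (2 * r)" if "0 < r" for r
      using that by (simp add: field_simps power2_eq_square)
    from this[OF t] t show "norm (a x * b x) \<le> (norm (a x))\<^sup>2 / (2 * ?t) + ?t * (norm (b x))\<^sup>2 / 2"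
      unfolding norm_mult by (smt (verit) divide_nonneg_nonneg zero_le_power2)
  qed
  also have "\<dots> = (\<integral>x. (norm (a x))\<^sup>2 \<partial>gauss) / (2 * (s * sqrt ?N)) + s * sqrt ?N * (\<integral>x. (norm (b x))\<^sup>2 \<partial>gauss) / 2"
    using ia2 ib2 by simp
  also have "\<dots> \<le> (s * ((?N * s\<^sup>2) / (Im z) ^ 4)) / (2 * (s * sqrt ?N)) + s * sqrt ?N * (s * (1 / (Im z) ^ 4)) / 2"
    using s_pos by (intro add_mono divide_right_mono mult_left_mono Va Vb) auto
  also have "\<dots> = s\<^sup>2 * sqrt ?N / (Im z) ^ 4"
  proof -
    have "(s * ((r\<^sup>2 * s\<^sup>2) / y)) / (2 * (s * r)) + s * r * (s * (1 / y)) / 2 = s\<^sup>2 * r / y" if "0 < r" "0 < y" for r y :: real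
      using that s_pos by (simp add: field_simps power2_eq_square)
    from this[of "sqrt ?N" "(Im z) ^ 4"] show ?thesis using z_pos N by simp
  qed
  finally show ?thesis .
qed

text \<open>The negative imaginary part is Im z times the squared length of column \<open>i\<close>
  of the resolvent. Averaged, it keeps the denominators \<open>W\<close> of
  \<open>bias_bound\<close> at imaginary part at least Im z.\<close>

lemma Im_R_nonpos: "Im (R x $ i $ i) \<le> 0"
proof -
  let ?v = "R x *v axis i 1"
  have v: "?v $ j = R x $ j $ i" for j
    by (simp add: matrix_vector_mult_def axis_def if_distrib[of "\<lambda>c. _ * c"] cong: if_cong)
  have "(mat z - (gue_matrix \<sigma> x + Y)) *v ?v = axis i 1"
    by (simp add: matrix_vector_mul_assoc R_mult)
  then have form: "Im (\<Sum>j\<in>UNIV. cnj (?v $ j) * axis i 1 $ j) = Im z * (norm ?v)\<^sup>2"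
    using Im_hermitian_shift_form[OF hermitian_model[of x], of ?v z] by simp
  have pick: "(\<Sum>j\<in>UNIV. cnj (w $ j) * axis i 1 $ j) = cnj (w $ i)" for w :: "(complex, 'n) vec"
    by (simp add: axis_def if_distrib[of "\<lambda>c. _ * c"] cong: if_cong)
  have "- Im (R x $ i $ i) = Im z * (norm ?v)\<^sup>2"
    using form unfolding pick by (simp add: v)
  moreover have "0 \<le> Im z * (norm ?v)\<^sup>2" using z_pos by simp
  ultimately show ?thesis by linarith
qed

lemma Im_g_nonpos: "Im (g i) \<le> 0"
proof -
  have "Im (g i) = (\<integral>x. Im (R x $ i $ i) \<partial>gauss)"
    unfolding g_def using integrable_R_entry by simp
  also have "\<dots> \<le> 0"
    using Bochner_Integration.integral_nonneg[of gauss "\<lambda>x. - Im (R x $ i $ i)"] Im_R_nonpos by simp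
  finally show ?thesis .
qed

theorem bias_bound:
  assumes v: "\<And>i. v i * (z - Y $ i $ i - (\<Sum>j\<in>UNIV. of_real (\<sigma> i j) * v j)) = 1" "\<And>i. Im (v i) < 0"
    and \<epsilon>: "\<epsilon> = s\<^sup>2 * sqrt (real CARD('n)) / (Im z) ^ 5"
    and \<delta>: "0 < \<delta>" "real CARD('n) * s * \<epsilon> \<le> (1 - \<delta>) * Im z"
  shows "norm (g i - v i) \<le> (1 + real CARD('n) * s / (\<delta> * (Im z)\<^sup>2)) * \<epsilon>"
proof -
  define W where "W i = z - Y $ i $ i - (\<Sum>j\<in>UNIV. of_real (\<sigma> i j) * g j)" for i
  \<comment> \<open>It is \<open>u\<close>, rather than \<open>g\<close>, that solves a neighbouring
    equation exactly; the two differ by the covariance divided by \<open>W\<close>.\<close>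
  define u where "u i = inverse (W i)" for i
  have ImY: "Im (Y $ i $ i) = 0" for i
    using hermitian_matrix_nth[OF Y_herm, of i i] by (simp add: complex_eq_iff)
  have ImW: "Im z \<le> Im (W i)" for i
  proof -
    have "(\<Sum>j\<in>UNIV. \<sigma> i j * Im (g j)) \<le> 0"
      by (intro sum_nonpos mult_nonneg_nonpos \<sigma>_nonneg Im_g_nonpos)
    then show ?thesis by (simp add: W_def ImY Im_sum)
  qed
  have W0: "W i \<noteq> 0" for i using ImW[of i] z_pos by auto
  have normW: "Im z \<le> norm (W i)" for i
    using ImW[of i] abs_Im_le_cmod[of "W i"] z_pos by linarith
  have \<epsilon>0: "0 \<le> \<epsilon>" unfolding \<epsilon> using z_pos by simp
  have gu: "norm (g i - u i) \<le> \<epsilon>" for i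
  proof -
    have "W i * g i - 1 = (\<integral>x. \<rho> i x * R x $ i $ i \<partial>gauss) - (\<integral>x. \<rho> i x \<partial>gauss) * g i"
      unfolding W_def integral_\<rho> using dyson_equation[of i] by (simp add: algebra_simps)
    then have "norm (W i * g i - 1) \<le> s\<^sup>2 * sqrt (real CARD('n)) / (Im z) ^ 4"
      using covariance_bound[of i] by simp
    moreover have "g i - u i = (W i * g i - 1) / W i"
      using W0[of i] by (simp add: u_def field_simps)
    ultimately have "norm (g i - u i) \<le> (s\<^sup>2 * sqrt (real CARD('n)) / (Im z) ^ 4) / Im z"
      using normW[of i] z_pos by (simp only: norm_divide, intro frac_le) auto
    then show ?thesis
      unfolding \<epsilon> by (simp add: power_Suc2[of _ 4, simplified] eval_nat_numeral mult_ac)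
  qed
  \<comment> \<open>Chosen so that subtracting the sum over \<open>u\<close> leaves W = 1 / u. In
    terms of the perturbed parameter this is the diagonal of \<Lambda>' - Y.\<close>
  define A where "A i = W i + (\<Sum>j\<in>UNIV. of_real (\<sigma> i j) * u j)" for i
  define \<eta> where "\<eta> = real CARD('n) * s * \<epsilon>"
  have AB: "norm (A i - (z - Y $ i $ i)) \<le> \<eta>" for i
  proof -
    have "A i - (z - Y $ i $ i) = (\<Sum>j\<in>UNIV. of_real (\<sigma> i j) * (u j - g j))"
      by (simp add: A_def W_def algebra_simps sum_subtractf)
    also have "norm \<dots> \<le> (\<Sum>j\<in>(UNIV::'n set). s * \<epsilon>)"
      by (intro order_trans[OF norm_sum] sum_mono)
        (use gu \<sigma>_nonneg \<sigma>_le s_pos in \<open>auto simp: norm_mult norm_minus_commute intro!: mult_mono less_imp_le[OF s_pos]\<close>)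
    finally show ?thesis by (simp add: \<eta>_def mult_ac)
  qed
  \<comment> \<open>The factors of the denominator are the lower bounds for the imaginary parts of
    \<open>A\<close> and of the unperturbed z - Y.\<close>
  have "norm (u i - v i) \<le> \<eta> / ((\<delta> * Im z) * Im z)"
  proof (rule fixed_point_stability[OF \<sigma>_nonneg _ _ v, where A = A])
    show "u i * (A i - (\<Sum>j\<in>UNIV. of_real (\<sigma> i j) * u j)) = 1" for i
      using W0[of i] by (simp add: A_def u_def)
    show "Im (u i) < 0" for i
      using ImW[of i] W0[of i] z_pos by (simp add: u_def divide_neg_pos sum_power2_gt_zero_iff complex_eq_iff)
    show "\<delta> * Im z \<le> Im (A i)" for i
    proof -
      have "\<bar>Im (A i - (z - Y $ i $ i))\<bar> \<le> (1 - \<delta>) * Im z"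
        using order_trans[OF abs_Im_le_cmod order_trans[OF AB \<delta>(2)[folded \<eta>_def]]] .
      then show ?thesis by (simp add: ImY algebra_simps)
    qed
  qed (use AB z_pos \<delta> ImY in auto)
  then have "norm (g i - v i) \<le> \<epsilon> + \<eta> / ((\<delta> * Im z) * Im z)"
    using norm_triangle_ineq[of "g i - u i" "u i - v i"] gu[of i] by simp
  also have "\<dots> = (1 + real CARD('n) * s / (\<delta> * (Im z)\<^sup>2)) * \<epsilon>"
    by (simp add: \<eta>_def algebra_simps power2_eq_square)
  finally show ?thesis .
qed

text \<open>A sign change at the single index \<open>i\<close> negates the entry (i, j) of the
  resolvent while preserving the Gaussian law, so its mean equals its own negative.\<close>

lemma expectation_offdiagonal:
  assumes "i \<noteq> j"
  shows "(\<integral>x. R x $ i $ j \<partial>gauss) = 0"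
proof -
  define e :: "'n \<Rightarrow> real" where "e a = (if a = i then -1 else 1)" for a
  define S :: "((complex, 'n) vec, 'n) vec" where "S = (\<chi> a b. if a = b then of_real (e a) else 0)"
  \<comment> \<open>Conjugation by \<open>S\<close> can be carried out on the coordinates: the
    matrix entry (a, b) reads only the coordinates (a, b) and (b, a), and both receive the same
    sign.\<close>
  define flip :: "real^('n \<times> 'n) \<Rightarrow> real^('n \<times> 'n)" where "flip x = (\<chi> \<alpha>. (e (fst \<alpha>) * e (snd \<alpha>)) * x $ \<alpha>)" for x
  have ee: "e a * e a = 1" for a by (simp add: e_def)
  have S_mult: "(S ** A) $ a $ b = of_real (e a) * A $ a $ b" for A a b
    by (simp add: S_def matrix_matrix_mult_def if_distrib[of "\<lambda>c. c * _"] cong: if_cong)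
  have mult_S: "(A ** S) $ a $ b = of_real (e b) * A $ a $ b" for A a b
    by (simp add: S_def matrix_matrix_mult_def if_distrib[of "\<lambda>c. _ * c"] mult.commute cong: if_cong)
  have SS: "S ** S = mat 1"
    by (simp add: vec_eq_iff S_mult) (simp add: S_def mat_def e_def)
  have entry: "gue_entry a b (flip x) = of_real (e a * e b) * gue_entry a b x" for a b x
    by (auto simp: gue_entry_def flip_def complex_eq_iff e_def)
  have "gue_matrix \<sigma> (flip x) = S ** gue_matrix \<sigma> x ** S" for x
    by (simp add: vec_eq_iff S_mult mult_S gue_matrix_def entry mult_ac)
  moreover have "Y = S ** Y ** S"
    using Y_diag by (auto simp: vec_eq_iff S_mult mult_S diagonal_matrix_def e_def)
  moreover have "mat z = S ** mat z ** S"
    by (auto simp: vec_eq_iff S_mult mult_S mat_def e_def)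
  ultimately have M: "mat z - (gue_matrix \<sigma> (flip x) + Y) = S ** (mat z - (gue_matrix \<sigma> x + Y)) ** S" for x
    by (simp add: matrix_mult.diff_left matrix_mult.diff_right matrix_mult.add_left matrix_mult.add_right)
  have "R (flip x) = S ** R x ** S" for x
    unfolding R_def[of "flip x"]
  proof (rule matrix_inv_unique)
    have "(mat z - (gue_matrix \<sigma> (flip x) + Y)) ** (S ** R x ** S)
      = S ** ((mat z - (gue_matrix \<sigma> x + Y)) ** (S ** S) ** R x) ** S"
      unfolding M by (simp only: matrix_mul_assoc)
    also have "\<dots> = mat 1" by (simp add: SS R_mult)
    finally show "(mat z - (gue_matrix \<sigma> (flip x) + Y)) ** (S ** R x ** S) = mat 1" .
  qed
  then have neg: "R (flip x) $ i $ j = - R x $ i $ j" for x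
    using assms by (simp add: S_mult mult_S e_def)
  have "distr gauss borel flip = gauss"
    unfolding flip_def by (rule gauss_sign_flip) (auto simp: e_def)
  then have "(\<integral>x. R x $ i $ j \<partial>gauss) = (\<integral>x. R x $ i $ j \<partial>(distr gauss borel flip))" by simp
  also have "\<dots> = (\<integral>x. R (flip x) $ i $ j \<partial>gauss)"
  proof (rule integral_distr)
    show "flip \<in> measurable gauss borel"
      unfolding flip_def by (intro borel_measurable_gauss continuous_intros)
    show "(\<lambda>x. R x $ i $ j) \<in> borel_measurable borel"
      by (intro borel_measurable_continuous_onI continuous_intros R_cont)
  qed
  also have "\<dots> = - (\<integral>x. R x $ i $ j \<partial>gauss)" by (simp add: neg)
  finally show ?thesis by simp
qed

end

section \<open>The law of a matrix with a variance profile\<close>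

text \<open>Independent parts with given marginals determine the law. The entries of the given array
  and those of the coordinate model are both brought to this common form.\<close>

lemma distr_complex_normal:
  fixes u :: "'w \<Rightarrow> complex"
  assumes M: "prob_space M"
    and Re: "distributed M lborel (\<lambda>\<omega>. Re (u \<omega>)) (normal_density 0 r)"
    and Im: "distributed M lborel (\<lambda>\<omega>. Im (u \<omega>)) (normal_density 0 r)"
    and ind: "prob_space.indep_var M borel (\<lambda>\<omega>. Re (u \<omega>)) borel (\<lambda>\<omega>. Im (u \<omega>))"
  shows "distr M borel u = distr (density lborel (normal_density 0 r) \<Otimes>\<^sub>M density lborel (normal_density 0 r)) borel
    (\<lambda>p. complex_of_real (fst p) + \<i> * complex_of_real (snd p))"
proof -
  interpret prob_space M by fact
  let ?n = "density lborel (\<lambda>x. ennreal (normal_density 0 r x))"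
  have d: "distr M borel (\<lambda>\<omega>. Re (u \<omega>)) = ?n" "distr M borel (\<lambda>\<omega>. Im (u \<omega>)) = ?n"
    using distributed_distr_eq_density[OF Re] distributed_distr_eq_density[OF Im]
    by (simp_all cong: distr_cong)
  have rv [measurable]: "(\<lambda>\<omega>. Re (u \<omega>)) \<in> borel_measurable M" "(\<lambda>\<omega>. Im (u \<omega>)) \<in> borel_measurable M"
    using ind unfolding indep_var_distribution_eq by auto
  have "?n \<Otimes>\<^sub>M ?n = distr M (borel \<Otimes>\<^sub>M borel) (\<lambda>\<omega>. (Re (u \<omega>), Im (u \<omega>)))"
    using ind unfolding indep_var_distribution_eq d by simp
  then have "distr (?n \<Otimes>\<^sub>M ?n) borel (\<lambda>p. complex_of_real (fst p) + \<i> * complex_of_real (snd p))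
      = distr M borel (\<lambda>\<omega>. complex_of_real (Re (u \<omega>)) + \<i> * complex_of_real (Im (u \<omega>)))"
    by (simp add: distr_distr comp_def)
  also have "\<dots> = distr M borel u"
    by (intro distr_cong) (auto simp: complex_eq_iff)
  finally show ?thesis ..
qed

lemma distributed_gauss_component:
  "distributed gauss lborel (\<lambda>x::real^'i. x $ i) std_normal_density"
  using distr_gauss_component[of i] by (simp add: distributed_def cong: distr_cong)

lemma indep_var_gauss_components:
  fixes i j :: "'i::finite"
  assumes "i \<noteq> j"
  shows "prob_space.indep_var gauss borel (\<lambda>x::real^'i. a * x $ i) borel (\<lambda>x. b * x $ j)"
proof -
  have "gauss.indep_var (Pi\<^sub>M {i} (\<lambda>_. borel)) (\<lambda>x::real^'i. \<lambda>k\<in>{i}. x $ k) (Pi\<^sub>M {j} (\<lambda>_. borel)) (\<lambda>x. \<lambda>k\<in>{j}. x $ k)"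
    by (rule gauss.indep_var_restrict[OF indep_vars_gauss]) (use assms in auto)
  from gauss.indep_var_compose[OF this, of "\<lambda>f. a * f i" borel "\<lambda>f. b * f j" borel]
  show ?thesis by (simp add: comp_def)
qed

text \<open>On both sides the lower triangle consists of independent entries with equal marginals,
  so the joint laws are the same product measure.\<close>

lemma gue_entries_law:
  fixes x :: "'n::{finite,linorder} \<Rightarrow> 'n \<Rightarrow> 'w \<Rightarrow> complex"
  assumes M: "prob_space M" and x: "standard_gue_array M x"
  defines "J \<equiv> {(i, j). j \<le> i} :: ('n \<times> 'n) set"
  shows "distr M (Pi\<^sub>M J (\<lambda>_. borel)) (\<lambda>\<omega>. \<lambda>\<alpha>\<in>J. x (fst \<alpha>) (snd \<alpha>) \<omega>)
    = distr gauss (Pi\<^sub>M J (\<lambda>_. borel)) (\<lambda>y. \<lambda>\<alpha>\<in>J. gue_entry (fst \<alpha>) (snd \<alpha>) y)"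
proof -
  interpret prob_space M by fact
  have J: "J \<noteq> {}" by (auto simp: J_def)
  have indM: "indep_vars (\<lambda>_. borel) (\<lambda>\<alpha>. x (fst \<alpha>) (snd \<alpha>)) J"
    using x unfolding standard_gue_array_def J_def split_beta' by blast
  \<comment> \<open>The coordinates read by the entry \<alpha>. For distinct positions in the lower
    triangle these sets are disjoint, which gives the independence.\<close>
  define K :: "'n \<times> 'n \<Rightarrow> ('n \<times> 'n) set" where "K \<alpha> = {\<alpha>, (snd \<alpha>, fst \<alpha>)}" for \<alpha>
  define h :: "'n \<times> 'n \<Rightarrow> ('n \<times> 'n \<Rightarrow> real) \<Rightarrow> complex" where
    "h \<alpha> f = (if fst \<alpha> = snd \<alpha> then of_real (f \<alpha>)
       else of_real (f \<alpha> / sqrt 2) + \<i> * of_real (f (snd \<alpha>, fst \<alpha>) / sqrt 2))" for \<alpha> f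
  have h: "h \<alpha> (\<lambda>\<beta>\<in>K \<alpha>. y $ \<beta>) = gue_entry (fst \<alpha>) (snd \<alpha>) y" if "\<alpha> \<in> J" for \<alpha> y
    using that by (cases \<alpha>) (auto simp: h_def gue_entry_def K_def J_def complex_eq_iff)
  have "gauss.indep_vars (\<lambda>\<alpha>. Pi\<^sub>M (K \<alpha>) (\<lambda>_. borel)) (\<lambda>\<alpha> y::real^('n \<times> 'n). \<lambda>\<beta>\<in>K \<alpha>. y $ \<beta>) J"
    by (rule gauss.indep_vars_restrict[OF indep_vars_gauss])
      (auto simp: disjoint_family_on_def K_def J_def)
  then have "gauss.indep_vars (\<lambda>_. borel) (\<lambda>\<alpha> y::real^('n \<times> 'n). h \<alpha> (\<lambda>\<beta>\<in>K \<alpha>. y $ \<beta>)) J"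
  proof (rule gauss.indep_vars_compose2)
    fix \<alpha> :: "'n \<times> 'n"
    have "(\<lambda>f. f \<alpha>) \<in> borel_measurable (Pi\<^sub>M (K \<alpha>) (\<lambda>_. borel :: real measure))"
      "(\<lambda>f. f (snd \<alpha>, fst \<alpha>)) \<in> borel_measurable (Pi\<^sub>M (K \<alpha>) (\<lambda>_. borel :: real measure))"
      by (auto intro!: measurable_component_singleton simp: K_def)
    then show "h \<alpha> \<in> borel_measurable (Pi\<^sub>M (K \<alpha>) (\<lambda>_. borel))"
      unfolding h_def by (cases "fst \<alpha> = snd \<alpha>") simp_all
  qed
  then have indG: "gauss.indep_vars (\<lambda>_. borel) (\<lambda>\<alpha>. gue_entry (fst \<alpha>) (snd \<alpha>)) J"
    by (rule gauss.indep_vars_cong[THEN iffD1, rotated -1]) (auto simp: h)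
  have comp: "distr M borel (x i j) = distr gauss borel (gue_entry i j)" if "j \<le> i" for i j
  proof (cases "i = j")
    case True
    have rv: "x i i \<in> borel_measurable M"
      using indM unfolding indep_vars_def by (auto simp: J_def)
    have D: "distributed M lborel (\<lambda>\<omega>. Re (x i i \<omega>)) std_normal_density"
      using x unfolding standard_gue_array_def by blast
    have eq: "x i i \<omega> = of_real (Re (x i i \<omega>))" if "\<omega> \<in> space M" for \<omega>
    proof -
      have "x i i \<omega> = cnj (x i i \<omega>)" using x that unfolding standard_gue_array_def by blast
      from arg_cong[OF this, of Im] show ?thesis by (simp add: complex_eq_iff)
    qed
    have "distr M borel (x i i) = distr M borel (\<lambda>\<omega>. complex_of_real (Re (x i i \<omega>)))"
      by (rule distr_cong) (use eq in auto)
    also have "\<dots> = distr (distr M lborel (\<lambda>\<omega>. Re (x i i \<omega>))) borel complex_of_real"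
      using rv by (subst distr_distr) (auto simp: comp_def)
    also have "\<dots> = distr std_normal borel complex_of_real"
      by (simp add: distributed_distr_eq_density[OF D])
    also have "\<dots> = distr gauss borel (\<lambda>y::real^('n \<times> 'n). complex_of_real (y $ (i, i)))"
      unfolding distr_gauss_component[of "(i, i)", symmetric] by (subst distr_distr) (auto simp: comp_def)
    finally show ?thesis using True by (simp add: gue_entry_def[abs_def])
  next
    case False
    with that have ij: "j < i" by simp
    have e: "gue_entry i j y = Complex (1 / sqrt 2 * y $ (i, j)) (1 / sqrt 2 * y $ (j, i))" for y :: "real^('n \<times> 'n)"
      using ij by (auto simp: gue_entry_def)
    have nd: "distributed gauss lborel (\<lambda>y::real^('n \<times> 'n). 1 / sqrt 2 * y $ \<alpha>) (normal_density 0 (sqrt (1/2)))" for \<alpha>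
      using gauss.normal_density_affine[OF distributed_gauss_component[of \<alpha>], of "1 / sqrt 2" 0] by (simp add: real_sqrt_divide)
    have "distr gauss borel (gue_entry i j) = distr (density lborel (normal_density 0 (sqrt (1/2))) \<Otimes>\<^sub>M density lborel (normal_density 0 (sqrt (1/2)))) borel
       (\<lambda>p. complex_of_real (fst p) + \<i> * complex_of_real (snd p))"
      by (rule distr_complex_normal[OF prob_space_gauss])
        (use nd indep_var_gauss_components[of "(i, j)" "(j, i)" "1 / sqrt 2" "1 / sqrt 2"] False in \<open>auto simp: e\<close>)
    also have "\<dots> = distr M borel (x i j)"
      by (rule distr_complex_normal[OF M, symmetric]) (use x False in \<open>unfold standard_gue_array_def, blast+\<close>)
    finally show ?thesis ..
  qed
  have "distr M (Pi\<^sub>M J (\<lambda>_. borel)) (\<lambda>\<omega>. \<lambda>\<alpha>\<in>J. x (fst \<alpha>) (snd \<alpha>) \<omega>) = Pi\<^sub>M J (\<lambda>\<alpha>. distr M borel (x (fst \<alpha>) (snd \<alpha>)))"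
    using indM indep_vars_iff_distr_eq_PiM'[OF J, of "\<lambda>\<alpha>. x (fst \<alpha>) (snd \<alpha>)" "\<lambda>_. borel"]
    unfolding indep_vars_def by blast
  also have "\<dots> = Pi\<^sub>M J (\<lambda>\<alpha>. distr gauss borel (gue_entry (fst \<alpha>) (snd \<alpha>)))"
    by (intro PiM_cong refl comp) (auto simp: J_def)
  also have "\<dots> = distr gauss (Pi\<^sub>M J (\<lambda>_. borel)) (\<lambda>y. \<lambda>\<alpha>\<in>J. gue_entry (fst \<alpha>) (snd \<alpha>) y)"
    using indG gauss.indep_vars_iff_distr_eq_PiM'[OF J, of "\<lambda>\<alpha>. gue_entry (fst \<alpha>) (snd \<alpha>)" "\<lambda>_. borel"]
    unfolding gauss.indep_vars_def by force
  finally show ?thesis .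
qed

text \<open>One measurable map \<open>\<Phi>\<close> rebuilds either matrix from its lower triangle.
  Only laws are compared; no Gaussian vector is constructed on \<open>M\<close>.\<close>

lemma gue_with_profile_law:
  fixes \<Gamma> :: "real^'n::{finite,linorder}^'n::{finite,linorder}"
  assumes M: "prob_space M" and X: "gue_with_profile M \<Gamma> X"
  defines "\<sigma> \<equiv> \<lambda>i j. \<Gamma> $ i $ j / real CARD('n)"
  shows "X \<in> borel_measurable M" and "distr M borel X = distr gauss borel (gue_matrix \<sigma>)"
proof -
  obtain x where x: "standard_gue_array M x" and
    Xx: "\<And>\<omega> i j. \<omega> \<in> space M \<Longrightarrow> X \<omega> $ i $ j = of_real (sqrt (\<Gamma> $ i $ j)) * x i j \<omega> / of_real (sqrt (real CARD('n)))"
    using X unfolding gue_with_profile_def by blast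
  interpret prob_space M by fact
  let ?J = "{(i, j). j \<le> i} :: ('n \<times> 'n) set"
  let ?P = "Pi\<^sub>M ?J (\<lambda>_. borel :: complex measure)"
  define \<Phi> :: "('n \<times> 'n \<Rightarrow> complex) \<Rightarrow> ((complex, 'n) vec, 'n) vec" where
    "\<Phi> f = (\<chi> i j. of_real (sqrt (\<sigma> i j)) * (if j \<le> i then f (i, j) else cnj (f (j, i))))" for f
  have coord: "(\<lambda>f. f \<alpha>) \<in> borel_measurable ?P" if "\<alpha> \<in> ?J" for \<alpha>
    using that by (rule measurable_component_singleton)
  have \<Phi>_entry: "(\<lambda>f. \<Phi> f $ i $ j) \<in> borel_measurable ?P" for i j
  proof (cases "j \<le> i")
    case True
    then show ?thesis using coord[of "(i, j)"] by (simp add: \<Phi>_def)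
  next
    case False
    have "(\<lambda>f. cnj (f (j, i))) \<in> borel_measurable ?P"
      by (rule borel_measurable_continuous_on[OF _ coord]) (use False in \<open>auto intro!: continuous_intros\<close>)
    then show ?thesis using False by (simp add: \<Phi>_def)
  qed
  have \<Phi>: "\<Phi> \<in> borel_measurable ?P"
  proof (subst borel_measurable_euclidean_space, rule ballI)
    fix b :: "((complex, 'n) vec, 'n) vec" assume "b \<in> Basis"
    then obtain i j c where b: "b = axis i (axis j c)" by (auto simp: Basis_vec_def)
    show "(\<lambda>f. \<Phi> f \<bullet> b) \<in> borel_measurable ?P"
      unfolding b inner_axis by (intro borel_measurable_inner \<Phi>_entry borel_measurable_const)
  qed
  have XM: "X \<omega> = \<Phi> (\<lambda>\<alpha>\<in>?J. x (fst \<alpha>) (snd \<alpha>) \<omega>)" if "\<omega> \<in> space M" for \<omega>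
  proof -
    have sym: "x i j \<omega> = cnj (x j i \<omega>)" for i j
      using x that unfolding standard_gue_array_def by blast
    have "X \<omega> $ i $ j = of_real (sqrt (\<sigma> i j)) * x i j \<omega>" for i j
      using Xx[OF that] by (simp add: \<sigma>_def real_sqrt_divide)
    note entry = this
    show ?thesis
    proof (unfold vec_eq_iff, intro allI)
      fix i j
      show "X \<omega> $ i $ j = \<Phi> (\<lambda>\<alpha>\<in>?J. x (fst \<alpha>) (snd \<alpha>) \<omega>) $ i $ j"
        using sym[of i j] linear[of i j] by (cases "j \<le> i") (simp_all add: \<Phi>_def entry)
    qed
  qed
  have XG: "gue_matrix \<sigma> y = \<Phi> (\<lambda>\<alpha>\<in>?J. gue_entry (fst \<alpha>) (snd \<alpha>) y)" for y
    using linear by (auto simp: vec_eq_iff \<Phi>_def gue_matrix_def cnj_gue_entry)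
  have mM: "(\<lambda>\<omega>. \<lambda>\<alpha>\<in>?J. x (fst \<alpha>) (snd \<alpha>) \<omega>) \<in> measurable M ?P"
  proof (rule measurable_restrict)
    have "indep_vars (\<lambda>_. borel) (\<lambda>\<alpha>. x (fst \<alpha>) (snd \<alpha>)) ?J"
      using x unfolding standard_gue_array_def split_beta' by blast
    then show "x (fst \<alpha>) (snd \<alpha>) \<in> borel_measurable M" if "\<alpha> \<in> ?J" for \<alpha>
      using that unfolding indep_vars_def by blast
  qed
  have ge: "gue_entry i j \<in> borel_measurable gauss" for i j :: 'n
  proof (intro borel_measurable_gauss linear_continuous_on linear_conv_bounded_linear[THEN iffD1] linearI)
  qed (simp_all add: gue_entry_add gue_entry_scaleR)
  have mG: "(\<lambda>y. \<lambda>\<alpha>\<in>?J. gue_entry (fst \<alpha>) (snd \<alpha>) y) \<in> measurable gauss ?P"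
    by (intro measurable_restrict ge)
  show "X \<in> borel_measurable M"
    using measurable_compose[OF mM \<Phi>] by (rule measurable_cong[THEN iffD2, rotated]) (rule XM)
  have "distr M borel X = distr M borel (\<Phi> \<circ> (\<lambda>\<omega>. \<lambda>\<alpha>\<in>?J. x (fst \<alpha>) (snd \<alpha>) \<omega>))"
    by (intro distr_cong refl) (simp add: XM)
  also have "\<dots> = distr (distr M ?P (\<lambda>\<omega>. \<lambda>\<alpha>\<in>?J. x (fst \<alpha>) (snd \<alpha>) \<omega>)) borel \<Phi>"
    using distr_distr[OF \<Phi> mM] ..
  also have "\<dots> = distr gauss borel (\<Phi> \<circ> (\<lambda>y. \<lambda>\<alpha>\<in>?J. gue_entry (fst \<alpha>) (snd \<alpha>) y))"
    unfolding gue_entries_law[OF M x] by (rule distr_distr[OF \<Phi> mG])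
  also have "\<dots> = distr gauss borel (gue_matrix \<sigma>)"
    by (intro distr_cong refl) (simp add: XG)
  finally show "distr M borel X = distr gauss borel (gue_matrix \<sigma>)" .
qed

section \<open>The deterministic equivalent\<close>

lemma inner_conj_transpose:
  "(\<Sum>i\<in>UNIV. cnj ((A *v w) $ i) * x $ i) = (\<Sum>a\<in>UNIV. cnj (w $ a) * (conj_transpose A *v x) $ a)"
proof -
  have "(\<Sum>i\<in>UNIV. cnj ((A *v w) $ i) * x $ i) = (\<Sum>i\<in>UNIV. \<Sum>a\<in>UNIV. cnj (w $ a) * (cnj (A $ i $ a) * x $ i))"
    by (simp add: matrix_vector_mult_def sum_distrib_left sum_distrib_right mult_ac)
  also have "\<dots> = (\<Sum>a\<in>UNIV. cnj (w $ a) * (conj_transpose A *v x) $ a)"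
    by (subst sum.swap) (simp add: matrix_vector_mult_def sum_distrib_left)
  finally show ?thesis .
qed

lemma norm_sq_sum: "complex_of_real ((norm w)\<^sup>2) = (\<Sum>a\<in>UNIV. cnj (w $ a) * w $ a)" for w :: "complex^'n"
  unfolding norm_vec_sq of_real_sum complex_norm_square by (simp add: mult.commute)

lemma norm_orthonormal_columns:
  fixes U :: "complex^'k^'n"
  assumes "orthonormal_columns U"
  shows "norm (U *v w) = norm w"
proof -
  have "complex_of_real ((norm (U *v w))\<^sup>2) = complex_of_real ((norm w)\<^sup>2)"
    unfolding norm_sq_sum inner_conj_transpose
    using assms by (simp add: matrix_vector_mul_assoc orthonormal_columns_def)
  then show ?thesis by (simp only: of_real_eq_iff power2_eq_iff_nonneg norm_ge_zero)
qed

text \<open>With w = \<open>conj_transpose U *v x\<close>, the square of norm w is the inner product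
  of U w and x, and norm (U w) = norm w.\<close>

lemma norm_conj_transpose_orthonormal_columns:
  fixes U :: "complex^'k^'n"
  assumes "orthonormal_columns U"
  shows "norm (conj_transpose U *v x) \<le> norm x"
proof -
  let ?w = "conj_transpose U *v x"
  have "(norm ?w)\<^sup>2 = norm (complex_of_real ((norm ?w)\<^sup>2))" by (simp only: norm_of_real abs_power2)
  also have "\<dots> = norm (\<Sum>i\<in>UNIV. (\<chi> i. cnj ((U *v ?w) $ i)) $ i * x $ i)"
    unfolding norm_sq_sum inner_conj_transpose[symmetric] by simp
  also have "\<dots> \<le> norm (\<chi> i. cnj ((U *v ?w) $ i)) * norm x" by (rule norm_sum_mult_le)
  also have "norm (\<chi> i. cnj ((U *v ?w) $ i)) = norm (U *v ?w)" by (simp add: norm_vec_def)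
  also have "\<dots> = norm ?w" by (rule norm_orthonormal_columns[OF assms])
  finally show ?thesis by (cases "norm ?w = 0") (auto simp: power2_eq_square)
qed

lemma norm_diagonal_matrix_mult_le:
  fixes A :: "complex^'n^'n"
  assumes "diagonal_matrix A" "\<And>i. norm (A $ i $ i) \<le> c"
  shows "norm (A *v x) \<le> c * norm x"
proof (rule power2_le_imp_le)
  have c: "0 \<le> c" using order_trans[OF norm_ge_zero assms(2)] .
  have "(A *v x) $ i = A $ i $ i * x $ i" for i
  proof -
    have "(\<Sum>j\<in>UNIV. A $ i $ j * x $ j) = (\<Sum>j\<in>UNIV. if i = j then A $ i $ j * x $ j else 0)"
      using assms(1) by (intro sum.cong) (auto simp: diagonal_matrix_def)
    then show ?thesis by (simp add: matrix_vector_mult_def)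
  qed
  then have "(norm (A *v x))\<^sup>2 \<le> (\<Sum>i\<in>UNIV. (c * norm (x $ i))\<^sup>2)"
    unfolding norm_vec_sq[of "A *v x"] using assms(2)
    by (auto intro!: sum_mono power_mono mult_right_mono simp: norm_mult simp del: power_mult_distrib)
  then show "(norm (A *v x))\<^sup>2 \<le> (c * norm x)\<^sup>2"
    by (simp add: power_mult_distrib norm_vec_sq[of x] sum_distrib_left)
  show "0 \<le> c * norm x" using c by simp
qed

lemma norm_le_max_entry:
  fixes Q :: "complex^'k^'k"
  assumes "\<And>a b. norm (Q $ a $ b) \<le> c"
  shows "norm Q \<le> real CARD('k) * c"
proof (rule power2_le_imp_le)
  have c: "0 \<le> c" using order_trans[OF norm_ge_zero assms] .
  have "(norm Q)\<^sup>2 \<le> (\<Sum>a\<in>(UNIV::'k set). \<Sum>b\<in>(UNIV::'k set). c\<^sup>2)"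
    unfolding norm_matrix_sq using assms by (intro sum_mono power_mono) auto
  then show "(norm Q)\<^sup>2 \<le> (real CARD('k) * c)\<^sup>2"
    by (simp add: power_mult_distrib power2_eq_square mult_ac)
  show "0 \<le> real CARD('k) * c" using c by simp
qed

lemma norm_le_op_norm: "norm (A *v v) \<le> op_norm A * norm v" for A :: "complex^'m^'n"
  unfolding op_norm_def by (rule onorm) (rule matrix_vector_mul_bounded_linear)

lemma op_norm_le: "op_norm A \<le> c" if "\<And>v. norm (A *v v) \<le> c * norm v" for A :: "complex^'m^'n"
  unfolding op_norm_def by (rule onorm_le) (rule that)

lemma op_norm_pos:
  fixes A :: "complex^'m^'n"
  assumes "A \<noteq> 0"
  shows "0 < op_norm A"
proof (rule ccontr)
  assume "\<not> 0 < op_norm A"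
  then have "norm (A *v v) \<le> 0" for v
    using norm_le_op_norm[of A v] by (smt (verit) mult_nonpos_nonneg norm_ge_zero)
  then have "A *v v = 0 *v v" for v by simp
  then have "A = 0" by (metis matrix_eq)
  with assms show False by simp
qed

text \<open>The rank-one product of column \<open>b\<close> with the adjoint of column
  \<open>a\<close>. Pairing with it by the trace reads off one entry of the compression by
  \<open>U\<close>, and unit columns make its Frobenius norm 1.\<close>

definition entry_functional :: "complex^'k^'n::finite \<Rightarrow> 'k \<Rightarrow> 'k \<Rightarrow> complex^'n^'n" where
  "entry_functional U a b = (\<chi> k l. U $ k $ b * cnj (U $ l $ a))"

lemma trace_entry_functional: "trace (entry_functional U a b ** B) = (conj_transpose U ** B ** U) $ a $ b"
  by (simp add: trace_def matrix_matrix_mult_def entry_functional_def sum_distrib_left sum_distrib_right mult_ac)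

lemma norm_entry_functional:
  fixes U :: "complex^'k^'n"
  assumes "orthonormal_columns U"
  shows "norm (entry_functional U a b) = 1"
proof -
  have col: "(\<Sum>k\<in>UNIV. (norm (U $ k $ a))\<^sup>2) = 1" for a
  proof -
    have "(conj_transpose U ** U) $ a $ a = 1"
      using assms by (simp add: orthonormal_columns_def mat_def)
    then have "complex_of_real (\<Sum>k\<in>UNIV. (norm (U $ k $ a))\<^sup>2) = complex_of_real 1"
      unfolding of_real_sum complex_norm_square by (simp add: matrix_matrix_mult_def mult.commute)
    then show ?thesis by (simp only: of_real_eq_iff)
  qed
  have "(norm (entry_functional U a b))\<^sup>2 = (\<Sum>k\<in>UNIV. \<Sum>l\<in>UNIV. (norm (U $ k $ b))\<^sup>2 * (norm (U $ l $ a))\<^sup>2)"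
    unfolding norm_matrix_sq entry_functional_def by (simp add: norm_mult power_mult_distrib)
  also have "\<dots> = 1\<^sup>2" by (simp flip: sum_distrib_left sum_distrib_right add: col)
  finally show ?thesis by (subst (asm) power2_eq_iff_nonneg) auto
qed

section \<open>The scalar form of the deterministic equivalent, and the threshold on Im z\<close>

lemma gamma_max_sq_ge: "\<Gamma> $ i $ j \<le> gamma_max_sq \<Gamma>" for \<Gamma> :: "real^'n^'n"
proof -
  have "finite (range (\<lambda>(i, j). \<Gamma> $ i $ j))" by simp
  moreover have "{\<Gamma> $ i $ j | i j. True} = range (\<lambda>(i, j). \<Gamma> $ i $ j)" by auto
  ultimately show ?thesis unfolding gamma_max_sq_def by (intro Max_ge) auto
qed

text \<open>For diagonal \<open>Y\<close> the matrix to be inverted is diagonal, so the equation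
  splits into scalar ones. Values of \<open>G\<close> in \<open>D_minus\<close> keep the
  denominators \<open>w\<close> in the upper half plane, hence nonzero.\<close>

lemma G_square_fixed_point:
  fixes \<Gamma> :: "real^'n^'n" and Y :: "complex^'n^'n"
  assumes G: "G_square \<Gamma> Y G" and \<Gamma>: "\<And>i j. 0 \<le> \<Gamma> $ i $ j"
    and Y: "hermitian_matrix Y" "diagonal_matrix Y" and z: "0 < Im z"
  shows "diagonal_matrix (G (mat z))" and "Im (G (mat z) $ i $ i) < 0"
    and "G (mat z) $ i $ i * (z - Y $ i $ i - (\<Sum>j\<in>UNIV. of_real (\<Gamma> $ i $ j / real CARD('n)) * G (mat z) $ j $ j)) = 1"
proof -
  have "mat z \<in> D_plus" using z by (auto simp: D_plus_def diagonal_matrix_def mat_def)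
  then have minus: "G (mat z) \<in> D_minus"
    and eq: "G (mat z) = diag_part (matrix_inv (mat z - R_map \<Gamma> (G (mat z)) - Y))"
    using G unfolding G_square_def by blast+
  show "diagonal_matrix (G (mat z))" and neg: "Im (G (mat z) $ i $ i) < 0" for i
    using minus by (auto simp: D_minus_def)
  define w where "w i = z - Y $ i $ i - (\<Sum>j\<in>UNIV. of_real (\<Gamma> $ i $ j / real CARD('n)) * G (mat z) $ j $ j)" for i
  have w0: "w i \<noteq> 0" for i
  proof -
    have "(\<Sum>j\<in>UNIV. \<Gamma> $ i $ j / real CARD('n) * Im (G (mat z) $ j $ j)) \<le> 0"
      using \<Gamma> neg by (intro sum_nonpos mult_nonneg_nonpos) (auto intro: less_imp_le)
    moreover have "Im (Y $ i $ i) = 0"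
      using hermitian_matrix_nth[OF Y(1), of i i] by (simp add: complex_eq_iff)
    ultimately have "0 < Im (w i)" using z by (simp add: w_def Im_sum)
    then show ?thesis by auto
  qed
  have "mat z - R_map \<Gamma> (G (mat z)) - Y = (\<chi> i j. if i = j then w i else 0)"
    using Y(2) by (auto simp: vec_eq_iff mat_def R_map_def w_def diagonal_matrix_def)
  moreover have "matrix_inv (\<chi> i j. if i = j then w i else 0) = (\<chi> i j. if i = j then 1 / w i else 0)"
    by (rule matrix_inv_unique)
      (auto simp: vec_eq_iff matrix_matrix_mult_def mat_def w0 if_distrib[of "\<lambda>c. c * _"] cong: if_cong)
  ultimately have "G (mat z) $ i $ i = 1 / w i" for i
    by (subst eq) (simp add: diag_part_def)
  then show "G (mat z) $ i $ i * (z - Y $ i $ i - (\<Sum>j\<in>UNIV. of_real (\<Gamma> $ i $ j / real CARD('n)) * G (mat z) $ j $ j)) = 1"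
    using w0[of i] unfolding w_def[symmetric] by simp
qed

text \<open>In the sixth power the exponents -1/4 and -1/6 become -3/2 and -1; division by y^5 then
  yields \<open>small\<close> in the theorem.\<close>

lemma sixth_power_threshold:
  fixes N g y \<delta> :: real
  assumes "0 < N" "0 < g" "\<delta> < 1" and le: "g * N powr (-1/4) * (1 - \<delta>) powr (-1/6) \<le> y"
  shows "g ^ 6 * N powr (-3/2) \<le> (1 - \<delta>) * y ^ 6"
proof -
  have "(g * N powr (-1/4) * (1 - \<delta>) powr (-1/6)) ^ 6 \<le> y ^ 6"
    using assms by (intro power_mono) auto
  moreover have "(N powr (-1/4)) ^ 6 = N powr (-3/2)" "((1 - \<delta>) powr (-1/6)) ^ 6 = (1 - \<delta>) powr - 1"
    using assms by (simp_all flip: powr_realpow add: powr_powr)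
  ultimately have "g ^ 6 * N powr (-3/2) * (1 - \<delta>) powr - 1 \<le> y ^ 6"
    by (simp add: power_mult_distrib)
  then show ?thesis
    using assms by (simp add: powr_minus field_simps)
qed

context gue_model
begin

text \<open>The tail bound reaches \<open>X\<close> through its law, which requires a Borel event in
  the space of all matrices. There the inverse need not exist; composing with the Hermitian part
  \<open>L\<close>, which fixes the values of \<open>X\<close>, makes the statistic continuous
  everywhere.\<close>

lemma hermitian_part_law:
  assumes A: "norm A = 1" and t: "0 \<le> t"
    and X: "X \<in> borel_measurable M" "distr M borel X = distr gauss borel (gue_matrix \<sigma>)"
    and herm: "\<And>\<omega>. \<omega> \<in> space M \<Longrightarrow> hermitian_matrix (X \<omega>)"
  shows "{\<omega> \<in> space M. t \<le> norm (trace (A ** matrix_inv (mat z - (X \<omega> + Y))) - (\<integral>x. F A x \<partial>gauss))} \<in> sets M"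
    and "measure M {\<omega> \<in> space M. t \<le> norm (trace (A ** matrix_inv (mat z - (X \<omega> + Y))) - (\<integral>x. F A x \<partial>gauss))}
      \<le> 2 * exp (- (t\<^sup>2 * (Im z) ^ 4 / (2 * s)))"
proof -
  define L where "L B = (1/2) *\<^sub>R (B + conj_transpose B)" for B :: "((complex, 'n) vec, 'n) vec"
  have L_id: "L B = B" if "hermitian_matrix B" for B
    using hermitian_matrix_nth[OF that] by (simp add: L_def vec_eq_iff complex_eq_iff)
  have L_herm: "hermitian_matrix (L B + Y)" for B
    using hermitian_matrix_nth[OF Y_herm] by (simp add: hermitian_matrix_def vec_eq_iff L_def add.commute)
  have "linear L"
    by (rule linearI) (simp_all add: L_def vec_eq_iff algebra_simps complex_eq_iff)
  then have L: "bounded_linear L" by (rule linear_conv_bounded_linear[THEN iffD1])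
  have z: "Im z \<noteq> 0" using z_pos by simp
  have "continuous_on UNIV (\<lambda>B. matrix_inv (mat z - (L B + Y)))"
    by (intro continuous_at_imp_continuous_on ballI has_derivative_continuous[OF has_derivative_resolvent[OF L L_herm z]])
  from bounded_linear.continuous_on[OF bounded_linear_trace_mult this, of A]
  have c: "continuous_on UNIV (\<lambda>B. norm (trace (A ** matrix_inv (mat z - (L B + Y))) - (\<integral>x. F A x \<partial>gauss)))"
    by (intro continuous_intros)
  define S where "S = {B. t \<le> norm (trace (A ** matrix_inv (mat z - (L B + Y))) - (\<integral>x. F A x \<partial>gauss))}"
  have S: "S \<in> sets borel"
    unfolding S_def by (intro borel_closed closed_Collect_le c continuous_on_const)
  have E: "{\<omega> \<in> space M. t \<le> norm (trace (A ** matrix_inv (mat z - (X \<omega> + Y))) - (\<integral>x. F A x \<partial>gauss))} = X -` S \<inter> space M"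
    by (auto simp: S_def L_id herm)
  show "{\<omega> \<in> space M. t \<le> norm (trace (A ** matrix_inv (mat z - (X \<omega> + Y))) - (\<integral>x. F A x \<partial>gauss))} \<in> sets M"
    unfolding E using X(1) S by (rule measurable_sets)
  have gm: "gue_matrix \<sigma> \<in> borel_measurable gauss"
    by (intro borel_measurable_gauss linear_continuous_on bounded_linear_gue_matrix)
  have "measure M (X -` S \<inter> space M) = measure (distr gauss borel (gue_matrix \<sigma>)) S"
    unfolding X(2)[symmetric] by (rule measure_distr[OF X(1) S, symmetric])
  also have "\<dots> = measure gauss (gue_matrix \<sigma> -` S \<inter> space gauss)"
    by (rule measure_distr[OF gm S])
  also have "gue_matrix \<sigma> -` S \<inter> space gauss = {x. t \<le> norm (F A x - (\<integral>x. F A x \<partial>gauss))}"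
    by (auto simp: S_def L_id[OF hermitian_gue] F_def R_def)
  also have "measure gauss \<dots> \<le> 2 * exp (- (t\<^sup>2 / (2 * (s * ((norm A)\<^sup>2 / (Im z) ^ 4)))))"
    by (rule F_concentration) (use A t in auto)
  finally show "measure M {\<omega> \<in> space M. t \<le> norm (trace (A ** matrix_inv (mat z - (X \<omega> + Y))) - (\<integral>x. F A x \<partial>gauss))}
      \<le> 2 * exp (- (t\<^sup>2 * (Im z) ^ 4 / (2 * s)))"
    unfolding E by (simp add: A)
qed

lemma expectation_F: "(\<integral>x. F A x \<partial>gauss) = trace (A ** (\<chi> i j. if i = j then g i else 0))"
proof -
  have "F A x = (\<Sum>i\<in>UNIV. \<Sum>j\<in>UNIV. A $ i $ j * R x $ j $ i)" for x
    by (simp add: F_def trace_def matrix_matrix_mult_def)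
  then have "(\<integral>x. F A x \<partial>gauss) = (\<Sum>i\<in>UNIV. \<Sum>j\<in>UNIV. A $ i $ j * (\<integral>x. R x $ j $ i \<partial>gauss))"
    using integrable_R_entry by simp
  moreover have "(\<integral>x. R x $ j $ i \<partial>gauss) = (if j = i then g j else 0)" for i j
    using expectation_offdiagonal[of j i] by (simp add: g_def)
  ultimately show ?thesis
    by (simp add: trace_def matrix_matrix_mult_def)
qed

end

section \<open>Union bound over the entries, combined with the bias\<close>

theorem corollary1p3:
  fixes M :: "'w measure"
    and \<Gamma> :: "real^'n::{finite,linorder}^'n::{finite,linorder}"
    and X :: "'w \<Rightarrow> complex^'n::{finite,linorder}^'n::{finite,linorder}"
    and Y Z :: "complex^'n::{finite,linorder}^'n::{finite,linorder}"
    and U :: "complex^'k::finite^'n::{finite,linorder}"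
    and \<Theta> :: "complex^'k^'k"
    and G :: "complex^'n::{finite,linorder}^'n::{finite,linorder} \<Rightarrow> complex^'n::{finite,linorder}^'n::{finite,linorder}"
    and \<delta> d :: real
    and z :: complex
  assumes "prob_space M"
    and "transpose \<Gamma> = \<Gamma>" and "\<And>i j. 0 \<le> \<Gamma> $ i $ j" and "0 < gamma_max \<Gamma>"
    and "gue_with_profile M \<Gamma> X"
    and "hermitian_matrix Y" and "diagonal_matrix Y"
    and "hermitian_matrix Z" and "rank Z = CARD('k)" and "Z = U ** \<Theta> ** conj_transpose U"
    and "orthonormal_columns U"
    and "diagonal_matrix \<Theta>" and "\<And>a. \<Theta> $ a $ a \<in> \<real>" and "\<And>a. \<Theta> $ a $ a \<noteq> 0"
    and "G_square \<Gamma> Y G"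
    and "0 < \<delta>" and "\<delta> < 1"
    and "0 < Im z"
    and "gamma_max \<Gamma> * real CARD('n) powr (-1/4) * (1 - \<delta>) powr (-1/6) \<le> Im z"
    and "0 < d"
  shows "measure M {\<omega> \<in> space M.
            op_norm (beta U \<Theta> (X \<omega>) Y z - beta_square U \<Theta> G z)
              \<ge> op_norm \<Theta> * eps' (CARD('n)) (CARD('k)) (gamma_max \<Gamma>) (Im z) \<delta> d}
         \<le> 4 * real (CARD('k)) ^ 2 * real CARD('n) powr (- d)"
proof -
  interpret prob_space M by fact
  define N where "N = real CARD('n)"
  define k where "k = real CARD('k)"
  define \<gamma> where "\<gamma> = gamma_max \<Gamma>"
  define y where "y = Im z"
  define \<sigma> where "\<sigma> i j = \<Gamma> $ i $ j / real CARD('n)" for i j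
  define s where "s = \<gamma>\<^sup>2 / N"
  have N: "1 \<le> N" and k: "1 \<le> k" unfolding N_def k_def by (simp_all add: Suc_leI)
  have \<gamma>: "0 < \<gamma>" and y: "0 < y" using assms by (simp_all add: \<gamma>_def y_def)
  have \<gamma>2: "\<gamma>\<^sup>2 = gamma_max_sq \<Gamma>"
    using \<gamma> unfolding \<gamma>_def gamma_max_def by (simp add: real_sqrt_gt_0_iff)
  have Gsym: "\<Gamma> $ i $ j = \<Gamma> $ j $ i" for i j
    using arg_cong[OF assms(2), of "\<lambda>A. A $ i $ j"] by (simp add: transpose_def)
  interpret gue_model \<sigma> s Y z
  proof
    show "\<sigma> i j = \<sigma> j i" "0 \<le> \<sigma> i j" "\<sigma> i j \<le> s" for i j
      using Gsym[of i j] assms(3) gamma_max_sq_ge[of \<Gamma> i j] N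
      by (simp_all add: \<sigma>_def s_def \<gamma>2 N_def divide_right_mono)
    show "0 < s" using \<gamma> N by (simp add: s_def)
  qed fact+
  have Ns: "N * s = \<gamma>\<^sup>2" using N by (simp add: s_def)
  define v where "v i = G (mat z) $ i $ i" for i
  have v: "v i * (z - Y $ i $ i - (\<Sum>j\<in>UNIV. of_real (\<sigma> i j) * v j)) = 1" "Im (v i) < 0" for i
    unfolding v_def \<sigma>_def using G_square_fixed_point(2,3)[OF assms(15,3,6,7,18)] by auto
  define \<epsilon> where "\<epsilon> = s\<^sup>2 * sqrt N / y ^ 5"
  have N32: "N powr (3/2) = N * sqrt N"
    using N powr_add[of N 1 "1/2"] by (simp add: powr_half_sqrt)
  have \<epsilon>_eq: "\<epsilon> = \<gamma> ^ 4 / (N powr (3/2) * y ^ 5)"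
  proof -
    have "\<epsilon> = \<gamma> ^ 4 * sqrt N / ((sqrt N * sqrt N) * N * y ^ 5)"
      using N by (simp add: \<epsilon>_def s_def power_divide power2_eq_square eval_nat_numeral)
    also have "\<dots> = \<gamma> ^ 4 / (N powr (3/2) * y ^ 5)"
      unfolding N32 using N y by (simp add: field_simps del: real_sqrt_mult_self)
    finally show ?thesis .
  qed
  have small: "N * s * \<epsilon> \<le> (1 - \<delta>) * y"
  proof -
    have "\<gamma> ^ 6 * N powr (-3/2) \<le> (1 - \<delta>) * y ^ 6"
      using sixth_power_threshold[of N \<gamma> \<delta> y] N \<gamma> assms(17,19) by (simp add: N_def \<gamma>_def y_def)
    then have "\<gamma> ^ 6 * N powr (-3/2) / y ^ 5 \<le> (1 - \<delta>) * y ^ 6 / y ^ 5"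
      using y by (intro divide_right_mono) auto
    moreover have "N powr (-3/2) = 1 / N powr (3/2)" using powr_minus_divide[of N "3/2"] by simp
    ultimately show ?thesis
      unfolding Ns \<epsilon>_eq using y by (simp add: eval_nat_numeral mult_ac)
  qed
  define b where "b = (1 + \<gamma>\<^sup>2 / (\<delta> * y\<^sup>2)) * \<epsilon>"
  have bias: "norm (g i - v i) \<le> b" for i
    using bias_bound[OF v, of \<epsilon> \<delta> i] assms(16) small Ns by (simp add: b_def \<epsilon>_def N_def y_def)
  \<comment> \<open>With this \<open>t\<close> the exponent in \<open>tail\<close> is d ln N. The
    two terms of \<open>eps'\<close> are \<open>k * t\<close> for the fluctuation and
    \<open>b\<close> for the bias.\<close>
  define t where "t = sqrt 2 * \<gamma> * (sqrt (d * ln N) / y\<^sup>2) * N powr (-1/2)"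
  have t: "0 \<le> t" using \<gamma> N assms(20) by (simp add: t_def)
  have eps: "eps' CARD('n) CARD('k) (gamma_max \<Gamma>) (Im z) \<delta> d = k * t + b"
    using y by (simp add: eps'_def b_def t_def \<epsilon>_eq N_def k_def \<gamma>_def y_def)
  have tail: "2 * exp (- (t\<^sup>2 * y ^ 4 / (2 * s))) = 2 * N powr (- d)"
  proof -
    have "N powr (-1/2) = 1 / sqrt N"
      using N powr_minus_divide[of N "1/2"] by (simp add: powr_half_sqrt)
    then have N2: "(N powr (-1/2))\<^sup>2 = 1 / N"
      using N by (simp add: power_divide)
    have "t\<^sup>2 = (sqrt 2)\<^sup>2 * \<gamma>\<^sup>2 * ((sqrt (d * ln N))\<^sup>2 / (y\<^sup>2)\<^sup>2) * (N powr (-1/2))\<^sup>2"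
      unfolding t_def power_mult_distrib power_divide ..
    also have "\<dots> = 2 * \<gamma>\<^sup>2 * (d * ln N / y ^ 4) * (1 / N)"
      unfolding N2 using N assms(20) by simp
    finally have "t\<^sup>2 = 2 * \<gamma>\<^sup>2 * (d * ln N / y ^ 4) * (1 / N)" .
    then have "t\<^sup>2 * y ^ 4 / (2 * s) = d * ln N"
      using N y \<gamma> by (simp add: s_def)
    then show ?thesis using N by (simp add: powr_def)
  qed
  let ?Q = "\<lambda>\<omega>. matrix_inv (mat z - (X \<omega> + Y))"
  let ?E = "\<chi> i j. if i = j then g i else 0"
  let ?A = "entry_functional U"
  define S where "S p = {\<omega> \<in> space M. t \<le> norm (trace (?A (fst p) (snd p) ** ?Q \<omega>) - (\<integral>x. F (?A (fst p) (snd p)) x \<partial>gauss))}" for p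
  have law: "X \<in> borel_measurable M" "distr M borel X = distr gauss borel (gue_matrix \<sigma>)"
    using gue_with_profile_law[OF assms(1,5)] unfolding \<sigma>_def[abs_def] by auto
  have herm: "hermitian_matrix (X \<omega>)" if "\<omega> \<in> space M" for \<omega>
  proof -
    from assms(5) obtain x where x: "standard_gue_array M x" and
      "\<forall>\<omega>\<in>space M. \<forall>i j. X \<omega> $ i $ j = of_real (sqrt (\<Gamma> $ i $ j)) * x i j \<omega> / of_real (sqrt (real CARD('n)))"
      unfolding gue_with_profile_def by (elim exE conjE)
    then have Xx: "X \<omega> $ i $ j = of_real (sqrt (\<Gamma> $ i $ j)) * x i j \<omega> / of_real (sqrt (real CARD('n)))" for i j
      using that by simp
    have "x i j \<omega> = cnj (x j i \<omega>)" for i j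
      using x that unfolding standard_gue_array_def by blast
    then have "cnj (x j i \<omega>) = x i j \<omega>" for i j
      by (rule sym)
    then show ?thesis
      by (simp add: hermitian_matrix_def vec_eq_iff Xx Gsym)
  qed
  have S: "S p \<in> sets M" and S_le: "measure M (S p) \<le> 2 * N powr (- d)" for p
    unfolding S_def tail[symmetric] y_def
    by (rule hermitian_part_law[OF norm_entry_functional[OF assms(11)] t law herm], assumption)+
  let ?V = "{\<omega> \<in> space M. op_norm \<Theta> * eps' CARD('n) CARD('k) (gamma_max \<Gamma>) (Im z) \<delta> d
      \<le> op_norm (beta U \<Theta> (X \<omega>) Y z - beta_square U \<Theta> G z)}"
  have sub: "?V \<subseteq> (\<Union>p\<in>UNIV. S p)"
  proof (rule ccontr)
    assume "\<not> ?V \<subseteq> (\<Union>p\<in>UNIV. S p)"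
    then obtain \<omega> where \<omega>: "\<omega> \<in> space M" "\<omega> \<in> ?V" and notS: "\<And>p. \<omega> \<notin> S p" by auto
    define P where "P = conj_transpose U ** ?Q \<omega> ** U - conj_transpose U ** ?E ** U"
    have P: "norm (P $ a $ b) < t" for a b
      using notS[of "(a, b)"] \<omega>(1) unfolding S_def expectation_F trace_entry_functional by (simp add: P_def)
    \<comment> \<open>The event of the theorem includes equality, so its exclusion needs a strict
      bound, while \<open>norm_le_max_entry\<close> is weak. The maximum of finitely many entries
      below \<open>t\<close> is still below \<open>t\<close>.\<close>
    define \<tau> where "\<tau> = Max (range (\<lambda>(a, b). norm (P $ a $ b)))"
    have "\<tau> \<in> range (\<lambda>(a, b). norm (P $ a $ b))" unfolding \<tau>_def by (rule Max_in) auto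
    then have \<tau>: "\<tau> < t" using P by auto
    have "norm (P $ a $ b) \<le> \<tau>" for a b unfolding \<tau>_def by (rule Max_ge) auto
    then have nP: "norm P \<le> k * \<tau>" unfolding k_def by (rule norm_le_max_entry)
    define C where "C = ?E - G (mat z)"
    have "diagonal_matrix C" "norm (C $ i $ i) \<le> b" for i
      using G_square_fixed_point(1)[OF assms(15,3,6,7,18)] bias[of i]
      by (simp_all add: C_def diagonal_matrix_def v_def)
    then have nC: "norm (C *v x) \<le> b * norm x" for x by (rule norm_diagonal_matrix_mult_le)
    \<comment> \<open>The deviation splits into the fluctuation \<open>P\<close> and the compressed
      bias \<open>C\<close>; the common right factor \<Theta> leaves its operator norm in
      front.\<close>
    have diff: "beta U \<Theta> (X \<omega>) Y z - beta_square U \<Theta> G z = - ((P + conj_transpose U ** C ** U) ** \<Theta>)"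
      unfolding beta_def beta_square_def P_def C_def diff_diff_eq[of "mat z"]
      by (simp add: matrix_mult.add_left matrix_mult.diff_left matrix_mult.diff_right)
    have "norm ((beta U \<Theta> (X \<omega>) Y z - beta_square U \<Theta> G z) *v w) \<le> ((k * \<tau> + b) * op_norm \<Theta>) * norm w" for w
    proof -
      have b0: "0 \<le> k * \<tau> + b"
        using order_trans[OF norm_ge_zero nP] order_trans[OF norm_ge_zero bias] by simp
      let ?w = "\<Theta> *v w"
      have "(beta U \<Theta> (X \<omega>) Y z - beta_square U \<Theta> G z) *v w = - (P *v ?w + conj_transpose U *v (C *v (U *v ?w)))"
        unfolding diff using matrix_vector_mult_diff_rdistrib[of 0 "(P + conj_transpose U ** C ** U) ** \<Theta>" w]
        by (simp add: matrix_vector_mul_assoc[symmetric] matrix_vector_mult_add_rdistrib)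
      also have "norm \<dots> \<le> norm (P *v ?w) + norm (conj_transpose U *v (C *v (U *v ?w)))"
        unfolding norm_minus_cancel by (rule norm_triangle_ineq)
      also have "norm (P *v ?w) \<le> k * \<tau> * norm ?w"
        by (rule order_trans[OF norm_matrix_vector_le mult_right_mono[OF nP]]) simp
      also have "norm (conj_transpose U *v (C *v (U *v ?w))) \<le> b * norm ?w"
        using order_trans[OF norm_conj_transpose_orthonormal_columns[OF assms(11)] nC, of "U *v ?w"]
        by (simp add: norm_orthonormal_columns[OF assms(11)])
      also have "k * \<tau> * norm ?w + b * norm ?w = (k * \<tau> + b) * norm ?w" by (simp add: algebra_simps)
      also have "\<dots> \<le> (k * \<tau> + b) * (op_norm \<Theta> * norm w)"
        by (intro mult_left_mono norm_le_op_norm b0)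
      finally show ?thesis by (simp add: mult_ac)
    qed
    then have "op_norm (beta U \<Theta> (X \<omega>) Y z - beta_square U \<Theta> G z) \<le> (k * \<tau> + b) * op_norm \<Theta>"
      by (rule op_norm_le)
    also have "\<dots> < (k * t + b) * op_norm \<Theta>"
    proof (intro mult_strict_right_mono op_norm_pos)
      show "k * \<tau> + b < k * t + b" using \<tau> k by simp
      show "\<Theta> \<noteq> 0" using assms(14) by (metis zero_index)
    qed
    finally show False using \<omega>(2) unfolding eps by (simp add: mult.commute)
  qed
  show ?thesis
  \<comment> \<open>A set that is not measurable has \<open>measure\<close> 0 by convention, so the
    estimate holds in either case.\<close>
  proof (cases "?V \<in> sets M")
    case True
    have "measure M ?V \<le> measure M (\<Union>p\<in>UNIV. S p)"
      using S sub by (intro finite_measure_mono) auto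
    also have "\<dots> \<le> (\<Sum>p\<in>UNIV. measure M (S p))"
      using S by (intro finite_measure_subadditive_finite) auto
    \<comment> \<open>Each of the k^2 entries contributes 2 N^(-d), half of what the constant 4
      allows.\<close>
    also have "\<dots> \<le> (\<Sum>p\<in>(UNIV :: ('k \<times> 'k) set). 2 * N powr (- d))"
      by (intro sum_mono S_le)
    also have "\<dots> = 2 * k\<^sup>2 * N powr (- d)"
      by (simp add: k_def power2_eq_square flip: UNIV_Times_UNIV)
    also have "\<dots> \<le> 4 * k\<^sup>2 * N powr (- d)"
      by (intro mult_right_mono) auto
    finally show ?thesis by (simp add: k_def N_def)
  next
    case False
    then have "measure M ?V = 0" by (rule measure_notin_sets)
    then show ?thesis by simp
  qed
qed

end
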